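(* Let $$P(z)=\prod_{d=1}^{\infty}(1-z^d)^{-1/d}=\sum_{n=0}^{\infty}\frac{p_n}{n!}z^n,$$ viewed as a formal power series in $z$ with rational coefficients (equivalently, as an analytic function for $|z|<1$). \begin{enumerate} \item (Combinatorial description.) For every $n\ge 0$, $p_n$ equals the number of pairs $(\sigma,\lambda)$, where $\sigma$ is a permutation of $\{1,\dots,n\}$ and $\lambda$ is a function assigning to each cycle of $\sigma$ (in its decomposition into disjoint cycles, fixed points counted as cycles of length $1$) a positive divisor of the length of that cycle. \item (Asymptotic behavior.) Let $c=\pi^2/12-\gamma^2/2-2\gamma_1$ and $w_n=\operatorname{W}(e^{\gamma}n)$. Then, as $n\to\infty$, $$\frac{p_n}{n!}\sim\frac{(w_n/n)^{1-\gamma}}{\sqrt{2\pi\log(n/w_n)}}\exp\Big(c+w_n+\frac{\log^2(w_n/n)}{2}\Big).$$ In particular, $\log\frac{p_n}{n!}\sim\frac{\log^2 n}{2}$. \end{enumerate}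
   Context: $\log$ is the natural logarithm. $\gamma=\gamma_0$ is the Euler–Mascheroni constant and $\gamma_1$ is the first Stieltjes constant, where the Stieltjes constants $\gamma_n$ are defined by the Laurent expansion $\zeta(s)=\frac{1}{s-1}+\sum_{n\ge0}\frac{(-1)^n\gamma_n}{n!}(s-1)^n$ of the Riemann zeta function at $s=1$. $\operatorname{W}$ denotes the principal branch of the Lambert W function (the inverse of $x\mapsto xe^x$ on $[0,\infty)$). $a_n\sim b_n$ means $a_n/b_n\to1$. *)

theory Defs
  imports
    "HOL-Complex_Analysis.Complex_Analysis"
    "HOL-Combinatorics.Orbits"
begin

text \<open>
  The factor \<open>(1 - z\<^sup>d) powr (-1/d)\<close> is the binomial series \<open>(1 + z) powr (-1/d)\<close> composed
  with \<open>-z\<^sup>d\<close>.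
\<close>
definition P_factor :: "nat \<Rightarrow> rat fps" where
  "P_factor d = fps_compose (fps_binomial (- 1 / of_nat d)) (- (fps_X ^ d))"

text \<open>The infinite product is taken in the \<open>X\<close>-adic topology on formal power series.\<close>
definition P_series :: "rat fps" where
  "P_series = (\<Prod>d. P_factor (Suc d))"

definition p_seq :: "nat \<Rightarrow> rat" where
  "p_seq n = fact n * fps_nth P_series n"

lemma P_factor_nth_less:
  assumes "n < d"
  shows "fps_nth (P_factor d) n = (if n = 0 then 1 else 0)"
proof -
  have "fps_nth ((- (fps_X ^ d) :: rat fps) ^ i) n = 0" if "i > 0" for i
  proof -
    have "(- (fps_X ^ d) :: rat fps) ^ i = fps_const ((-1) ^ i) * fps_X ^ (d * i)"
      by (simp add: power_minus[of "fps_X ^ d"] power_mult flip: fps_const_power fps_const_neg)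
    moreover have "n < d * i"
      using assms that by (metis One_nat_def Suc_leI less_le_trans mult.right_neutral mult_le_mono2)
    ultimately show ?thesis
      by (simp only: fps_mult_left_const_nth fps_X_power_nth) simp
  qed
  then have "fps_nth (P_factor d) n =
      (\<Sum>i\<in>{0}. ((- 1 / of_nat d) gchoose i) * fps_nth ((- (fps_X ^ d) :: rat fps) ^ i) n)"
    unfolding P_factor_def fps_compose_nth fps_binomial_nth
    by (intro sum.mono_neutral_right) auto
  then show ?thesis by simp
qed

lemma P_series_has_prod: "(\<lambda>d. P_factor (Suc d)) has_prod P_series"
proof -
  define S where "S = (\<lambda>N. \<Prod>d\<le>N. P_factor (Suc d))"
  have mult_nth: "fps_nth (A * P_factor (Suc N)) n = fps_nth A n" if "n \<le> N" for A N n
  proof -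
    have "fps_nth (A * P_factor (Suc N)) n =
        (\<Sum>i=0..n. fps_nth A i * fps_nth (P_factor (Suc N)) (n - i))"
      by (simp add: fps_mult_nth)
    also have "\<dots> = (\<Sum>i=0..n. if i = n then fps_nth A i else 0)"
      using that by (intro sum.cong) (auto simp: P_factor_nth_less)
    finally show ?thesis by simp
  qed
  have stab: "fps_nth (S N) n = fps_nth (S n) n" if "n \<le> N" for n N
    using that
  proof (induction N rule: dec_induct)
    case (step N)
    then show ?case by (simp add: S_def mult_nth)
  qed simp
  define L where "L = Abs_fps (\<lambda>n. fps_nth (S n) n)"
  have "S \<longlonglongrightarrow> L"
  proof (rule tendsto_fpsI)
    fix n
    show "\<forall>\<^sub>F N in sequentially. fps_nth (S N) n = fps_nth L n"
      unfolding L_def fps_nth_Abs_fps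
      by (rule eventually_mono[OF eventually_ge_at_top[of n]]) (rule stab)
  qed
  have "fps_nth L 0 = 1"
    by (simp add: L_def S_def P_factor_nth_less)
  then have "L \<noteq> 0" by auto
  with \<open>S \<longlonglongrightarrow> L\<close> have *: "(\<lambda>d. P_factor (Suc d)) has_prod L"
    by (simp add: has_prod_def raw_has_prod_def S_def)
  have uniq: "L' = L" if "(\<lambda>d. P_factor (Suc d)) has_prod L'" for L'
  proof -
    have "P_factor (Suc d) \<noteq> 0" for d
      using P_factor_nth_less[of 0 "Suc d"] by auto
    with that have "S \<longlonglongrightarrow> L'"
      by (auto simp: has_prod_def raw_has_prod_def S_def)
    with \<open>S \<longlonglongrightarrow> L\<close> show ?thesis by (rule LIMSEQ_unique[rotated])
  qed
  have "P_series = L"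
    unfolding P_series_def prodinf_def using * uniq by (rule the_equality)
  with * show ?thesis by simp
qed

text \<open>
  The cycles of a permutation of \<open>A\<close>, each represented by its underlying set of points (so that
  its length is the cardinality); a fixed point \<open>x\<close> contributes the cycle \<open>{x}\<close>.
\<close>
definition perm_cycles :: "'a set \<Rightarrow> ('a \<Rightarrow> 'a) \<Rightarrow> 'a set set" where
  "perm_cycles A \<sigma> = orbit \<sigma> ` A"

definition divisor_labelled_perms :: "nat \<Rightarrow> ((nat \<Rightarrow> nat) \<times> (nat set \<Rightarrow> nat)) set" where
  "divisor_labelled_perms n =
     (SIGMA \<sigma>:{\<sigma>. \<sigma> permutes {1..n}}.
        \<Pi>\<^sub>E C\<in>perm_cycles {1..n} \<sigma>. {d. d > 0 \<and> d dvd card C})"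

text \<open>
  The unique holomorphic continuation of the Dirichlet series to the complex plane without \<open>1\<close>;
  the value \<open>0\<close> at the pole is a convention that makes the description unique.
\<close>
definition riemann_zeta :: "complex \<Rightarrow> complex" where
  "riemann_zeta = (THE f. f holomorphic_on (- {1}) \<and> f 1 = 0 \<and>
     (\<forall>s. Re s > 1 \<longrightarrow> (\<lambda>n. of_nat (Suc n) powr (- s)) sums f s))"

text \<open>
  The coefficient of \<open>(s - 1)\<^sup>n\<close> in the Laurent expansion of \<open>riemann_zeta\<close> at \<open>1\<close> is
  \<open>(-1)\<^sup>n \<gamma>\<^sub>n / n!\<close>. These coefficients are real, so taking the real part only adjusts the type.
\<close>
definition stieltjes :: "nat \<Rightarrow> real" where
  "stieltjes n = Re ((- 1) ^ n * fact n * fls_nth (laurent_expansion riemann_zeta 1) (int n))"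

definition Lambert_W :: "real \<Rightarrow> real" where
  "Lambert_W = inv_into {0..} (\<lambda>x. x * exp x)"

end

theory Submission
  imports
    Defs
    "HOL-Library.Discrete_Functions"
    "HOL-Real_Asymp.Real_Asymp"
    "HOL-Probability.Probability"
begin

text \<open>
  Write \<open>\<tau>(n)\<close> for the number of divisors of \<open>n\<close>. Taking logarithms gives \<open>P = exp F\<close> with
  \<open>F(z) = \<Sum> \<tau>(n)/n z\<^sup>n\<close>, so the coefficients of \<open>P\<close> satisfy \<open>n a\<^sub>n = \<Sum> \<tau>(k) a\<^sub>n\<^sub>-\<^sub>k\<close>, which is also the
  recurrence for permutations whose cycles of length \<open>k\<close> carry one of \<open>\<tau>(k)\<close> labels.

  For the asymptotics, Dirichlet's hyperbola method shows that the series
  \<open>\<Sum> (\<tau>(n) - H\<^sub>n\<^sub>-\<^sub>1 - \<gamma>)/n\<close> converges to \<open>c\<close>; since \<open>\<Sum> H\<^sub>n\<^sub>-\<^sub>1/n x\<^sup>n = ln\<^sup>2(1-x)/2\<close>, Abel's theorem gives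
  \<open>F(exp(-t)) = ln\<^sup>2(t)/2 - \<gamma> ln t + c + o(1)\<close> as \<open>t \<rightarrow> 0\<close>. The saddle point of
  \<open>F(exp(-t)) + n t\<close> is then \<open>t = w\<^sub>n/n\<close>. In Cauchy's integral over the circle of radius
  \<open>exp(-t)\<close> put the angle equal to \<open>v t / sqrt(-ln t)\<close>: the normalised integrand tends to \<open>exp(-v\<^sup>2/2)\<close>,
  and it is dominated because \<open>F(r) - Re F(r cis \<theta>)\<close> is a sum of the nonnegative terms
  \<open>ln (\<bar>1 - r\<^sup>d cis(d\<theta>)\<bar> / (1 - r\<^sup>d)) / d\<close>, finitely many of which suffice.
\<close>

subsection \<open>Permutations weighted by their cycle lengths\<close>

text \<open>The delicate point is domination away from the saddle. The rescaled range of integration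
  has length of order sqrt(-ln t)/t, so for |\<theta>| \<ge> sqrt t the integrand must be O(t^a)
  with some a > 1. The term d = 1 alone yields a = 1/2 at |\<theta>| = sqrt t and a = 1 when
  \<theta> is bounded away from 0. Near 0 the terms d = 1, ..., 4 together yield (1 + 1/2 + 1/3 +
  1/4)/2 = 25/24; away from 0 the term d = 1 and one of d = 2, 3 yield at least 4/3. For |\<theta>|
  \<le> sqrt t about 1/sqrt t terms are usable, and the sum of their weights 1/d supplies the factor
  -ln t = l in the bound (1 + v^2/(12 l)) powr (-l/4), which has an integrable majorant independent
  of l.

  The hyperbola method leaves a sum of ln d/d, which brings in \<gamma>_1. Its limit is half the
  second derivative at 1 of 1 - (s - 1) \<zeta>(s). As \<open>riemann_zeta\<close> is a definite
  description, existence and uniqueness of the continuation to the whole punctured plane have to be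
  proved before any of its coefficients can be used.\<close>

definition divisor_count :: "nat \<Rightarrow> nat" where
  "divisor_count n = card {d. d > 0 \<and> d dvd n}"

definition cycle_weight_sum :: "(nat \<Rightarrow> 'b::comm_semiring_1) \<Rightarrow> 'a set \<Rightarrow> 'b" where
  "cycle_weight_sum f A = (\<Sum>\<sigma> | \<sigma> permutes A. \<Prod>C\<in>perm_cycles A \<sigma>. f (card C))"

text \<open>The cycle through \<open>x\<close> is weighted as if it were \<open>j\<close> points
  longer. Deleting \<open>x\<close> from its cycle raises \<open>j\<close> by one, so the family
  over all \<open>j\<close> is closed under deletion of the marked point.\<close>

definition marked_cycle_weight_sum ::
    "(nat \<Rightarrow> 'b::comm_semiring_1) \<Rightarrow> 'a set \<Rightarrow> 'a \<Rightarrow> nat \<Rightarrow> 'b" where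
  "marked_cycle_weight_sum f A x j = (\<Sum>\<sigma> | \<sigma> permutes A.
     f (card (orbit \<sigma> x) + j) * (\<Prod>C\<in>perm_cycles A \<sigma> - {orbit \<sigma> x}. f (card C)))"

lemma marked_cycle_weight_sum_0:
  assumes "finite A" "x \<in> A"
  shows "marked_cycle_weight_sum f A x 0 = cycle_weight_sum f A"
  unfolding marked_cycle_weight_sum_def cycle_weight_sum_def
proof (rule sum.cong)
  fix \<sigma> assume "\<sigma> \<in> {\<sigma>. \<sigma> permutes A}"
  have "finite (perm_cycles A \<sigma>)" "orbit \<sigma> x \<in> perm_cycles A \<sigma>"
    using assms by (auto simp: perm_cycles_def)
  then show "f (card (orbit \<sigma> x) + 0) * (\<Prod>C\<in>perm_cycles A \<sigma> - {orbit \<sigma> x}. f (card C)) =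
      (\<Prod>C\<in>perm_cycles A \<sigma>. f (card C))"
    by (simp add: prod.remove)
qed simp

text \<open>Composing with the transposition redirects the predecessor of \<open>y\<close> to
  \<open>x\<close> and sends \<open>x\<close> to \<open>y\<close>: the point \<open>x\<close> is
  spliced into the cycle of \<open>y\<close> just before \<open>y\<close>, and no other cycle is
  touched.\<close>

lemma orbit_insert_point:
  assumes "finite A" "x \<notin> A" "\<pi> permutes A" "y \<in> A"
  defines "\<sigma> \<equiv> Transposition.transpose x y \<circ> \<pi>"
  shows "orbit \<sigma> x = insert x (orbit \<pi> y)"
    and "perm_cycles (insert x A) \<sigma> - {orbit \<sigma> x} = perm_cycles A \<pi> - {orbit \<pi> y}"
proof -
  have xy: "x \<noteq> y" using assms by auto
  have \<pi>x: "\<pi> x = x" using assms by (meson permutes_not_in)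
  have \<pi>A: "\<pi> z \<in> A" if "z \<in> A" for z using that assms by (simp add: permutes_in_image)
  have \<pi>perm: "permutation \<pi>" using assms by (auto simp: permutation_permutes)
  have self: "z \<in> orbit \<pi> z" for z by (rule permutation_self_in_orbit[OF \<pi>perm])
  have cyc: "orbit \<pi> z = orbit \<pi> u" if "z \<in> orbit \<pi> u" for z u
    using cyclic_on_orbit'[OF \<pi>perm] that orbit_cyclic_eq3 by metis
  have sub: "orbit \<pi> z \<subseteq> A" if "z \<in> A" for z
    using permutes_orbit_subset assms that by metis
  have \<sigma>x: "\<sigma> x = y" using \<pi>x by (simp add: \<sigma>_def)
  have \<sigma>z: "\<sigma> z = (if \<pi> z = y then x else \<pi> z)" if "z \<in> A" for z
    using \<pi>A[OF that] assms(2) xy by (auto simp: \<sigma>_def Transposition.transpose_def)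
  have \<sigma>perm: "permutation \<sigma>"
    unfolding \<sigma>_def by (intro permutation_compose \<pi>perm) (simp add: permutation_swap_id)
  have self\<sigma>: "z \<in> orbit \<sigma> z" for z by (rule permutation_self_in_orbit[OF \<sigma>perm])
  have cyc\<sigma>: "orbit \<sigma> z = orbit \<sigma> u" if "z \<in> orbit \<sigma> u" for z u
    using cyclic_on_orbit'[OF \<sigma>perm] that orbit_cyclic_eq3 by metis
  have y1: "y \<in> orbit \<sigma> x" using \<sigma>x orbit.base[of \<sigma> x] by simp
  have inA: "z \<in> A" if "z \<in> orbit \<pi> y" for z using that sub assms(4) by blast
  have step1: "\<pi> z \<in> orbit \<sigma> x" if "z \<in> orbit \<sigma> x" "z \<in> A" for z
    using orbit.step[OF that(1)] \<sigma>z[OF that(2)] y1 by (auto split: if_splits)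
  show eq: "orbit \<sigma> x = insert x (orbit \<pi> y)"
  proof (intro equalityI subsetI)
    fix z assume "z \<in> orbit \<sigma> x"
    then show "z \<in> insert x (orbit \<pi> y)"
    proof induction
      case base
      then show ?case using \<sigma>x self by simp
    next
      case (step z)
      show ?case
      proof (cases "z = x")
        case False
        then have "z \<in> orbit \<pi> y" using step by simp
        then show ?thesis using \<sigma>z[OF inA] orbit.step[of z \<pi> y] by simp
      qed (use \<sigma>x self in simp)
    qed
  next
    fix z assume "z \<in> insert x (orbit \<pi> y)"
    moreover have "z \<in> orbit \<sigma> x" if "z \<in> orbit \<pi> y"
      using that
    proof induction
      case base
      then show ?case using step1 y1 assms(4) by blast
    next
      case (step z)
      then show ?case using step1 inA by blast
    qed
    ultimately show "z \<in> orbit \<sigma> x" using self\<sigma> by auto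
  qed
  have other: "orbit \<sigma> z = orbit \<pi> z" if "z \<in> A" "z \<notin> orbit \<pi> y" for z
  proof (rule orbit_cong[OF self])
    fix s assume s: "s \<in> orbit \<pi> z"
    then have "s \<in> A" using sub that by blast
    moreover have "\<pi> s \<noteq> y"
      using orbit.step[OF s] cyc[of y z] self[of z] that(2) by metis
    ultimately show "\<sigma> s = \<pi> s" using \<sigma>z by simp
  qed
  have "perm_cycles (insert x A) \<sigma> - {orbit \<sigma> x} = orbit \<pi> ` (A - orbit \<pi> y)"
  proof (intro equalityI subsetI)
    fix C assume "C \<in> perm_cycles (insert x A) \<sigma> - {orbit \<sigma> x}"
    then obtain z where z: "z \<in> A" "C = orbit \<sigma> z" "C \<noteq> orbit \<sigma> x"
      by (auto simp: perm_cycles_def)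
    then have "z \<notin> orbit \<pi> y" using cyc\<sigma>[of z x] eq by auto
    then show "C \<in> orbit \<pi> ` (A - orbit \<pi> y)" using other z by auto
  next
    fix C assume "C \<in> orbit \<pi> ` (A - orbit \<pi> y)"
    then obtain z where z: "z \<in> A" "z \<notin> orbit \<pi> y" "C = orbit \<pi> z" by auto
    then have "C = orbit \<sigma> z" using other by auto
    moreover have "C \<noteq> orbit \<sigma> x" using sub[OF z(1)] z eq assms(2) by auto
    ultimately show "C \<in> perm_cycles (insert x A) \<sigma> - {orbit \<sigma> x}"
      using z by (auto simp: perm_cycles_def)
  qed
  also have "\<dots> = perm_cycles A \<pi> - {orbit \<pi> y}"
    using cyc self by (fastforce simp: perm_cycles_def)
  finally show "perm_cycles (insert x A) \<sigma> - {orbit \<sigma> x} = perm_cycles A \<pi> - {orbit \<pi> y}" .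
qed

text \<open>Each permutation of \<open>insert x A\<close> arises exactly once from a permutation of
  \<open>A\<close>: either \<open>x\<close> is a fixed point, or it is spliced in front of a unique
  \<open>y\<close>. In the second case the mark passes to \<open>y\<close>, and \<open>Suc j\<close>
  records the lost point.\<close>

lemma marked_cycle_weight_sum_insert:
  assumes "finite A" "x \<notin> A"
  shows "marked_cycle_weight_sum f (insert x A) x j =
    f (Suc j) * cycle_weight_sum f A + (\<Sum>y\<in>A. marked_cycle_weight_sum f A y (Suc j))"
proof -
  have fixed: "f (card (orbit \<pi> x) + j) *
      (\<Prod>C\<in>perm_cycles (insert x A) \<pi> - {orbit \<pi> x}. f (card C)) =
      f (Suc j) * (\<Prod>C\<in>perm_cycles A \<pi>. f (card C))" if "\<pi> permutes A" for \<pi>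
  proof -
    have "\<pi> x = x" using that assms by (meson permutes_not_in)
    then have o: "orbit \<pi> x = {x}" by (simp add: orbit_eq_singleton_iff)
    have "{x} \<notin> orbit \<pi> ` A"
      using permutes_orbit_subset[OF that] assms by fastforce
    then have "perm_cycles (insert x A) \<pi> - {orbit \<pi> x} = perm_cycles A \<pi>"
      by (auto simp: perm_cycles_def o)
    then show ?thesis by (simp add: o)
  qed
  have moved: "f (card (orbit (Transposition.transpose x y \<circ> \<pi>) x) + j) *
      (\<Prod>C\<in>perm_cycles (insert x A) (Transposition.transpose x y \<circ> \<pi>) - {orbit (Transposition.transpose x y \<circ> \<pi>) x}. f (card C)) =
      f (card (orbit \<pi> y) + Suc j) * (\<Prod>C\<in>perm_cycles A \<pi> - {orbit \<pi> y}. f (card C))"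
    if "\<pi> permutes A" "y \<in> A" for \<pi> y
  proof -
    have sub: "orbit \<pi> y \<subseteq> A" by (rule permutes_orbit_subset[OF that])
    then have "card (insert x (orbit \<pi> y)) = Suc (card (orbit \<pi> y))"
      using assms by (subst card_insert_disjoint) (auto intro: finite_subset)
    then show ?thesis
      using orbit_insert_point[OF assms that] by simp
  qed
  have "marked_cycle_weight_sum f (insert x A) x j =
      (\<Sum>\<pi> | \<pi> permutes A. f (Suc j) * (\<Prod>C\<in>perm_cycles A \<pi>. f (card C))) +
      (\<Sum>y\<in>A. \<Sum>\<pi> | \<pi> permutes A. f (card (orbit \<pi> y) + Suc j) *
         (\<Prod>C\<in>perm_cycles A \<pi> - {orbit \<pi> y}. f (card C)))"
    unfolding marked_cycle_weight_sum_def sum_over_permutations_insert[OF assms]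
    using assms fixed moved
    by (subst sum.insert) (auto intro!: arg_cong2[of _ _ _ _ "(+)"] sum.cong)
  then show ?thesis
    by (simp add: marked_cycle_weight_sum_def cycle_weight_sum_def sum_distrib_left)
qed

text \<open>The index \<open>k\<close> counts the points deleted from the marked cycle besides
  \<open>x\<close> before it closes; the other \<open>m - k\<close> points are permuted freely. The
  formula for unmarked sums is assumed only up to size \<open>n\<close>, so that the lemma can serve
  inside a strong induction on the size.\<close>

lemma marked_cycle_weight_sum_eq:
  fixes b :: "nat \<Rightarrow> 'b::field_char_0"
  assumes W: "\<And>A :: 'a set. finite A \<Longrightarrow> card A \<le> n \<Longrightarrow> cycle_weight_sum f A = fact (card A) * b (card A)"
    and "finite A" "card A = m" "m \<le> n" "(x :: 'a) \<notin> A"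
  shows "marked_cycle_weight_sum f (insert x A) x j = fact m * (\<Sum>k\<le>m. f (Suc (k + j)) * b (m - k))"
  using assms(2-)
proof (induction m arbitrary: A x j)
  case 0
  then show ?case
    using W[of A] by (subst marked_cycle_weight_sum_insert) auto
next
  case (Suc m)
  have "marked_cycle_weight_sum f A y (Suc j) = fact m * (\<Sum>k\<le>m. f (Suc (k + Suc j)) * b (m - k))"
    if "y \<in> A" for y
    using Suc.IH[of "A - {y}" y "Suc j"] Suc.prems that by (simp add: insert_absorb)
  then have "(\<Sum>y\<in>A. marked_cycle_weight_sum f A y (Suc j)) =
      fact (Suc m) * (\<Sum>k\<le>m. f (Suc (k + Suc j)) * b (m - k))"
    using Suc.prems by simp
  then show ?case
    using W[of A] Suc.prems
    by (subst marked_cycle_weight_sum_insert)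
       (auto simp: sum.atMost_Suc_shift algebra_simps simp del: sum.atMost_Suc)
qed

text \<open>Removing the points of the cycle through a marked point one at a time proves the
  exponential formula without having to enumerate the cycles of a given length.\<close>
theorem cycle_weight_sum_eq:
  fixes b :: "nat \<Rightarrow> 'b::field_char_0"
  assumes b0: "b 0 = 1"
    and rec: "\<And>n. of_nat (Suc n) * b (Suc n) = (\<Sum>k\<le>n. f (Suc k) * b (n - k))"
    and "finite A"
  shows "cycle_weight_sum f A = fact (card A) * b (card A)"
  using assms(3)
proof (induction "card A" arbitrary: A rule: less_induct)
  case less
  show ?case
  proof (cases "A = {}")
    case True
    then show ?thesis by (simp add: cycle_weight_sum_def perm_cycles_def b0)
  next
    case False
    then obtain x B where xB: "A = insert x B" "x \<notin> B" by (meson Set.set_insert ex_in_conv)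
    then have B: "finite B" "card A = Suc (card B)" using less.prems by auto
    have "cycle_weight_sum f A = marked_cycle_weight_sum f (insert x B) x 0"
      using less.prems xB by (simp add: marked_cycle_weight_sum_0)
    also have "\<dots> = fact (card B) * (\<Sum>k\<le>card B. f (Suc (k + 0)) * b (card B - k))"
      using less.hyps B xB by (intro marked_cycle_weight_sum_eq[of "card B"]) auto
    also have "\<dots> = fact (card A) * b (card A)"
      using rec[of "card B"] B by (simp add: mult.assoc)
    finally show ?thesis .
  qed
qed

lemma card_divisor_labelled_perms:
  "of_nat (card (divisor_labelled_perms n)) =
    cycle_weight_sum (\<lambda>k. of_nat (divisor_count k) :: 'b :: comm_semiring_1) {1..n}"
proof -
  have "card (divisor_labelled_perms n) =
      (\<Sum>\<sigma> | \<sigma> permutes {1..n}. card (\<Pi>\<^sub>E C\<in>perm_cycles {1..n} \<sigma>. {d. d > 0 \<and> d dvd card C}))"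
    unfolding divisor_labelled_perms_def
  proof (rule card_SigmaI)
    show "finite {\<sigma>. \<sigma> permutes {1..n}}" by (simp add: finite_permutations)
    show "\<forall>\<sigma>\<in>{\<sigma>. \<sigma> permutes {1..n}}. finite (\<Pi>\<^sub>E C\<in>perm_cycles {1..n} \<sigma>. {d. d > 0 \<and> d dvd card C})"
    proof (intro ballI finite_PiE)
      fix \<sigma> C assume \<sigma>: "\<sigma> \<in> {\<sigma>. \<sigma> permutes {1..n}}" and "C \<in> perm_cycles {1..n} \<sigma>"
      then obtain x where x: "x \<in> {1..n}" "C = orbit \<sigma> x" by (auto simp: perm_cycles_def)
      then have "C \<subseteq> {1..n}" using permutes_orbit_subset[of \<sigma> "{1..n}" x] \<sigma> by simp
      then have "card C > 0"
        using x orbit_nonempty[of \<sigma> x] by (auto simp: card_gt_0_iff intro: finite_subset)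
      then show "finite {d. d > 0 \<and> d dvd card C}" by (auto intro: finite_subset[of _ "{..card C}"] dvd_imp_le)
    qed (auto simp: perm_cycles_def)
  qed
  also have "\<dots> = (\<Sum>\<sigma> | \<sigma> permutes {1..n}. \<Prod>C\<in>perm_cycles {1..n} \<sigma>. divisor_count (card C))"
    by (intro sum.cong refl) (simp add: card_PiE divisor_count_def perm_cycles_def)
  finally show ?thesis by (simp add: cycle_weight_sum_def)
qed

subsection \<open>The logarithmic derivative of the product\<close>

text \<open>The logarithmic derivative of (1 - z^d)^(-1/d) is z^(d-1)/(1 - z^d), whose expansion is
  the indicator series. The identity is first proved multiplied by \<open>1 - fps_X ^ d\<close>,
  using the differential equation of the binomial series, and the factor is cancelled at the
  end.\<close>

lemma fps_deriv_P_factor: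
  assumes "d > 0"
  shows "fps_deriv (P_factor d) = P_factor d * Abs_fps (\<lambda>k. if d dvd Suc k then 1 else 0)"
proof -
  let ?T = "Abs_fps (\<lambda>k. if d dvd Suc k then 1 else 0) :: rat fps"
  let ?b = "- (fps_X ^ d) :: rat fps"
  let ?B = "fps_binomial (- 1 / of_nat d) :: rat fps"
  have b0: "?b $ 0 = 0" using assms by simp
  have "(1 + fps_X) * fps_deriv ?B = fps_const (- 1 / of_nat d) * ?B"
    unfolding fps_binomial_deriv by (simp add: fps_divide_unit mult.assoc inverse_mult_eq_1')
  then have "((1 + fps_X) * fps_deriv ?B) oo ?b = (fps_const (- 1 / of_nat d) * ?B) oo ?b"
    by simp
  then have ode: "(1 - fps_X ^ d) * (fps_deriv ?B oo ?b) = fps_const (- 1 / of_nat d) * P_factor d"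
    using b0 by (simp add: fps_compose_mult_distrib fps_compose_add_distrib P_factor_def)
  have dX: "fps_deriv ?b = - (of_nat d * fps_X ^ (d - 1))"
    by (simp add: fps_deriv_power fps_of_nat)
  have T: "(1 - fps_X ^ d) * ?T = fps_X ^ (d - 1)"
  proof (rule fps_ext)
    fix k
    have "((1 - fps_X ^ d) * ?T) $ k = ?T $ k - (fps_X ^ d * ?T) $ k"
      by (simp add: algebra_simps)
    also have "\<dots> = (if d dvd Suc k then 1 else 0) - (if k < d then 0 else if d dvd Suc (k - d) then 1 else 0)"
      by (simp add: fps_X_power_mult_nth)
    also have "\<dots> = (if k = d - 1 then 1 else 0)"
    proof (cases "k < d")
      case True
      then have "d dvd Suc k \<longleftrightarrow> k = d - 1"
        using assms by (metis Suc_leI Suc_pred' diff_Suc_1 dvd_imp_le dvd_refl le_antisym zero_less_Suc)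
      then show ?thesis using True by simp
    next
      case False
      then have "d dvd Suc (k - d) \<longleftrightarrow> d dvd Suc k"
        by (metis Suc_diff_le dvd_minus_self le_SucI less_Suc_eq_le linorder_not_less)
      then show ?thesis using False assms by auto
    qed
    finally show "((1 - fps_X ^ d) * ?T) $ k = (fps_X ^ (d - 1) :: rat fps) $ k"
      by (simp add: fps_X_power_nth)
  qed
  have "(1 - fps_X ^ d) * fps_deriv (P_factor d) =
      ((1 - fps_X ^ d) * (fps_deriv ?B oo ?b)) * fps_deriv ?b"
    unfolding P_factor_def by (subst fps_compose_deriv[OF b0]) (simp add: mult.assoc)
  also have "\<dots> = (fps_const (- 1 / of_nat d) * (- of_nat d)) * fps_X ^ (d - 1) * P_factor d"
    unfolding ode dX by (simp add: algebra_simps)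
  also have "fps_const (- 1 / of_nat d) * (- of_nat d) = (1 :: rat fps)"
    using assms by (simp add: fps_of_nat [symmetric] fps_const_mult[symmetric] del: fps_const_mult)
  also have "1 * fps_X ^ (d - 1) * P_factor d = (1 - fps_X ^ d) * (P_factor d * ?T)"
    using T by (simp add: mult_ac)
  finally have eq: "(1 - fps_X ^ d) * fps_deriv (P_factor d) = (1 - fps_X ^ d) * (P_factor d * ?T)" .
  have "(1 - fps_X ^ d :: rat fps) $ 0 = 1" using assms by simp
  then have "(1 - fps_X ^ d :: rat fps) \<noteq> 0" by force
  with eq show ?thesis by simp
qed

text \<open>\<open>has_prod\<close> allows for finitely many vanishing factors; constant term 1
  rules these out, which leaves the plain limit of partial products.\<close>

lemma P_series_LIMSEQ: "(\<lambda>N. \<Prod>d\<le>N. P_factor (Suc d)) \<longlonglongrightarrow> P_series"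
proof -
  have "P_factor (Suc d) \<noteq> 0" for d
    using P_factor_nth_less[of 0 "Suc d"] by auto
  with P_series_has_prod show ?thesis
    by (auto simp: has_prod_def raw_has_prod_def)
qed

text \<open>A fixed coefficient only involves a finite partial product, where the product rule adds
  up the logarithmic derivatives: one unit for each divisor of \<open>Suc k\<close>.\<close>

lemma fps_deriv_P_series:
  "fps_deriv P_series = P_series * Abs_fps (\<lambda>k. of_nat (divisor_count (Suc k)))"
proof (rule fps_ext)
  fix n
  define T :: "nat \<Rightarrow> rat fps" where "T = (\<lambda>d. Abs_fps (\<lambda>k. if Suc d dvd Suc k then 1 else 0))"
  define S where "S = (\<lambda>N. \<Prod>d\<le>N. P_factor (Suc d))"
  have der: "fps_deriv (S N) = S N * (\<Sum>d\<le>N. T d)" for N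
    by (induction N) (simp_all add: S_def T_def fps_deriv_P_factor algebra_simps)
  have "S \<longlonglongrightarrow> P_series" unfolding S_def by (rule P_series_LIMSEQ)
  then have "eventually (\<lambda>N. fps_nth (S N) k = fps_nth P_series k) sequentially" for k
    unfolding tendsto_fps_iff by blast
  then have "eventually (\<lambda>N. \<forall>k\<in>{..Suc n}. fps_nth (S N) k = fps_nth P_series k) sequentially"
    by (intro eventually_ball_finite) auto
  \<comment> \<open>The derivative needs the coefficients up to \<open>Suc n\<close>;
    \<open>N \<ge> n\<close> ensures that the factors with index \<open>Suc d\<close>,
    \<open>d \<le> N\<close>, include every divisor of \<open>Suc k\<close> for
    \<open>k \<le> n\<close>.\<close>
  then have "eventually (\<lambda>N. N \<ge> n \<and> (\<forall>k\<in>{..Suc n}. fps_nth (S N) k = fps_nth P_series k)) sequentially"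
    using eventually_ge_at_top by (rule eventually_conj[rotated])
  then obtain N where N: "N \<ge> n" "\<And>k. k \<le> Suc n \<Longrightarrow> fps_nth (S N) k = fps_nth P_series k"
    by (auto simp: eventually_at_top_linorder)
  have Tk: "fps_nth (\<Sum>d\<le>N. T d) k = of_nat (divisor_count (Suc k))" if "k \<le> n" for k
  proof -
    have "fps_nth (\<Sum>d\<le>N. T d) k = (\<Sum>d\<in>{d. d \<le> N \<and> Suc d dvd Suc k}. 1)"
      unfolding T_def by (simp add: fps_sum_nth sum.If_cases Int_def)
    also have "\<dots> = of_nat (card {d. d \<le> N \<and> Suc d dvd Suc k})" by simp
    also have "card {d. d \<le> N \<and> Suc d dvd Suc k} = card (Suc ` {d. d \<le> N \<and> Suc d dvd Suc k})"
      by (simp add: card_image)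
    also have "Suc ` {d. d \<le> N \<and> Suc d dvd Suc k} = {d. d > 0 \<and> d dvd Suc k}"
    proof (intro equalityI subsetI)
      fix d assume "d \<in> {d. d > 0 \<and> d dvd Suc k}"
      then show "d \<in> Suc ` {d. d \<le> N \<and> Suc d dvd Suc k}"
        using that N(1) dvd_imp_le[of d "Suc k"] by (intro image_eqI[of _ _ "d - 1"]) auto
    qed auto
    finally show ?thesis by (simp add: divisor_count_def)
  qed
  have "fps_deriv P_series $ n = fps_deriv (S N) $ n" using N by simp
  also have "\<dots> = (P_series * Abs_fps (\<lambda>k. of_nat (divisor_count (Suc k)))) $ n"
    unfolding der fps_mult_nth using N Tk by (intro sum.cong) auto
  finally show "fps_deriv P_series $ n = (P_series * Abs_fps (\<lambda>k. of_nat (divisor_count (Suc k)))) $ n" .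
qed

lemma P_series_nth_0: "fps_nth P_series 0 = 1"
proof -
  have "eventually (\<lambda>N. fps_nth (\<Prod>d\<le>N. P_factor (Suc d)) 0 = fps_nth P_series 0) sequentially"
    using P_series_LIMSEQ unfolding tendsto_fps_iff by blast
  moreover have "fps_nth (\<Prod>d\<le>N. P_factor (Suc d)) 0 = 1" for N
    by (induction N) (auto simp: P_factor_nth_less)
  ultimately show ?thesis by simp
qed

lemma P_series_nth_recurrence:
  "of_nat (Suc n) * fps_nth P_series (Suc n) =
     (\<Sum>k\<le>n. of_nat (divisor_count (Suc k)) * fps_nth P_series (n - k))"
proof -
  have "of_nat (Suc n) * fps_nth P_series (Suc n) = fps_nth (fps_deriv P_series) n" by simp
  also have "\<dots> = fps_nth (Abs_fps (\<lambda>k. of_nat (divisor_count (Suc k))) * P_series) n"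
    by (simp only: fps_deriv_P_series mult.commute)
  finally show ?thesis by (simp add: fps_mult_nth atLeast0AtMost)
qed

theorem p_seq_eq_card: "p_seq n = of_nat (card (divisor_labelled_perms n))"
  using cycle_weight_sum_eq[of "fps_nth P_series" "\<lambda>k. of_nat (divisor_count k)" "{1..n}",
      OF P_series_nth_0 P_series_nth_recurrence]
  by (simp add: p_seq_def card_divisor_labelled_perms)

subsection \<open>Continuation of the zeta function and the first Stieltjes constant\<close>

text \<open>
  Expanding \<open>(n + 1) powr (1 - s)\<close> around \<open>n\<close> in the telescoping sum of \<open>n powr (1 - s) - (n + 1) powr (1 - s)\<close>
  expresses \<open>(s - 1) \<zeta>(s)\<close> by \<open>\<zeta>(s + 1), \<dots>, \<zeta>(s + K - 1)\<close> and the sum of the errors, which converges for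
  \<open>Re s > 1 - K\<close>; this continues \<open>\<zeta>\<close> from one half plane to the next. The index \<open>m\<close> stands for \<open>n = m + 1\<close>.
\<close>
definition binomial_error :: "nat \<Rightarrow> nat \<Rightarrow> complex \<Rightarrow> complex" where
  "binomial_error K m s =
     (\<Sum>k\<le>K. ((1 - s) gchoose k) * of_nat (Suc m) powr (1 - s - of_nat k)) - of_nat (Suc (Suc m)) powr (1 - s)"

text \<open>Each factor satisfies |a - i| \<le> A + i, and at \<open>- A\<close> these bounds are
  attained simultaneously.\<close>

lemma norm_gbinomial_le:
  fixes a :: complex
  assumes "norm a \<le> A"
  shows "norm (a gchoose k) \<le> \<bar>(- A) gchoose k\<bar>"
proof -
  have A: "A \<ge> 0" using assms norm_ge_zero order_trans by blast
  have "norm (a gchoose k) = (\<Prod>i=0..<k. norm (a - of_nat i)) / fact k"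
    by (simp add: gbinomial_prod_rev norm_divide prod_norm)
  also have "\<dots> \<le> (\<Prod>i=0..<k. \<bar>- A - of_nat i\<bar>) / fact k"
  proof (intro divide_right_mono prod_mono conjI)
    fix i
    show "norm (a - of_nat i) \<le> \<bar>- A - of_nat i\<bar>"
      using norm_triangle_ineq4[of a "of_nat i"] assms A by simp
  qed auto
  also have "\<dots> = \<bar>(- A) gchoose k\<bar>"
    by (simp add: gbinomial_prod_rev abs_prod)
  finally show ?thesis .
qed

text \<open>With N = m + 1, factoring out N powr (1 - s) turns the error into minus the tail, from
  index K + 1 on, of the binomial series of (1 + 1/N) powr (1 - s). The constant depends only on the
  radius \<open>A\<close>, which makes the bound locally uniform in \<open>s\<close>.\<close>

lemma norm_binomial_error_le:
  obtains C where "\<And>s m. norm (1 - s) \<le> A \<Longrightarrow> m \<ge> 1 \<Longrightarrow>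
    norm (binomial_error K m s) \<le> C * real (Suc m) powr (- Re s - real K)"
proof -
  \<comment> \<open>For \<open>m \<ge> 1\<close> the ratio 1/N is at most 1/2. The terms of
    \<open>g\<close> are those of the binomial series of (1 - 1/2) powr (-A), all of which are
    nonnegative.\<close>
  define g where "g = (\<lambda>k. \<bar>(- A) gchoose k\<bar> * (1/2) ^ k)"
  have summ: "summable g" if "A \<ge> 0"
  proof -
    have "summable (\<lambda>k. ((- A) gchoose k) * (-1/2) ^ k)"
      using gen_binomial_real[of "-1/2" "-A"] by (simp add: sums_iff)
    also have "(\<lambda>k. ((- A) gchoose k) * (-1/2) ^ k) = g"
    proof
      fix k
      have "(\<Prod>i=0..<k. - A - real i) = (-1) ^ k * (\<Prod>i=0..<k. A + real i)"
        by (induction k) (auto simp: algebra_simps)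
      moreover have "(\<Prod>i=0..<k. A + real i) \<ge> 0" using that by (intro prod_nonneg) auto
      ultimately have "g k = (\<Prod>i=0..<k. A + real i) / fact k * (1/2) ^ k"
        by (simp add: g_def gbinomial_prod_rev abs_mult)
      moreover have "(-1/2 :: real) ^ k = (-1) ^ k * (1/2) ^ k"
        by (simp flip: power_mult_distrib)
      moreover have "((-1) ^ k * (-1) ^ k :: real) = 1"
        by (simp flip: power_mult_distrib)
      ultimately show "((- A) gchoose k) * (-1/2) ^ k = g k"
        using \<open>(\<Prod>i=0..<k. - A - real i) = (-1) ^ k * (\<Prod>i=0..<k. A + real i)\<close>
        by (simp add: gbinomial_prod_rev)
    qed
    finally show ?thesis .
  qed
  \<comment> \<open>The tail keeps the true factor (1/N)^(K+1), while \<open>g\<close> contains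
    (1/2)^(K+1); the power of 2 makes up for it.\<close>
  define C where "C = 2 ^ Suc K * suminf g"
  have "norm (binomial_error K m s) \<le> C * real (Suc m) powr (- Re s - real K)"
    if s: "norm (1 - s) \<le> A" and m: "m \<ge> 1" for s m
  proof -
    have A: "A \<ge> 0" using s norm_ge_zero order_trans by blast
    define N where "N = real (Suc m)"
    have N: "N \<ge> 2" using m by (simp add: N_def)
    define c where "c = (\<lambda>k. ((1 - s) gchoose k) * (of_real (1 / N)) ^ k)"
    have Npow: "of_real N powr (1 - s - of_nat k) = of_real N powr (1 - s) * of_real (1 / N) ^ k" for k
      using N by (simp add: powr_diff powr_nat' power_divide)
    have csums: "c sums (1 + of_real (1 / N)) powr (1 - s)"
      unfolding c_def by (rule gen_binomial_complex) (use N in \<open>simp add: norm_divide\<close>)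
    have "of_nat (Suc (Suc m)) = (of_real N * (1 + of_real (1 / N)) :: complex)"
      using N by (simp add: algebra_simps) (simp add: N_def)
    also have "\<dots> powr (1 - s) = of_real N powr (1 - s) * (1 + of_real (1 / N)) powr (1 - s)"
      using powr_times_real[of "of_real N" "1 + of_real (1 / N)" "1 - s"] N by simp
    also have "(1 + of_real (1 / N)) powr (1 - s) = suminf c"
      using csums by (simp add: sums_iff)
    finally have Suc2: "of_nat (Suc (Suc m)) powr (1 - s) = of_real N powr (1 - s) * suminf c" .
    have [simp]: "of_nat (Suc m) = complex_of_real N" by (simp add: N_def)
    have "binomial_error K m s = of_real N powr (1 - s) * ((\<Sum>k\<le>K. c k) - suminf c)"
    proof -
      have "(\<Sum>k\<le>K. ((1 - s) gchoose k) * of_real N powr (1 - s - of_nat k)) =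
          of_real N powr (1 - s) * (\<Sum>k\<le>K. c k)"
        unfolding sum_distrib_left Npow c_def by (simp add: mult_ac)
      then show ?thesis
        unfolding binomial_error_def Suc2 by (simp add: right_diff_distrib del: of_nat_Suc)
    qed
    also have "suminf c = (\<Sum>k. c (k + Suc K)) + (\<Sum>k<Suc K. c k)"
      using csums by (intro suminf_split_initial_segment) (simp add: sums_iff)
    finally have eq: "binomial_error K m s = - (of_real N powr (1 - s) * (\<Sum>k. c (k + Suc K)))"
      by (simp add: lessThan_Suc_atMost)
    have bound: "norm (c (k + Suc K)) \<le> (2 / N) ^ Suc K * g (k + Suc K)" for k
    proof -
      have le: "norm (c (k + Suc K)) \<le> \<bar>(- A) gchoose (k + Suc K)\<bar> * (1 / N) ^ (k + Suc K)"
        unfolding c_def norm_mult norm_power using N norm_gbinomial_le[OF s, of "k + Suc K"]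
        by (intro mult_mono) (auto simp: norm_divide)
      have "(1 / N) ^ (k + Suc K) = (1 / N) ^ Suc K * (1 / N) ^ k" by (simp add: power_add)
      also have "\<dots> \<le> (1 / N) ^ Suc K * (1 / 2) ^ k"
        using N by (intro mult_left_mono power_mono) (auto simp: field_simps)
      also have "\<dots> = (2 / N) ^ Suc K * (1 / 2) ^ (k + Suc K)"
        by (simp add: power_add power_divide)
      finally have "\<bar>(- A) gchoose (k + Suc K)\<bar> * (1 / N) ^ (k + Suc K) \<le>
          \<bar>(- A) gchoose (k + Suc K)\<bar> * ((2 / N) ^ Suc K * (1 / 2) ^ (k + Suc K))"
        by (rule mult_left_mono) simp
      with le show ?thesis unfolding g_def by (simp only: mult_ac)
    qed
    have gs: "summable (\<lambda>k. g (k + Suc K))" using summ[OF A] by (simp only: summable_iff_shift)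
    have ns: "summable (\<lambda>k. norm (c (k + Suc K)))"
      by (rule summable_comparison_test'[OF summable_mult[OF gs, of "(2 / N) ^ Suc K"], of 0])
         (simp only: real_norm_def abs_norm_cancel, rule bound)
    have "norm (\<Sum>k. c (k + Suc K)) \<le> (\<Sum>k. (2 / N) ^ Suc K * g (k + Suc K))"
      using summable_norm[OF ns] suminf_le[OF bound ns summable_mult[OF gs]] by linarith
    also have "\<dots> = (2 / N) ^ Suc K * (\<Sum>k. g (k + Suc K))" by (rule suminf_mult[OF gs])
    also have "\<dots> \<le> (2 / N) ^ Suc K * suminf g"
    proof (rule mult_left_mono)
      have "suminf g = (\<Sum>k. g (k + Suc K)) + (\<Sum>k<Suc K. g k)"
        by (rule suminf_split_initial_segment[OF summ[OF A]])
      moreover have "(\<Sum>k<Suc K. g k) \<ge> 0" by (intro sum_nonneg) (simp add: g_def)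
      ultimately show "(\<Sum>k. g (k + Suc K)) \<le> suminf g" by linarith
    qed (use N in auto)
    finally have "norm (binomial_error K m s) \<le> N powr (1 - Re s) * ((2 / N) ^ Suc K * suminf g)"
      unfolding eq norm_minus_cancel norm_mult using N
      by (intro mult_mono) (simp_all add: norm_powr_real_powr del: power_Suc)
    also have "\<dots> = C * (N powr (1 - Re s) * (1 / N) ^ Suc K)"
      by (simp add: C_def power_divide mult_ac)
    also have "(1 / N) ^ Suc K = N powr (- real (Suc K))"
      using N by (simp only: powr_minus powr_realpow power_one_over inverse_eq_divide)
    also have "N powr (1 - Re s) * N powr (- real (Suc K)) = N powr (- Re s - real K)"
      by (simp add: powr_add[symmetric])
    finally show ?thesis by (simp add: N_def)
  qed
  then show ?thesis by (rule that)
qed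

lemma binomial_error_holomorphic: "binomial_error K m holomorphic_on S"
proof -
  have [holomorphic_intros]: "(\<lambda>s. (1 - s) gchoose k) holomorphic_on S" for k
    unfolding gbinomial_prod_rev by (intro holomorphic_intros) auto
  show ?thesis
    unfolding binomial_error_def by (intro holomorphic_intros)
qed

lemma binomial_error_uniform_limit:
  assumes "Re s > 1 - real K"
  obtains d where "d > 0" "cball s d \<subseteq> {s. Re s > 1 - real K}"
    "uniform_limit (cball s d) (\<lambda>n s. \<Sum>m<n. binomial_error K m s) (\<lambda>s. \<Sum>m. binomial_error K m s) sequentially"
proof -
  \<comment> \<open>Half the distance to the boundary line keeps the exponent -Re z - K at most -1 -
    d on the whole disc, so one convergent majorant serves all of it.\<close>
  define d where "d = (Re s - (1 - real K)) / 2"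
  have d: "d > 0" using assms by (simp add: d_def)
  have Re: "Re z \<ge> 1 - real K + d" if "z \<in> cball s d" for z
    using that abs_Re_le_cmod[of "s - z"] by (simp add: dist_norm d_def field_simps)
  obtain C where C: "\<And>z m. norm (1 - z) \<le> norm (1 - s) + d \<Longrightarrow> m \<ge> 1 \<Longrightarrow>
      norm (binomial_error K m z) \<le> C * real (Suc m) powr (- Re z - real K)"
    using norm_binomial_error_le by blast
  show ?thesis
  proof (rule that[OF d])
    show "cball s d \<subseteq> {s. Re s > 1 - real K}" using Re d by fastforce
    show "uniform_limit (cball s d) (\<lambda>n s. \<Sum>m<n. binomial_error K m s)
        (\<lambda>s. \<Sum>m. binomial_error K m s) sequentially"
    proof (rule Weierstrass_m_test_ev)
      show "eventually (\<lambda>m. \<forall>z\<in>cball s d. norm (binomial_error K m z) \<le> \<bar>C\<bar> * real (Suc m) powr (- 1 - d)) sequentially"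
        using eventually_ge_at_top[of 1]
      proof eventually_elim
        case (elim m)
        show ?case
        proof
          fix z assume z: "z \<in> cball s d"
          have "norm (1 - z) \<le> norm (1 - s) + norm (s - z)"
            using norm_triangle_ineq[of "1 - s" "s - z"] by simp
          then have "norm (1 - z) \<le> norm (1 - s) + d" using z by (simp add: dist_norm)
          from C[OF this elim]
          have "norm (binomial_error K m z) \<le> \<bar>C\<bar> * real (Suc m) powr (- Re z - real K)"
            by (smt (verit) mult_right_mono powr_ge_zero)
          also have "\<dots> \<le> \<bar>C\<bar> * real (Suc m) powr (- 1 - d)"
            using Re[OF z] by (intro mult_left_mono powr_mono) auto
          finally show "norm (binomial_error K m z) \<le> \<bar>C\<bar> * real (Suc m) powr (- 1 - d)" .
        qed
      qed
      have "summable (\<lambda>m. real m powr (- 1 - d))" using d by (subst summable_real_powr_iff) auto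
      then have "summable (\<lambda>m. real (Suc m) powr (- 1 - d))" by (subst summable_Suc_iff)
      then show "summable (\<lambda>m. \<bar>C\<bar> * real (Suc m) powr (- 1 - d))" by (rule summable_mult)
    qed
  qed
qed

lemma open_Re_gt: "open {s. Re s > a}"
  by (simp add: open_halfspace_Re_gt)

lemma binomial_error_suminf_holomorphic:
  "(\<lambda>s. \<Sum>m. binomial_error K m s) holomorphic_on {s. Re s > 1 - real K}"
proof (rule holomorphic_uniform_sequence)
  show "open {s. Re s > 1 - real K}" by (rule open_Re_gt)
  show "(\<lambda>s. \<Sum>m<n. binomial_error K m s) holomorphic_on {s. Re s > 1 - real K}" for n
    by (intro holomorphic_intros binomial_error_holomorphic)
  fix s assume "s \<in> {s. Re s > 1 - real K}"
  then have "Re s > 1 - real K" by simp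
  from binomial_error_uniform_limit[OF this]
  show "\<exists>d>0. cball s d \<subseteq> {s. 1 - real K < Re s} \<and>
      uniform_limit (cball s d) (\<lambda>n s. \<Sum>m<n. binomial_error K m s)
         (\<lambda>s. \<Sum>m. binomial_error K m s) sequentially"
    by metis
qed

section \<open>The Dirichlet series and its continuation\<close>

definition dirichlet_zeta :: "complex \<Rightarrow> complex" where
  "dirichlet_zeta s = (\<Sum>n. of_nat (Suc n) powr (- s))"

lemma dirichlet_zeta_sums:
  assumes "Re s > 1"
  shows "(\<lambda>n. of_nat (Suc n) powr (- s)) sums dirichlet_zeta s"
proof -
  have "summable (\<lambda>n. real n powr (- Re s))" using assms by (subst summable_real_powr_iff) auto
  then have "summable (\<lambda>n. real (Suc n) powr (- Re s))" by (subst summable_Suc_iff)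
  also have "(\<lambda>n. real (Suc n) powr (- Re s)) = (\<lambda>n. norm (of_nat (Suc n) powr (- s) :: complex))"
    by (subst norm_powr_real_powr) (auto simp del: of_nat_Suc)
  finally have "summable (\<lambda>n. of_nat (Suc n) powr (- s) :: complex)"
    by (rule summable_norm_cancel)
  then show ?thesis by (simp add: dirichlet_zeta_def summable_sums)
qed

text \<open>In the sum of the errors the terms k = 0 telescope to 1 against the subtracted powers,
  and the terms k = 1 give (1 - s) \<zeta>(s), which is moved to the left.\<close>

lemma dirichlet_zeta_functional:
  assumes "Re s > 1" "K \<ge> 1"
  shows "(s - 1) * dirichlet_zeta s = 1 - (\<Sum>m. binomial_error K m s)
    + (\<Sum>k=2..K. ((1 - s) gchoose k) * dirichlet_zeta (s + of_nat k - 1))"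
proof -
  have "(\<lambda>n. of_nat (Suc n) powr (1 - s) :: complex) \<longlonglongrightarrow> 0"
  proof (rule tendsto_norm_zero_cancel)
    have "(\<lambda>n. real n powr (1 - Re s)) \<longlonglongrightarrow> 0"
      using assms by (intro tendsto_neg_powr filterlim_real_sequentially) auto
    then have "(\<lambda>n. real (Suc n) powr (1 - Re s)) \<longlonglongrightarrow> 0" by (rule LIMSEQ_Suc)
    also have "(\<lambda>n. real (Suc n) powr (1 - Re s)) = (\<lambda>n. norm (of_nat (Suc n) powr (1 - s) :: complex))"
      by (subst norm_powr_real_powr) (auto simp del: of_nat_Suc)
    finally show "(\<lambda>n. norm (of_nat (Suc n) powr (1 - s) :: complex)) \<longlonglongrightarrow> 0" .
  qed
  from telescope_sums'[OF this]
  have tele: "(\<lambda>n. of_nat (Suc n) powr (1 - s) - of_nat (Suc (Suc n)) powr (1 - s) :: complex) sums 1"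
    by simp
  have zk: "(\<lambda>n. ((1 - s) gchoose k) * of_nat (Suc n) powr (1 - s - of_nat k)) sums
      (((1 - s) gchoose k) * dirichlet_zeta (s + of_nat k - 1))" if "k \<in> {1..K}" for k
  proof -
    have "Re (s + of_nat k - 1) > 1" using assms that by auto
    from sums_mult[OF dirichlet_zeta_sums[OF this]] show ?thesis by (simp add: algebra_simps)
  qed
  have "(\<lambda>n. (of_nat (Suc n) powr (1 - s) - of_nat (Suc (Suc n)) powr (1 - s)) +
      (\<Sum>k=1..K. ((1 - s) gchoose k) * of_nat (Suc n) powr (1 - s - of_nat k))) sums
      (1 + (\<Sum>k=1..K. ((1 - s) gchoose k) * dirichlet_zeta (s + of_nat k - 1)))"
    by (intro sums_add tele sums_sum zk)
  also have "(\<lambda>n. (of_nat (Suc n) powr (1 - s) - of_nat (Suc (Suc n)) powr (1 - s)) +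
      (\<Sum>k=1..K. ((1 - s) gchoose k) * of_nat (Suc n) powr (1 - s - of_nat k))) =
      (\<lambda>n. binomial_error K n s)"
  proof
    fix n
    have "{..K} = insert 0 {1..K}" by auto
    then show "(of_nat (Suc n) powr (1 - s) - of_nat (Suc (Suc n)) powr (1 - s)) +
      (\<Sum>k=1..K. ((1 - s) gchoose k) * of_nat (Suc n) powr (1 - s - of_nat k)) = binomial_error K n s"
      unfolding binomial_error_def by (simp del: of_nat_Suc)
  qed
  finally have "(\<Sum>m. binomial_error K m s) =
      1 + (\<Sum>k=1..K. ((1 - s) gchoose k) * dirichlet_zeta (s + of_nat k - 1))"
    by (simp add: sums_iff)
  also have "{1..K} = insert 1 {2..K}" using assms by auto
  also have "(\<Sum>k\<in>insert 1 {2..K}. ((1 - s) gchoose k) * dirichlet_zeta (s + of_nat k - 1)) =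
      (1 - s) * dirichlet_zeta s + (\<Sum>k=2..K. ((1 - s) gchoose k) * dirichlet_zeta (s + of_nat k - 1))"
    by (subst sum.insert) auto
  finally show ?thesis by (simp add: algebra_simps)
qed

text \<open>Continuing (s - 1) \<zeta>(s) rather than \<zeta> removes the pole. The poles of the
  shifted values \<zeta>(s + k - 1) are harmless as well: the k-th binomial coefficient contains the
  factor -(s + k - 2)/k, which combines with the shifted value to a value of the function already
  continued.\<close>

lemma zeta_continuation_halfplane:
  "\<exists>g. g holomorphic_on {s. Re s > - real m} \<and> (\<forall>s. Re s > 1 \<longrightarrow> g s = (s - 1) * dirichlet_zeta s)"
proof (induction m)
  case 0
  have "(\<lambda>s. 1 - (\<Sum>m. binomial_error 1 m s)) holomorphic_on {s. Re s > - real 0}"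
    using binomial_error_suminf_holomorphic[of 1] by (intro holomorphic_intros) simp
  then show ?case
    using dirichlet_zeta_functional[of _ 1]
    by (intro exI[of _ "\<lambda>s. 1 - (\<Sum>m. binomial_error 1 m s)"]) auto
next
  case (Suc m)
  then obtain g where g: "g holomorphic_on {s. Re s > - real m}"
    "\<And>s. Re s > 1 \<Longrightarrow> g s = (s - 1) * dirichlet_zeta s" by blast
  \<comment> \<open>The error sum is then holomorphic for Re s > 1 - K = -(m + 1), and the shifts by
    k - 1 \<ge> 1 land in the half plane of the induction hypothesis.\<close>
  define K where "K = m + 2"
  define h where "h = (\<lambda>s. 1 - (\<Sum>m. binomial_error K m s)
    - (\<Sum>k=2..K. ((1 - s) gchoose (k - 1)) / of_nat k * g (s + of_nat k - 1)))"
  have [holomorphic_intros]: "(\<lambda>s. (1 - s) gchoose k) holomorphic_on S" for k S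
    unfolding gbinomial_prod_rev by (intro holomorphic_intros) auto
  have shift: "(\<lambda>s. g (s + of_nat k - 1)) holomorphic_on {s. Re s > - real (Suc m)}"
    if "k \<in> {2..K}" for k
  proof -
    have "(g \<circ> (\<lambda>s. s + of_nat k - 1)) holomorphic_on {s. Re s > - real (Suc m)}"
      using that by (intro holomorphic_on_compose_gen[OF _ g(1)] holomorphic_intros) auto
    then show ?thesis by (simp add: o_def)
  qed
  have "h holomorphic_on {s. Re s > - real (Suc m)}"
    unfolding h_def using binomial_error_suminf_holomorphic[of K]
    by (intro holomorphic_intros shift) (auto simp: K_def)
  moreover have "h s = (s - 1) * dirichlet_zeta s" if s: "Re s > 1" for s
  proof -
    have "((1 - s) gchoose (k - 1)) / of_nat k * g (s + of_nat k - 1) =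
        - (((1 - s) gchoose k) * dirichlet_zeta (s + of_nat k - 1))" if k: "k \<in> {2..K}" for k
    proof -
      obtain j where j: "k = Suc j" using k by (cases k) auto
      have geq: "g (s + of_nat k - 1) = (s + of_nat k - 2) * dirichlet_zeta (s + of_nat k - 1)"
        using g(2)[of "s + of_nat k - 1"] s k by simp
      have beq: "((1 - s) gchoose k) = ((1 - s) gchoose j) * (- (s + of_nat k - 2)) / of_nat k"
      proof -
        have "(1 - s gchoose j) * (1 - s - of_nat j) = of_nat (Suc j) * (1 - s gchoose Suc j)"
          using gbinomial_mult_1[of "1 - s" j] by (simp add: algebra_simps del: of_nat_Suc)
        then show ?thesis unfolding j by (simp add: nonzero_eq_divide_eq mult_ac del: of_nat_Suc) (simp add: algebra_simps)
      qed
      have "c / x * (y * z) = - (c * (- y) / x * z)" for c x y z :: complex by simp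
      moreover have "k - 1 = j" using j by simp
      ultimately show ?thesis unfolding geq beq by metis
    qed
    then have "h s = 1 - (\<Sum>m. binomial_error K m s) +
        (\<Sum>k=2..K. ((1 - s) gchoose k) * dirichlet_zeta (s + of_nat k - 1))"
      unfolding h_def by (simp add: sum_negf)
    then show ?thesis using dirichlet_zeta_functional[OF s, of K] by (simp add: K_def)
  qed
  ultimately show ?case by blast
qed

text \<open>The half planes are nested and all functions agree for Re s > 1, so the identity theorem
  glues them; only then is the result divided by s - 1.\<close>

lemma zeta_continuation_exists:
  "\<exists>f. f holomorphic_on (- {1}) \<and> f 1 = 0 \<and> (\<forall>s. Re s > 1 \<longrightarrow> f s = dirichlet_zeta s)"
proof -
  from zeta_continuation_halfplane obtain g where
    hol: "\<And>m. g m holomorphic_on {s. Re s > - real m}" and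
    g: "\<And>m s. Re s > 1 \<Longrightarrow> g m s = (s - 1) * dirichlet_zeta s"
    by metis
  have conn: "connected {s. Re s > a}" for a
    by (intro convex_connected convex_halfspace_Re_gt)
  have agree: "g m s = g n s" if "Re s > - real m" "m \<le> n" for m n s
  proof (rule analytic_continuation_open[where s = "{s. Re s > 1}" and s' = "{s. Re s > - real m}"
        and f = "g m" and g = "g n"])
    show "{s. Re s > 1} \<noteq> {}" by (auto intro!: exI[of _ 2])
    show "g n holomorphic_on {s. - real m < Re s}"
      using that by (intro holomorphic_on_subset[OF hol]) auto
  qed (use that g hol conn open_Re_gt in auto)
  define M where "M = (\<lambda>s. Suc (nat \<lceil>- Re s\<rceil>))"
  have M: "Re s > - real (M s)" for s unfolding M_def by linarith
  define f where "f = (\<lambda>s. if s = 1 then 0 else g (M s) s / (s - 1))"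
  have f: "f s = g m s / (s - 1)" if "Re s > - real m" "s \<noteq> 1" for s m
  proof -
    have "g (M s) s = g m s"
    proof (cases "m \<le> M s")
      case True
      then show ?thesis using agree[of m s "M s"] that by metis
    next
      case False
      then show ?thesis using agree[of "M s" s m] M[of s] by simp
    qed
    then show ?thesis using that by (simp add: f_def)
  qed
  have "f holomorphic_on (\<Union>m\<in>UNIV. {s. Re s > - real m} - {1})"
  proof (rule holomorphic_on_UN_open)
    fix m
    show "open ({s. Re s > - real m} - {1})" by (intro open_Diff open_Re_gt) auto
    have "(\<lambda>s. g m s / (s - 1)) holomorphic_on ({s. Re s > - real m} - {1})"
      by (intro holomorphic_intros holomorphic_on_subset[OF hol]) auto
    then show "f holomorphic_on ({s. Re s > - real m} - {1})"
      by (rule holomorphic_transform) (use f in auto)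
  qed
  also have "(\<Union>m\<in>UNIV. {s. Re s > - real m} - {1}) = - {1}" using M by blast
  finally have "f holomorphic_on (- {1})" .
  moreover have "f s = dirichlet_zeta s" if "Re s > 1" for s
  proof -
    have "s \<noteq> 1" using that by auto
    then show ?thesis using f[of 0 s] g[OF that] that by simp
  qed
  ultimately show ?thesis by (intro exI[of _ f]) (auto simp: f_def)
qed

text \<open>Uniqueness in the definite description follows from the identity theorem, because the
  plane without one point is connected; at 1 itself the value is prescribed.\<close>

lemma riemann_zeta_holomorphic: "riemann_zeta holomorphic_on (- {1})"
  and riemann_zeta_eq_dirichlet: "\<And>s. Re s > 1 \<Longrightarrow> riemann_zeta s = dirichlet_zeta s"
proof -
  let ?P = "\<lambda>f. f holomorphic_on (- {1}) \<and> f 1 = 0 \<and>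
     (\<forall>s. Re s > 1 \<longrightarrow> (\<lambda>n. of_nat (Suc n) powr (- s)) sums f s)"
  obtain f where f: "f holomorphic_on (- {1})" "f 1 = 0" "\<And>s. Re s > 1 \<Longrightarrow> f s = dirichlet_zeta s"
    using zeta_continuation_exists by blast
  have P: "?P f" using f dirichlet_zeta_sums by simp
  have "h = f" if h: "?P h" for h
  proof
    fix s
    show "h s = f s"
    proof (cases "s = 1")
      case False
      show ?thesis
      proof (rule analytic_continuation_open[where s = "{s. Re s > 1}" and s' = "- {1}"
            and f = h and g = f])
        show "{s. Re s > 1} \<noteq> {}" by (auto intro!: exI[of _ 2])
        show "connected (- {1 :: complex})" by (rule connected_punctured_universe) simp
        show "h z = f z" if "z \<in> {s. Re s > 1}" for z
          using that h P sums_unique2 by blast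
      qed (use False h f open_Re_gt in auto)
    qed (use h f in auto)
  qed
  with P have "riemann_zeta = f" unfolding riemann_zeta_def by (intro the_equality) blast+
  with f show "riemann_zeta holomorphic_on (- {1})" "\<And>s. Re s > 1 \<Longrightarrow> riemann_zeta s = dirichlet_zeta s"
    by auto
qed

text \<open>The case K = 1 of the continuation, where no shifted values occur, already covers a
  neighbourhood of 1 and has an explicit numerator.\<close>

lemma riemann_zeta_near_1:
  assumes "Re s > 0" "s \<noteq> 1"
  shows "riemann_zeta s = (1 - (\<Sum>m. binomial_error 1 m s)) / (s - 1)"
proof -
  have "(s - 1) * riemann_zeta s = 1 - (\<Sum>m. binomial_error 1 m s)"
  proof (rule analytic_continuation_open[where s = "{s. Re s > 1}" and s' = "{s. Re s > 0} - {1}"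
        and f = "\<lambda>s. (s - 1) * riemann_zeta s"])
    show "{s. Re s > 1} \<noteq> {}" by (auto intro!: exI[of _ 2])
    show "connected ({s. Re s > 0} - {1 :: complex})"
      by (intro connected_open_delete open_Re_gt convex_connected convex_halfspace_Re_gt) auto
    show "(\<lambda>s. 1 - (\<Sum>m. binomial_error 1 m s)) holomorphic_on {s. Re s > 0} - {1}"
      using binomial_error_suminf_holomorphic[of 1]
      by (intro holomorphic_intros) (auto intro: holomorphic_on_subset)
    show "(\<lambda>s. (s - 1) * riemann_zeta s) holomorphic_on {s. Re s > 0} - {1}"
      by (intro holomorphic_intros holomorphic_on_subset[OF riemann_zeta_holomorphic]) auto
    show "(z - 1) * riemann_zeta z = 1 - (\<Sum>m. binomial_error 1 m z)" if "z \<in> {s. Re s > 1}" for z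
      using that dirichlet_zeta_functional[of z 1] by (simp add: riemann_zeta_eq_dirichlet)
  qed (use assms open_Re_gt in \<open>auto intro!: open_Diff\<close>)
  then show ?thesis using assms by (simp add: field_simps)
qed

text \<open>The partial sum telescopes to 1 - (n+1) powr (1 - s) plus (1 - s) times the sum of k
  powr (-s) for k \<le> n, which is differentiated twice by hand.\<close>

lemma second_deriv_binomial_error_sum:
  "(deriv ^^ 2) (\<lambda>s. \<Sum>m<n. binomial_error 1 m s) 1 =
     of_real (2 * (\<Sum>k=1..n. ln (real k) / real k) - (ln (real (Suc n)))\<^sup>2)"
proof -
  define l where "l = (\<lambda>k. complex_of_real (ln (real k)))"
  have pw: "of_nat k powr s = exp (s * l k)" if "k > 0" for k s
    using that by (simp add: powr_def l_def Ln_of_nat)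
  define F where "F = (\<lambda>s. 1 - exp ((1 - s) * l (Suc n)) + (\<Sum>k=1..n. (1 - s) * exp (- s * l k)))"
  define F1 where "F1 = (\<lambda>s. l (Suc n) * exp ((1 - s) * l (Suc n)) +
      (\<Sum>k=1..n. - exp (- s * l k) - l k * (1 - s) * exp (- s * l k)))"
  define F2 where "F2 = (\<lambda>s. (\<Sum>k=1..n. 2 * l k * exp (- s * l k) + (l k)\<^sup>2 * (1 - s) * exp (- s * l k))
      - (l (Suc n))\<^sup>2 * exp ((1 - s) * l (Suc n)))"
  have F: "(\<Sum>m<n. binomial_error 1 m s) = F s" for s
  proof (unfold F_def, induction n)
    case 0
    then show ?case by (simp add: l_def)
  next
    case (Suc n)
    have [simp]: "complex_of_nat (Suc 0) = 1" by simp
    have "binomial_error 1 n s = exp ((1 - s) * l (Suc n)) + (1 - s) * exp (- s * l (Suc n))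
        - exp ((1 - s) * l (Suc (Suc n)))"
      by (simp add: binomial_error_def pw del: of_nat_Suc)
    then show ?case unfolding sum.lessThan_Suc Suc.IH by simp
  qed
  have d1: "(F has_field_derivative F1 s) (at s)" for s
    unfolding F_def F1_def
    by (auto intro!: derivative_eq_intros sum.cong simp: algebra_simps)
  have d2: "(F1 has_field_derivative F2 s) (at s)" for s
    unfolding F1_def F2_def
    by (auto intro!: derivative_eq_intros sum.cong simp: algebra_simps power2_eq_square)
  have "deriv F = F1" "deriv F1 = F2"
    using DERIV_imp_deriv[OF d1] DERIV_imp_deriv[OF d2] by auto
  then have "(deriv ^^ 2) F 1 = F2 1" by (simp add: numeral_2_eq_2)
  also have "\<dots> = of_real (2 * (\<Sum>k=1..n. ln (real k) / real k) - (ln (real (Suc n)))\<^sup>2)"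
  proof -
    have "(\<Sum>k=1..n. 2 * l k * exp (- 1 * l k) + (l k)\<^sup>2 * (1 - 1) * exp (- 1 * l k)) =
        of_real (2 * (\<Sum>k=1..n. ln (real k) / real k))"
      unfolding of_real_mult of_real_sum sum_distrib_left
    proof (intro sum.cong refl)
      fix k assume "k \<in> {1..n}"
      then have "exp (- 1 * l k) = of_real (1 / real k)"
        by (simp add: l_def exp_minus exp_of_real inverse_eq_divide)
      then show "2 * l k * exp (- 1 * l k) + (l k)\<^sup>2 * (1 - 1) * exp (- 1 * l k) =
          of_real 2 * of_real (ln (real k) / real k)"
        by (simp add: l_def)
    qed
    then show ?thesis by (simp add: F2_def l_def)
  qed
  finally show ?thesis using F by simp
qed

text \<open>Near 1, \<zeta>(s) = (1 - R(s))/(s - 1), so the coefficient -\<gamma>_1 of s - 1 equals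
  -R''(1)/2. As the partial sums converge to R uniformly on a disc, their second derivatives
  converge too.\<close>

theorem stieltjes_1_LIMSEQ:
  "(\<lambda>n. (\<Sum>k=1..n. ln (real k) / real k) - (ln (real (Suc n)))\<^sup>2 / 2) \<longlonglongrightarrow> stieltjes 1"
proof -
  define R where "R = (\<lambda>s. \<Sum>m. binomial_error 1 m s)"
  define G where "G = (\<lambda>s. 1 - R s)"
  have holR: "R holomorphic_on {s. Re s > 0}"
    using binomial_error_suminf_holomorphic[of 1] by (simp add: R_def)
  have anG: "G analytic_on {1}"
    unfolding G_def using holR open_Re_gt
    by (intro analytic_intros) (auto simp: analytic_at intro!: exI[of _ "{s. Re s > 0}"])
  define F where "F = fps_expansion G 1"
  have "(\<lambda>x. G (1 + x)) has_laurent_expansion fps_to_fls F"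
    unfolding F_def by (intro has_laurent_expansion_fps analytic_at_imp_has_fps_expansion anG)
  from has_laurent_expansion_shift'[OF this, of 1]
  have "(\<lambda>x. G (1 + x) * x powi (-1)) has_laurent_expansion fls_shift 1 (fps_to_fls F)" .
  moreover have "eventually (\<lambda>x. G (1 + x) * x powi (-1) = riemann_zeta (1 + x)) (at 0)"
  proof -
    have "eventually (\<lambda>x. x \<in> ball 0 1 - {0}) (at (0 :: complex))"
      by (intro eventually_at_in_open) auto
    then show ?thesis
    proof eventually_elim
      case (elim x)
      then have "Re (1 + x) > 0" using abs_Re_le_cmod[of x] by auto
      then show ?case using riemann_zeta_near_1[of "1 + x"] elim
        by (simp add: G_def R_def power_int_minus field_simps)
    qed
  qed
  ultimately have "(\<lambda>x. riemann_zeta (1 + x)) has_laurent_expansion fls_shift 1 (fps_to_fls F)"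
    by (subst (asm) has_laurent_expansion_cong[OF _ refl]) auto
  then have "laurent_expansion riemann_zeta 1 = fls_shift 1 (fps_to_fls F)"
    by (rule laurent_expansion_eqI)
  then have "stieltjes 1 = - Re (fps_nth F 2)"
    by (simp add: stieltjes_def)
  also have "fps_nth F 2 = (deriv ^^ 2) G 1 / 2"
    by (simp add: F_def fps_expansion_def)
  also have "(deriv ^^ 2) G 1 = - (deriv ^^ 2) R 1"
  proof -
    have "(deriv ^^ 2) (\<lambda>s. 1 - R s) 1 = (deriv ^^ 2) (\<lambda>s. 1) 1 - (deriv ^^ 2) R (1 :: complex)"
      using holR open_Re_gt by (intro higher_deriv_diff[where S = "{s. Re s > 0}"]) auto
    then show ?thesis by (simp add: G_def numeral_2_eq_2)
  qed
  finally have st: "stieltjes 1 = Re ((deriv ^^ 2) R 1) / 2" by simp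
  obtain d where d: "d > 0"
    "uniform_limit (cball 1 d) (\<lambda>n s. \<Sum>m<n. binomial_error 1 m s) R sequentially"
    using binomial_error_uniform_limit[of 1 1] unfolding R_def by auto
  have "(\<lambda>n. (deriv ^^ 2) (\<lambda>s. \<Sum>m<n. binomial_error 1 m s) 1) \<longlonglongrightarrow> (deriv ^^ 2) R 1"
  proof (rule higher_deriv_complex_uniform_limit)
    show "uniform_limit (ball 1 d) (\<lambda>n s. \<Sum>m<n. binomial_error 1 m s) R sequentially"
      using d(2) by (rule uniform_limit_on_subset) auto
    show "eventually (\<lambda>n. (\<lambda>s. \<Sum>m<n. binomial_error 1 m s) holomorphic_on ball 1 d) sequentially"
      by (intro always_eventually allI holomorphic_intros binomial_error_holomorphic)
  qed (use d in auto)
  from tendsto_divide[OF tendsto_Re[OF this] tendsto_const[of 2]]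
  show ?thesis
    unfolding second_deriv_binomial_error_sum st by (simp add: diff_divide_distrib)
qed

subsection \<open>Abel's limit theorem\<close>

text \<open>Multiplying the generating function of the partial sums by 1 - x undoes the summation.
  The rule serves below both to evaluate series and to turn bounds on partial sums into bounds near
  x = 1.\<close>

lemma sums_by_parts_power:
  fixes b :: "nat \<Rightarrow> real"
  assumes "summable (\<lambda>n. (\<Sum>k\<le>n. b k) * x ^ n)"
  shows "(\<lambda>n. b n * x ^ n) sums ((1 - x) * (\<Sum>n. (\<Sum>k\<le>n. b k) * x ^ n))"
proof -
  define B where "B = (\<lambda>n. (\<Sum>k\<le>n. b k) * x ^ n)"
  define S where "S = suminf B"
  have B: "B sums S" using assms by (simp add: B_def S_def summable_sums)
  then have "(\<lambda>n. x * B n) sums (x * S)" by (rule sums_mult)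
  moreover define A where "A = (\<lambda>n. if n = 0 then 0 else x * B (n - 1))"
  moreover have "(\<lambda>n. A (Suc n)) = (\<lambda>n. x * B n)" by (simp add: A_def)
  ultimately have "(\<lambda>n. A (Suc n)) sums (x * S)" by simp
  then have "A sums (x * S + A 0)" by (rule sums_Suc)
  then have "A sums (x * S)" by (simp add: A_def)
  from sums_diff[OF B this] have "(\<lambda>n. B n - A n) sums (S - x * S)" .
  moreover have "B n - A n = b n * x ^ n" for n
    by (cases n) (auto simp: A_def B_def algebra_simps)
  ultimately show ?thesis by (simp add: S_def B_def algebra_simps)
qed

text \<open>After summation by parts the difference to \<open>c\<close> is (1 - x) times the power
  series of the errors \<open>B n\<close>. Beyond \<open>N\<close> these are at most e/2, and the
  geometric series cancels 1 - x; the part below \<open>N\<close> stays bounded and is killed by 1 -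
  x.\<close>

lemma abel_limit:
  fixes b :: "nat \<Rightarrow> real"
  assumes "b sums c"
  shows "((\<lambda>x. \<Sum>n. b n * x ^ n) \<longlongrightarrow> c) (at_left 1)"
proof (rule tendstoI)
  fix e :: real assume e: "e > 0"
  define B where "B = (\<lambda>n. (\<Sum>k\<le>n. b k) - c)"
  have B0: "B \<longlonglongrightarrow> 0"
    using assms by (auto simp: B_def sums_def_le intro: tendsto_eq_intros)
  then obtain N where N: "\<And>n. n \<ge> N \<Longrightarrow> \<bar>B n\<bar> \<le> e / 2"
    using e by (auto simp: LIMSEQ_def dest!: spec[of _ "e / 2"]) (meson less_imp_le)
  from B0 obtain K where K: "\<And>n. \<bar>B n\<bar> \<le> K"
    by (metis Bseq_def convergentI convergent_imp_Bseq real_norm_def)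
  define D where "D = (\<Sum>n<N. \<bar>B n\<bar>)"
  have D: "D \<ge> 0" by (auto simp: D_def intro: sum_nonneg)
  \<comment> \<open>The threshold is chosen so that (1 - x)(D + 1) < e/2; adding 1 avoids dividing
    by zero when D = 0.\<close>
  have "eventually (\<lambda>x::real. x \<in> {max 0 (1 - e / (2 * (D + 1)))<..<1}) (at_left 1)"
    using e D by (intro eventually_at_left_real) auto
  then show "eventually (\<lambda>x. dist (\<Sum>n. b n * x ^ n) c < e) (at_left 1)"
  proof eventually_elim
    case (elim x)
    then have x: "0 < x" "x < 1" "1 - x < e / (2 * (D + 1))" by auto
    have geo: "(\<lambda>n. x ^ n) sums (1 / (1 - x))" using x by (intro geometric_sums) auto
    have sB: "summable (\<lambda>n. \<bar>B n\<bar> * x ^ n)"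
    proof (rule summable_comparison_test'[of "\<lambda>n. K * x ^ n" 0])
      show "summable (\<lambda>n. K * x ^ n)" using x by (intro summable_mult summable_geometric) auto
      show "norm (\<bar>B n\<bar> * x ^ n) \<le> K * x ^ n" for n
        using mult_right_mono[OF K[of n], of "x ^ n"] x by (simp add: abs_mult)
    qed
    then have sB': "summable (\<lambda>n. B n * x ^ n)"
      using x by (intro summable_norm_cancel[of "\<lambda>n. B n * x ^ n"]) (simp add: abs_mult)
    have eqB: "(\<Sum>k\<le>n. b k) * x ^ n = B n * x ^ n + c * x ^ n" for n
      by (simp add: B_def algebra_simps)
    have "(\<lambda>n. (\<Sum>k\<le>n. b k) * x ^ n) sums ((\<Sum>n. B n * x ^ n) + c * (1 / (1 - x)))"
      unfolding eqB by (intro sums_add sums_mult geo summable_sums sB')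
    then have "(\<Sum>n. b n * x ^ n) = (1 - x) * ((\<Sum>n. B n * x ^ n) + c * (1 / (1 - x)))"
      using sums_by_parts_power[of b x] by (simp add: sums_iff)
    then have eq: "(\<Sum>n. b n * x ^ n) - c = (1 - x) * (\<Sum>n. B n * x ^ n)"
    proof -
      have "(1 - x) * (c * (1 / (1 - x))) = c" using x by simp
      then show ?thesis using \<open>(\<Sum>n. b n * x ^ n) = _\<close> by (simp only: distrib_left)
    qed
    have "\<bar>\<Sum>n. B n * x ^ n\<bar> \<le> (\<Sum>n. \<bar>B n\<bar> * x ^ n)"
      using summable_rabs[of "\<lambda>n. B n * x ^ n"] sB x by (simp add: abs_mult)
    also have "\<dots> = (\<Sum>n. \<bar>B (n + N)\<bar> * x ^ (n + N)) + (\<Sum>n<N. \<bar>B n\<bar> * x ^ n)"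
      using suminf_split_initial_segment[OF sB] by simp
    also have "(\<Sum>n<N. \<bar>B n\<bar> * x ^ n) \<le> D"
      unfolding D_def using x by (intro sum_mono mult_left_le power_le_one) auto
    also have "(\<Sum>n. \<bar>B (n + N)\<bar> * x ^ (n + N)) \<le> (\<Sum>n. e / 2 * x ^ n)"
    proof (rule suminf_le)
      show "summable (\<lambda>n. \<bar>B (n + N)\<bar> * x ^ (n + N))"
        using sB by (subst summable_iff_shift[of "\<lambda>n. \<bar>B n\<bar> * x ^ n"])
      show "summable (\<lambda>n. e / 2 * x ^ n)" using x by (intro summable_mult summable_geometric) auto
      show "\<bar>B (n + N)\<bar> * x ^ (n + N) \<le> e / 2 * x ^ n" for n
        using x N[of "n + N"] e by (intro mult_mono power_decreasing) auto
    qed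
    also have "(\<Sum>n. e / 2 * x ^ n) = e / 2 * (1 / (1 - x))"
      using sums_mult[OF geo, of "e / 2"] by (simp add: sums_iff)
    finally have "\<bar>\<Sum>n. B n * x ^ n\<bar> \<le> e / 2 * (1 / (1 - x)) + D" by simp
    then have "(1 - x) * \<bar>\<Sum>n. B n * x ^ n\<bar> \<le> (1 - x) * (e / 2 * (1 / (1 - x)) + D)"
      using x by (intro mult_left_mono) auto
    also have "\<dots> = e / 2 + (1 - x) * D" using x by (simp add: field_simps)
    also have "(1 - x) * D \<le> (1 - x) * (D + 1)" using x by (intro mult_left_mono) auto
    also have "\<dots> < e / 2" using x D by (simp add: field_simps)
    finally show ?case unfolding dist_real_def eq using x by (simp add: abs_mult)
  qed
qed

subsection \<open>Sums of the divisor function\<close>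

lemma finite_divisors: "n > 0 \<Longrightarrow> finite {d. d > 0 \<and> d dvd (n::nat)}"
  by (auto intro: finite_subset[of _ "{..n}"] dvd_imp_le)

text \<open>All positive numbers divide 0, and \<open>card\<close> of an infinite set is 0. Hence
  index 0 drops out of the power series.\<close>

lemma divisor_count_0 [simp]: "divisor_count 0 = 0"
proof -
  have "infinite {d::nat. d > 0}"
    using infinite_Ioi[of "0::nat"] by (simp add: greaterThan_def)
  then show ?thesis by (simp add: divisor_count_def)
qed

lemma divisor_count_le: "divisor_count n \<le> n"
proof (cases "n = 0")
  case False
  then have "{d. d > 0 \<and> d dvd n} \<subseteq> {1..n}" by (auto intro: dvd_imp_le)
  then have "card {d. d > 0 \<and> d dvd n} \<le> card {1..n}" by (intro card_mono) auto
  then show ?thesis by (simp add: divisor_count_def)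
qed simp

lemma sum_divisor_count:
  fixes f :: "nat \<Rightarrow> real"
  shows "(\<Sum>n=1..N. real (divisor_count n) * f n) = (\<Sum>(d, k) | d \<ge> 1 \<and> k \<ge> 1 \<and> d * k \<le> N. f (d * k))"
proof -
  have "(\<Sum>(d, k) | d \<ge> 1 \<and> k \<ge> 1 \<and> d * k \<le> N. f (d * k)) =
      (\<Sum>(n, d)\<in>(SIGMA n:{1..N}. {d. d > 0 \<and> d dvd n}). f n)"
    by (rule sum.reindex_bij_witness[of _ "\<lambda>(n, d). (d, n div d)" "\<lambda>(d, k). (d * k, d)"])
       (auto simp: dvd_div_eq_0_iff Suc_le_eq)
  also have "\<dots> = (\<Sum>n=1..N. \<Sum>d | d > 0 \<and> d dvd n. f n)"
    by (subst sum.Sigma) (auto intro: finite_divisors)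
  finally show ?thesis by (simp add: divisor_count_def)
qed

lemma sum_pairs_le:
  fixes f :: "nat \<Rightarrow> nat \<Rightarrow> real"
  shows "(\<Sum>(d, k) | d \<ge> 1 \<and> k \<ge> 1 \<and> d * k \<le> N \<and> d \<le> M. f d k) =
    (\<Sum>d=1..M. \<Sum>k=1..N div d. f d k)"
proof -
  have "{(d, k). d \<ge> 1 \<and> k \<ge> 1 \<and> d * k \<le> N \<and> d \<le> M} = (SIGMA d:{1..M}. {1..N div d})"
    by (auto simp: less_eq_div_iff_mult_less_eq mult.commute Suc_le_eq)
  then show ?thesis by (simp add: sum.Sigma)
qed

lemma finite_pairs_mult_le: "finite {(d, k). (d::nat) \<ge> 1 \<and> k \<ge> 1 \<and> d * k \<le> (N::nat)}"
proof (rule finite_subset)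
  show "{(d, k). d \<ge> 1 \<and> k \<ge> 1 \<and> d * k \<le> N} \<subseteq> {..N} \<times> {..N}"
    by (auto intro: order_trans[rotated])
qed auto

lemma real_div_bounds: "real (n div d) \<le> real n / real d" "real n / real d < real (n div d) + 1"
  using floor_correct[of "real n / real d"] by (simp_all add: floor_divide_of_nat_eq)

lemma harm_le: "harm n \<le> real n"
proof -
  have "harm n \<le> (\<Sum>d=1..n. 1 :: real)"
    unfolding harm_def by (intro sum_mono) (auto simp: field_simps)
  then show ?thesis by simp
qed

text \<open>The divisor sum is the sum of N div d and so lies between N H_N - N and N H_N, while the
  harmonic numbers up to N sum to (N + 1) H_N - N. A linear error suffices: in the power series it
  costs 1/(1 - x) against a main term larger by a logarithm.\<close>

lemma sum_divisor_count_bounds: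
  "\<bar>\<Sum>n\<le>N. real (divisor_count n) - harm n\<bar> \<le> real N"
proof -
  have eq: "{(d, k). d \<ge> 1 \<and> k \<ge> 1 \<and> d * k \<le> N} = {(d, k). d \<ge> 1 \<and> k \<ge> 1 \<and> d * k \<le> N \<and> d \<le> N}"
    by (auto intro: order_trans[rotated])
  have "(\<Sum>n=1..N. real (divisor_count n) * 1) = (\<Sum>d=1..N. \<Sum>k=1..N div d. 1)"
    unfolding sum_divisor_count[where f = "\<lambda>_. 1"] eq by (rule sum_pairs_le)
  then have T0: "(\<Sum>n=1..N. real (divisor_count n)) = (\<Sum>d=1..N. real (N div d))" by simp
  have T: "(\<Sum>n\<le>N. real (divisor_count n)) = (\<Sum>d=1..N. real (N div d))"
  proof -
    have "{..N} = insert 0 {1..N}" by auto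
    then show ?thesis using T0 by simp
  qed
  have "(\<Sum>d=1..N. real (N div d)) \<le> (\<Sum>d=1..N. real N * inverse (real d))"
    by (intro sum_mono) (simp add: real_div_bounds(1) divide_inverse[symmetric])
  then have up: "(\<Sum>n\<le>N. real (divisor_count n)) \<le> N * harm N"
    unfolding T harm_def sum_distrib_left[symmetric] .
  have "(\<Sum>d=1..N. real N * inverse (real d) - 1) \<le> (\<Sum>d=1..N. real (N div d))"
  proof (intro sum_mono)
    fix d assume "d \<in> {1..N}"
    show "real N * inverse (real d) - 1 \<le> real (N div d)"
      using real_div_bounds(2)[of N d] by (simp add: divide_inverse[symmetric])
  qed
  then have lo: "N * harm N - N \<le> (\<Sum>n\<le>N. real (divisor_count n))"
    unfolding T harm_def sum_distrib_left[symmetric] sum_subtractf by simp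
  have H: "(\<Sum>n\<le>N. harm n) = (real N + 1) * harm N - real N"
  proof (induction N)
    case (Suc N)
    have "(real N + 1) * harm (Suc N) = (real N + 1) * harm N + 1"
      by (simp add: harm_Suc field_simps)
    then show ?case using Suc by (simp add: algebra_simps)
  qed (simp add: harm_def)
  have "harm N \<le> real N" by (rule harm_le)
  moreover have "harm N \<ge> (0::real)" by (rule harm_nonneg)
  ultimately show ?thesis using up lo H by (simp add: sum_subtractf algebra_simps abs_le_iff)
qed

text \<open>Both \<gamma> and \<open>harm m - ln x\<close> lie between
  \<open>harm m - ln (m + 1)\<close> and \<open>harm m - ln m\<close>, which differ by at most 1/m.
  The real \<open>x\<close> will be N/d, with \<open>m\<close> its integer part.\<close>

lemma harm_minus_ln_bounds:
  assumes "m \<ge> 1" "real m \<le> x" "x < real m + 1"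
  shows "\<bar>harm m - ln x - euler_mascheroni\<bar> \<le> 1 / real m"
proof -
  have "euler_mascheroni \<le> harm m - ln (real m)"
    using euler_mascheroni_LIMSEQ
  proof (rule LIMSEQ_le_const2, intro exI allI impI)
    fix n assume "n \<ge> m"
    then show "harm n - ln (real n) \<le> harm m - ln (real m)"
      using euler_mascheroni_sequence_decreasing[of m n] assms by simp
  qed
  moreover have "harm m - ln (real m + 1) \<le> euler_mascheroni"
    using euler_mascheroni_lower[of "m - 1"] assms
    by (simp add: of_nat_diff Suc_diff_le add_ac) (smt (verit) divide_nonneg_nonneg of_nat_0_le_iff)
  moreover have "ln (real m + 1) - ln (real m) \<le> 1 / real m"
  proof -
    have "ln (real m + 1) - ln (real m) = ln (1 + 1 / real m)"
    proof -
      have "1 + 1 / real m = (real m + 1) / real m" using assms by (simp add: field_simps)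
      then show ?thesis using assms by (simp add: ln_div)
    qed
    also have "\<dots> \<le> 1 / real m" by (rule ln_add_one_self_le_self) simp
    finally show ?thesis .
  qed
  moreover have "ln (real m) \<le> ln x" "ln x \<le> ln (real m + 1)" using assms by auto
  ultimately show ?thesis by linarith
qed

text \<open>As M is the integer square root of N, a pair with product at most N has a component at
  most M, and all pairs in the square of side M qualify. Inclusion and exclusion with the symmetry
  of the two regions give the formula.\<close>

lemma hyperbola:
  assumes "M\<^sup>2 \<le> N" "N < (Suc M)\<^sup>2"
  shows "(\<Sum>n=1..N. real (divisor_count n) / n) = 2 * (\<Sum>d=1..M. harm (N div d) / d) - (harm M)\<^sup>2"
proof -
  let ?S = "{(d, k). d \<ge> 1 \<and> k \<ge> 1 \<and> d * k \<le> N}"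
  let ?A = "{(d, k). d \<ge> 1 \<and> k \<ge> 1 \<and> d * k \<le> N \<and> d \<le> M}"
  let ?B = "{(d, k). d \<ge> 1 \<and> k \<ge> 1 \<and> d * k \<le> N \<and> k \<le> M}"
  let ?f = "\<lambda>(d, k). 1 / real (d * k)"
  have fin: "finite ?A" "finite ?B"
    by (rule finite_subset[OF _ finite_pairs_mult_le[of N]]; auto)+
  have "?S \<subseteq> ?A \<union> ?B"
  proof
    fix p assume p: "p \<in> ?S"
    show "p \<in> ?A \<union> ?B"
    proof (rule ccontr)
      assume np: "p \<notin> ?A \<union> ?B"
      obtain d k where dk: "p = (d, k)" by (cases p)
      then have "d \<ge> Suc M" "k \<ge> Suc M" "d * k \<le> N" using p np by auto
      then show False using assms(2) mult_le_mono[of "Suc M" d "Suc M" k]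
        by (simp add: power2_eq_square)
    qed
  qed
  then have S: "?S = ?A \<union> ?B" by auto
  have I: "?A \<inter> ?B = {1..M} \<times> {1..M}"
  proof (intro equalityI subsetI)
    fix p assume "p \<in> {1..M} \<times> {1..M}"
    then obtain d k where p: "p = (d, k)" "1 \<le> d" "d \<le> M" "1 \<le> k" "k \<le> M" by auto
    then have "d * k \<le> N" using mult_le_mono[of d M k M] assms(1) by (auto simp: power2_eq_square)
    then show "p \<in> ?A \<inter> ?B" using p by auto
  qed auto
  have sA: "sum ?f ?A = (\<Sum>d=1..M. harm (N div d) / d)"
    by (subst sum_pairs_le) (simp add: harm_def sum_divide_distrib field_simps)
  have sB: "sum ?f ?B = sum ?f ?A"
    by (rule sum.reindex_bij_witness[of _ "\<lambda>(d, k). (k, d)" "\<lambda>(d, k). (k, d)"]) (auto simp: mult.commute)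
  have sI: "sum ?f ({1..M} \<times> {1..M}) = (harm M)\<^sup>2"
    unfolding power2_eq_square harm_def sum_product sum.cartesian_product
    by (intro sum.cong) (auto simp: field_simps)
  have "(\<Sum>n=1..N. real (divisor_count n) * (1 / n)) = sum ?f ?S"
    by (subst sum_divisor_count) simp
  also have "\<dots> = sum ?f ?A + sum ?f ?B - sum ?f (?A \<inter> ?B)"
    unfolding S using fin by (rule sum_Un)
  finally show ?thesis unfolding I sI sB sA by simp
qed

text \<open>Replacing \<open>harm (N div d)\<close> by ln(N/d) + \<gamma> costs at most 2d/N, hence
  2/N after division by d. The M summands together cost 2M/N \<le> 2/M, and the hyperbola formula
  doubles this.\<close>

lemma hyperbola_ln:
  assumes "M\<^sup>2 \<le> N" "N < (Suc M)\<^sup>2" "M \<ge> 1"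
  shows "\<bar>(\<Sum>n=1..N. real (divisor_count n) / n) - (2 * (ln N + euler_mascheroni) * harm M
    - 2 * (\<Sum>d=1..M. ln (real d) / d) - (harm M)\<^sup>2)\<bar> \<le> 4 / M"
proof -
  define \<gamma> :: real where "\<gamma> = euler_mascheroni"
  have N: "N > 0" using assms by (metis One_nat_def Suc_le_eq le_zero_eq not_gr_zero power_eq_0_iff zero_less_one_class.zero_le_one)
  have "M * 1 \<le> M * M" using assms by (intro mult_le_mono) auto
  then have MN: "M \<le> N" using assms(1) unfolding power2_eq_square by linarith
  have "\<bar>\<Sum>d=1..M. (harm (N div d) - (ln N - ln d + \<gamma>)) / d\<bar> \<le> (\<Sum>d=1..M. 2 / real N)"
  proof (rule order_trans[OF sum_abs], rule sum_mono)
    fix d assume d: "d \<in> {1..M}"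
    let ?m = "N div d"
    have m: "?m \<ge> 1" using d MN by (auto simp: Suc_le_eq div_greater_zero_iff)
    note 1 = real_div_bounds(1)[of N d] and 2 = real_div_bounds(2)[of N d]
    have "ln (N / d) = ln N - ln d" using N d by (simp add: ln_div)
    then have "\<bar>harm ?m - (ln N - ln d + \<gamma>)\<bar> \<le> 1 / ?m"
      using harm_minus_ln_bounds[OF m 1 2] by (simp add: \<gamma>_def algebra_simps)
    also have "1 / real ?m \<le> 2 * d / N"
    proof -
      have "N / d \<le> 2 * real ?m" using 2 m by linarith
      then show ?thesis using m d N by (simp add: field_simps)
    qed
    finally show "\<bar>(harm ?m - (ln N - ln d + \<gamma>)) / d\<bar> \<le> 2 / real N"
      using d N by (simp add: abs_divide field_simps)
  qed
  also have "\<dots> = 2 * real M / N" by simp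
  also have "\<dots> \<le> 2 / M"
  proof -
    have "real M * real M \<le> N" using assms(1) unfolding power2_eq_square by (metis of_nat_le_iff of_nat_mult)
    then show ?thesis using assms(3) N by (simp add: field_simps)
  qed
  also have "(\<Sum>d=1..M. (harm (N div d) - (ln N - ln d + \<gamma>)) / d) =
      (\<Sum>d=1..M. harm (N div d) / d) - (ln N + \<gamma>) * harm M + (\<Sum>d=1..M. ln (real d) / d)"
    unfolding harm_def sum_distrib_left sum_subtractf[symmetric] sum.distrib[symmetric]
    by (intro sum.cong) (auto simp: field_simps)
  finally show ?thesis
    unfolding hyperbola[OF assms(1,2)] \<gamma>_def by (simp add: abs_le_iff algebra_simps)
qed

text \<open>The squares of the harmonic numbers telescope: H_n^2 - H_(n-1)^2 = 2 H_(n-1)/n + 1/n^2.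
  The squares 1/n^2 are the source of the pi^2/12 in the constant.\<close>

lemma sum_harm_div: "(\<Sum>n=1..N. harm (n - 1) / real n) = ((harm N)\<^sup>2 - (\<Sum>n=1..N. 1 / (real n)\<^sup>2)) / 2"
proof (induction N)
  case (Suc N)
  have "harm (Suc N) = harm N + 1 / real (Suc N)" by (simp add: harm_Suc inverse_eq_divide del: of_nat_Suc)
  then have "(harm (Suc N))\<^sup>2 = (harm N)\<^sup>2 + 2 * (harm N / real (Suc N)) + 1 / (real (Suc N))\<^sup>2"
    by (simp only: power2_sum power_divide) simp
  then show ?case using Suc by (simp del: of_nat_Suc)
qed (simp add: harm_def)


text \<open>With L = ln N, the hyperbola method gives L^2/2 + 2\<gamma>L + \<gamma>^2 - 2\<gamma>_1
  for the sum of divisor counts over n. The harmonic part and the \<gamma>/n part subtract L^2/2 +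
  \<gamma>L + \<gamma>^2/2 - pi^2/12 and \<gamma>L + \<gamma>^2, so everything growing with N
  cancels.\<close>

theorem sums_divisor_constant:
  "(\<lambda>n. (real (divisor_count n) - harm (n - 1) - euler_mascheroni) / real n) sums
     (pi\<^sup>2 / 12 - euler_mascheroni\<^sup>2 / 2 - 2 * stieltjes 1)"
proof -
  define \<gamma> :: real where "\<gamma> = euler_mascheroni"
  define D where "D = (\<lambda>N. \<Sum>n=1..N. real (divisor_count n) / n)"
  define Q where "Q = (\<lambda>N. \<Sum>n=1..N. 1 / (real n)\<^sup>2)"
  define G where "G = (\<lambda>N. \<Sum>d=1..N. ln (real d) / d)"
  define e :: "nat \<Rightarrow> real" where "e = (\<lambda>N. harm N - ln (real N) - \<gamma>)"
  define g where "g = (\<lambda>N. G N - (ln (real N))\<^sup>2 / 2 - stieltjes 1)"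
  define M where "M = floor_sqrt"
  define f where "f = (\<lambda>N. ln (real N) - 2 * ln (real (M N)))"
  define err where "err = (\<lambda>N. D N - (2 * (ln N + \<gamma>) * harm (M N) - 2 * G (M N) - (harm (M N))\<^sup>2))"
  have M1: "M N \<ge> 1" if "N \<ge> 1" for N
    using that by (simp add: M_def le_floor_sqrt_iff)
  have MM: "(M N)\<^sup>2 \<le> N" "N < (Suc (M N))\<^sup>2" for N
    unfolding M_def by (simp_all add: Suc_floor_sqrt_power2_gt)
  have Mlim: "filterlim M sequentially sequentially"
    unfolding filterlim_at_top M_def
    by (intro allI eventually_sequentiallyI[of "_\<^sup>2"]) (simp add: le_floor_sqrt_iff)
  have inv0: "(\<lambda>n. C / real n) \<longlonglongrightarrow> 0" for C by real_asymp
  have e0: "e \<longlonglongrightarrow> 0"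
    unfolding e_def \<gamma>_def using euler_mascheroni_LIMSEQ by (auto intro: tendsto_eq_intros)
  have ebound: "\<bar>e n\<bar> \<le> 1 / n" if "n \<ge> 1" for n
    using harm_minus_ln_bounds[of n "real n"] that by (simp add: e_def \<gamma>_def)
  \<comment> \<open>Errors of harmonic numbers get multiplied by logarithms, so their mere
    convergence to 0 is not enough; the rate 1/n is.\<close>
  have le0: "(\<lambda>n. ln (real n) * e n) \<longlonglongrightarrow> 0"
  proof (rule Lim_null_comparison)
    show "eventually (\<lambda>n. norm (ln (real n) * e n) \<le> ln n / n) sequentially"
      using eventually_ge_at_top[of 1]
    proof eventually_elim
      case (elim n)
      then show ?case using mult_left_mono[OF ebound[OF elim], of "ln n"] by (simp add: abs_mult)
    qed
    show "(\<lambda>n. ln (real n) / real n) \<longlonglongrightarrow> 0" by real_asymp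
  qed
  have g0: "g \<longlonglongrightarrow> 0"
  proof -
    have "(\<lambda>n. (ln (real (Suc n)))\<^sup>2 / 2 - (ln (real n))\<^sup>2 / 2) \<longlonglongrightarrow> 0" by real_asymp
    from tendsto_add[OF stieltjes_1_LIMSEQ this]
    have "(\<lambda>n. G n - (ln (real n))\<^sup>2 / 2) \<longlonglongrightarrow> stieltjes 1" by (simp add: G_def)
    from tendsto_diff[OF this tendsto_const[of "stieltjes 1"]] show ?thesis by (simp add: g_def)
  qed
  have Q0: "Q \<longlonglongrightarrow> pi\<^sup>2 / 6"
  proof -
    have "(\<lambda>n. \<Sum>k<n. 1 / (real k + 1)\<^sup>2) \<longlonglongrightarrow> pi\<^sup>2 / 6"
      using inverse_squares_sums by (simp add: sums_def add_ac)
    also have "(\<lambda>n. \<Sum>k<n. 1 / (real k + 1)\<^sup>2) = Q"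
      unfolding Q_def by (rule ext, rule sum.reindex_bij_witness[of _ "\<lambda>k. k - 1" Suc]) auto
    finally show ?thesis .
  qed
  have f0: "f \<longlonglongrightarrow> 0"
  proof (rule Lim_null_comparison)
    show "eventually (\<lambda>N. norm (f N) \<le> 2 / real (M N)) sequentially"
      using eventually_ge_at_top[of 1]
    proof eventually_elim
      case (elim N)
      note m = M1[OF elim]
      have "real ((M N)\<^sup>2) \<le> N" "real N \<le> real ((Suc (M N))\<^sup>2)"
        using MM[of N] by linarith+
      then have "ln (real ((M N)\<^sup>2)) \<le> ln N" "ln (real N) \<le> ln (real ((Suc (M N))\<^sup>2))"
        using m elim by (auto simp del: of_nat_power)
      then have "2 * ln (M N) \<le> ln N" "ln N \<le> 2 * ln (Suc (M N))"
        using m by (simp_all add: ln_realpow)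
      moreover have "ln (Suc (M N)) - ln (M N) \<le> 1 / M N"
      proof -
        have "real (Suc (M N)) = real (M N) * (1 + 1 / M N)" using m by (simp add: field_simps)
        moreover have "1 + 1 / real (M N) > 0" by (simp add: add_pos_nonneg)
        ultimately have "ln (Suc (M N)) = ln (M N) + ln (1 + 1 / M N)"
          using m by (simp only: ln_mult_pos of_nat_0_less_iff)
        then show ?thesis using ln_add_one_self_le_self[of "1 / M N"] by simp
      qed
      ultimately show ?case by (simp add: f_def)
    qed
    show "(\<lambda>N. 2 / real (M N)) \<longlonglongrightarrow> 0" by (rule filterlim_compose[OF inv0 Mlim])
  qed
  have err0: "err \<longlonglongrightarrow> 0"
  proof (rule Lim_null_comparison)
    show "eventually (\<lambda>N. norm (err N) \<le> 4 / real (M N)) sequentially"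
      using eventually_ge_at_top[of 1]
      by eventually_elim (use hyperbola_ln[OF MM M1] in \<open>simp add: err_def D_def G_def \<gamma>_def\<close>)
    show "(\<lambda>N. 4 / real (M N)) \<longlonglongrightarrow> 0" by (rule filterlim_compose[OF inv0 Mlim])
  qed
  \<comment> \<open>An exact identity: each asymptotic statement is replaced by an equation with a
    named error, so that the growing terms cancel algebraically and only null sequences are left
    beside the constant.\<close>
  have eq: "(\<Sum>n\<le>N. (real (divisor_count n) - harm (n - 1) - \<gamma>) / real n) =
      Q N / 2 - \<gamma>\<^sup>2 / 2 - 2 * stieltjes 1 + 2 * (ln (M N) * e (M N)) + 2 * (f N * e (M N)) - 2 * g (M N)
      - (e (M N))\<^sup>2 - (f N)\<^sup>2 / 2 + err N - ln N * e N - 2 * \<gamma> * e N - (e N)\<^sup>2 / 2" for N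
  proof -
    have "(\<Sum>n\<le>N. (real (divisor_count n) - harm (n - 1) - \<gamma>) / real n) =
        (\<Sum>n=1..N. (real (divisor_count n) - harm (n - 1) - \<gamma>) / real n)"
      by (intro sum.mono_neutral_right) auto
    also have "\<dots> = D N - (\<Sum>n=1..N. harm (n - 1) / real n) - \<gamma> * harm N"
    proof -
      have "(\<Sum>n=1..N. \<gamma> / real n) = \<gamma> * harm N"
        by (simp add: harm_def sum_distrib_left divide_inverse)
      then show ?thesis by (simp add: D_def diff_divide_distrib sum_subtractf)
    qed
    also have "\<dots> = D N - ((harm N)\<^sup>2 - Q N) / 2 - \<gamma> * harm N"
      unfolding sum_harm_div Q_def by simp
    finally have 1: "(\<Sum>n\<le>N. (real (divisor_count n) - harm (n - 1) - \<gamma>) / real n) =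
        D N - ((harm N)\<^sup>2 - Q N) / 2 - \<gamma> * harm N" .
    have 2: "harm N = ln N + \<gamma> + e N" "harm (M N) = ln (M N) + \<gamma> + e (M N)"
      by (simp_all add: e_def)
    have 3: "G (M N) = (ln (M N))\<^sup>2 / 2 + stieltjes 1 + g (M N)" by (simp add: g_def)
    have 4: "ln N = 2 * ln (M N) + f N" by (simp add: f_def)
    have 5: "D N = 2 * (ln N + \<gamma>) * harm (M N) - 2 * G (M N) - (harm (M N))\<^sup>2 + err N"
      by (simp add: err_def)
    show ?thesis
      unfolding 1 5 2 3 4 by (simp add: power2_eq_square field_simps)
  qed
  have "(\<lambda>N. Q N / 2 - \<gamma>\<^sup>2 / 2 - 2 * stieltjes 1 + 2 * (ln (M N) * e (M N)) + 2 * (f N * e (M N)) - 2 * g (M N)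
      - (e (M N))\<^sup>2 - (f N)\<^sup>2 / 2 + err N - ln N * e N - 2 * \<gamma> * e N - (e N)\<^sup>2 / 2)
      \<longlonglongrightarrow> (pi\<^sup>2 / 6) / 2 - \<gamma>\<^sup>2 / 2 - 2 * stieltjes 1 + 2 * 0 + 2 * (0 * 0) - 2 * 0
      - 0\<^sup>2 - 0\<^sup>2 / 2 + 0 - 0 - 2 * \<gamma> * 0 - 0\<^sup>2 / 2"
    by (intro tendsto_intros Q0 f0 err0 e0 le0 filterlim_compose[OF le0 Mlim]
        filterlim_compose[OF e0 Mlim] filterlim_compose[OF g0 Mlim]) auto
  then show ?thesis
    unfolding sums_def_le using eq by (simp add: \<gamma>_def)
qed

subsection \<open>Power series near the point 1\<close>

lemma ln_one_minus_sums:
  fixes x :: real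
  assumes "0 < x" "x < 1"
  shows "(\<lambda>n. 1 / real n * x ^ n) sums (- ln (1 - x))"
  using sums_minus[OF ln_series'[of "- x"]] assms by simp

lemma Suc_power_sums:
  fixes x :: real
  assumes "0 < x" "x < 1"
  shows "(\<lambda>n. real (Suc n) * x ^ n) sums (1 / (1 - x)\<^sup>2)"
  using geometric_deriv_sums[of x] assms by simp

lemma summable_linear_power:
  fixes x :: real
  assumes "0 < x" "x < 1" "\<And>n. \<bar>B n\<bar> \<le> C * (real n + 1)"
  shows "summable (\<lambda>n. \<bar>B n\<bar> * x ^ n)"
proof (rule summable_comparison_test'[of "\<lambda>n. C * (real (Suc n) * x ^ n)" 0])
  show "summable (\<lambda>n. C * (real (Suc n) * x ^ n))"
    using Suc_power_sums[OF assms(1,2)] by (intro summable_mult) (simp add: sums_iff)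
  show "norm (\<bar>B n\<bar> * x ^ n) \<le> C * (real (Suc n) * x ^ n)" for n
    using mult_right_mono[OF assms(3)[of n], of "x ^ n"] assms by (simp add: abs_mult algebra_simps)
qed

lemma quadratic_power_sums:
  fixes x :: real
  assumes "0 < x" "x < 1"
  shows "(\<lambda>n. (real n + 1) * (real n + 2) * x ^ n) sums (2 / (1 - x) ^ 3)"
proof -
  \<comment> \<open>Any number strictly between x and 1 absorbs the polynomial factor into a
    convergent geometric series.\<close>
  define y where "y = (1 + x) / 2"
  have y: "0 < x / y" "x / y < 1" "0 < y" "y < 1" using assms by (auto simp: y_def field_simps)
  define B where "B = (\<lambda>n. (real n + 1) * (real n + 2))"
  have Bsum: "(\<Sum>k\<le>n. 2 * real (Suc k)) = B n" for n
    unfolding B_def by (induction n) (auto simp: algebra_simps)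
  have "summable (\<lambda>n. B n * x ^ n)"
  proof -
    have "eventually (\<lambda>n. norm (B n * x ^ n) \<le> y ^ n) sequentially"
    proof -
      have "eventually (\<lambda>n. (real n + 1) * (real n + 2) * (x / y) ^ n \<le> 1) sequentially"
        using y by real_asymp
      then show ?thesis
        by eventually_elim (use y assms in \<open>simp add: B_def abs_mult power_divide field_simps\<close>)
    qed
    then show ?thesis by (rule summable_comparison_test_ev) (use y in \<open>auto intro: summable_geometric\<close>)
  qed
  with sums_by_parts_power[of "\<lambda>k. 2 * real (Suc k)" x]
  have "(\<lambda>n. 2 * real (Suc n) * x ^ n) sums ((1 - x) * (\<Sum>n. B n * x ^ n))"
    unfolding Bsum by blast
  moreover have "(\<lambda>n. 2 * real (Suc n) * x ^ n) sums (2 * (1 / (1 - x)\<^sup>2))"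
    using sums_mult[OF Suc_power_sums[OF assms], of 2] by (simp only: mult.assoc)
  ultimately have "(1 - x) * (\<Sum>n. B n * x ^ n) = 2 * (1 / (1 - x)\<^sup>2)"
    by (rule sums_unique2)
  then have "(\<Sum>n. B n * x ^ n) = 2 * (1 / (1 - x)\<^sup>2) / (1 - x)"
    using assms by (simp only: nonzero_eq_divide_eq mult.commute)
  then have "(\<Sum>n. B n * x ^ n) = 2 / (1 - x) ^ 3"
    by (simp add: power2_eq_square power3_eq_cube)
  with \<open>summable (\<lambda>n. B n * x ^ n)\<close> show ?thesis by (simp add: sums_iff B_def)
qed

lemma harm_sums:
  fixes x :: real
  assumes "0 < x" "x < 1"
  shows "(\<lambda>n. harm n * x ^ n) sums (- ln (1 - x) / (1 - x))"
proof -
  have h: "(\<Sum>k\<le>n. 1 / real k) = harm n" for n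
    unfolding harm_def by (intro sum.mono_neutral_cong_right) (auto simp: inverse_eq_divide)
  have "\<bar>harm n\<bar> \<le> 1 * (real n + 1)" for n using harm_le[of n] by simp
  from summable_linear_power[OF assms this] have s: "summable (\<lambda>n. harm n * x ^ n)" by simp
  with sums_by_parts_power[of "\<lambda>k. 1 / real k" x]
  have "(\<lambda>n. 1 / real n * x ^ n) sums ((1 - x) * (\<Sum>n. harm n * x ^ n))" unfolding h by blast
  with ln_one_minus_sums[OF assms] have "(1 - x) * (\<Sum>n. harm n * x ^ n) = - ln (1 - x)"
    using sums_unique2 by blast
  then have "(\<Sum>n. harm n * x ^ n) = - ln (1 - x) / (1 - x)" using assms by (simp add: field_simps)
  with s show ?thesis by (simp add: sums_iff)
qed

text \<open>From k H_k - (k - 1) H_(k-1) = H_(k-1) + 1 the numbers n H_n are partial sums of a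
  sequence whose power series is known.\<close>

lemma mult_harm_sums:
  fixes x :: real
  assumes "0 < x" "x < 1"
  shows "(\<lambda>n. real n * harm n * x ^ n) sums (x * (1 - ln (1 - x)) / (1 - x)\<^sup>2)"
proof -
  define b :: "nat \<Rightarrow> real" where "b = (\<lambda>n. if n = 0 then 0 else harm (n - 1) + 1)"
  have h: "(\<Sum>k\<le>n. b k) = real n * harm n" for n
    by (induction n) (auto simp: b_def harm_Suc field_simps)
  have "(\<lambda>n. harm n * x ^ n + x ^ n) sums (- ln (1 - x) / (1 - x) + 1 / (1 - x))"
    using assms by (intro sums_add harm_sums geometric_sums) auto
  then have "(\<lambda>n. x * (harm n * x ^ n + x ^ n)) sums (x * (- ln (1 - x) / (1 - x) + 1 / (1 - x)))"
    by (rule sums_mult)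
  also have "(\<lambda>n. x * (harm n * x ^ n + x ^ n)) = (\<lambda>n. b (Suc n) * x ^ Suc n)"
    by (auto simp: b_def algebra_simps)
  finally have "(\<lambda>n. b n * x ^ n) sums (x * (- ln (1 - x) / (1 - x) + 1 / (1 - x)) + b 0 * x ^ 0)"
    by (rule sums_Suc)
  then have b: "(\<lambda>n. b n * x ^ n) sums (x * (- ln (1 - x) / (1 - x) + 1 / (1 - x)))"
    by (simp add: b_def)
  have s: "summable (\<lambda>n. real n * harm n * x ^ n)"
  proof (rule summable_comparison_test'[of "\<lambda>n. (real n + 1) * (real n + 2) * x ^ n" 0])
    show "summable (\<lambda>n. (real n + 1) * (real n + 2) * x ^ n)"
      using quadratic_power_sums[OF assms] by (simp add: sums_iff)
    show "norm (real n * harm n * x ^ n) \<le> (real n + 1) * (real n + 2) * x ^ n" for n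
      using assms harm_le[of n] harm_nonneg[of n, where 'a = real]
      by (auto simp: abs_mult intro!: mult_right_mono mult_mono)
  qed
  with sums_by_parts_power[of b x]
  have "(\<lambda>n. b n * x ^ n) sums ((1 - x) * (\<Sum>n. real n * harm n * x ^ n))" unfolding h by blast
  with b have "(1 - x) * (\<Sum>n. real n * harm n * x ^ n) = x * (- ln (1 - x) / (1 - x) + 1 / (1 - x))"
    using sums_unique2 by blast
  then have "(\<Sum>n. real n * harm n * x ^ n) = x * (- ln (1 - x) / (1 - x) + 1 / (1 - x)) / (1 - x)"
    using assms by (simp add: nonzero_eq_divide_eq mult.commute)
  also have "- ln (1 - x) / (1 - x) + 1 / (1 - x) = (1 - ln (1 - x)) / (1 - x)"
    by (simp add: diff_divide_distrib)
  also have "x * ((1 - ln (1 - x)) / (1 - x)) / (1 - x) = x * (1 - ln (1 - x)) / (1 - x)\<^sup>2"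
    by (simp add: power2_eq_square)
  finally show ?thesis using s by (simp add: sums_iff)
qed

text \<open>This is half the Cauchy square of the series of -ln(1 - x); partial fractions 1/(i(n-i))
  = (1/i + 1/(n-i))/n produce the harmonic numbers.\<close>

lemma harm_div_sums:
  fixes x :: real
  assumes "0 < x" "x < 1"
  shows "(\<lambda>n. harm (n - 1) / real n * x ^ n) sums ((ln (1 - x))\<^sup>2 / 2)"
proof -
  define a where "a = (\<lambda>n. 1 / real n * x ^ n)"
  have a: "a sums (- ln (1 - x))" using ln_one_minus_sums[OF assms] by (simp add: a_def)
  have na: "summable (\<lambda>n. norm (a n))" using a assms by (simp add: a_def sums_iff)
  have coef: "(\<Sum>i\<le>n. a i * a (n - i)) = 2 * (harm (n - 1) / real n * x ^ n)" for n
  proof -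
    have "(\<Sum>i\<le>n. a i * a (n - i)) = (\<Sum>i=1..n-1. a i * a (n - i))"
    proof (intro sum.mono_neutral_right ballI)
      fix i assume "i \<in> {..n} - {1..n-1}"
      then have "i = 0 \<or> n - i = 0" by auto
      then show "a i * a (n - i) = 0" by (auto simp: a_def)
    qed auto
    also have "\<dots> = (\<Sum>i=1..n-1. (inverse (real i) + inverse (real (n - i))) * (x ^ n / real n))"
    proof (intro sum.cong refl)
      fix i assume i: "i \<in> {1..n-1}"
      then have "i + (n - i) = n" by auto
      then have "x ^ i * x ^ (n - i) = x ^ n" by (metis power_add)
      moreover have "real (n - i) = real n - real i" "real n \<noteq> 0" "real i \<noteq> 0" "real n \<noteq> real i"
        using i by auto
      ultimately show "a i * a (n - i) = (inverse (real i) + inverse (real (n - i))) * (x ^ n / real n)"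
        by (simp add: a_def divide_simps)
    qed
    also have "\<dots> = (harm (n - 1) + (\<Sum>i=1..n-1. inverse (real (n - i)))) * (x ^ n / real n)"
      unfolding sum_distrib_right[symmetric] sum.distrib harm_def ..
    also have "(\<Sum>i=1..n-1. inverse (real (n - i))) = harm (n - 1)"
      unfolding harm_def by (rule sum.reindex_bij_witness[of _ "\<lambda>i. n - i" "\<lambda>i. n - i"]) auto
    finally show ?thesis by simp
  qed
  have "(\<lambda>n. \<Sum>i\<le>n. a i * a (n - i)) sums ((- ln (1 - x)) * (- ln (1 - x)))"
    using Cauchy_product_sums[OF na na] a by (simp add: sums_iff)
  then have "(\<lambda>n. 2 * (harm (n - 1) / real n * x ^ n)) sums ((ln (1 - x))\<^sup>2)"
    unfolding coef by (simp add: power2_eq_square)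
  from sums_divide[OF this, of 2] show ?thesis by simp
qed

section \<open>The logarithm of the product and its derivatives near 1\<close>

text \<open>This is the function F. The polymorphic type covers both the real interval, where the
  asymptotics live, and the complex disc of the Cauchy integral.\<close>

definition divisor_series :: "'a :: {real_normed_field, banach} \<Rightarrow> 'a" where
  "divisor_series z = (\<Sum>n. of_nat (divisor_count n) / of_nat n * z ^ n)"

lemma divisor_series_norm_summable:
  fixes z :: "'a :: {real_normed_field, banach}"
  assumes "norm z < 1"
  shows "summable (\<lambda>n. norm (of_nat (divisor_count n) / of_nat n * z ^ n))"
proof (rule summable_comparison_test'[of "\<lambda>n. norm z ^ n" 0])
  show "summable (\<lambda>n. norm z ^ n)" using assms by (intro summable_geometric) auto
  show "norm (norm (of_nat (divisor_count n) / of_nat n * z ^ n)) \<le> norm z ^ n" for n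
  proof -
    have "real (divisor_count n) / real n \<le> 1"
      using divisor_count_le[of n] by (auto simp: divide_le_eq_1)
    then have "real (divisor_count n) / real n * norm z ^ n \<le> 1 * norm z ^ n"
      by (intro mult_right_mono) auto
    then show ?thesis by (simp add: norm_mult norm_divide norm_power)
  qed
qed

lemma divisor_series_sums:
  fixes z :: "'a :: {real_normed_field, banach}"
  assumes "norm z < 1"
  shows "(\<lambda>n. of_nat (divisor_count n) / of_nat n * z ^ n) sums divisor_series z"
  unfolding divisor_series_def
  by (rule summable_sums[OF summable_norm_cancel[OF divisor_series_norm_summable[OF assms]]])

theorem divisor_series_asymp:
  "((\<lambda>x. divisor_series x - ((ln (1 - x))\<^sup>2 / 2 - euler_mascheroni * ln (1 - x))) \<longlongrightarrow>
     pi\<^sup>2 / 12 - euler_mascheroni\<^sup>2 / 2 - 2 * stieltjes 1) (at_left (1::real))"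
proof -
  define b :: "nat \<Rightarrow> real"
    where "b = (\<lambda>n. (real (divisor_count n) - harm (n - 1) - euler_mascheroni) / real n)"
  have "((\<lambda>x. \<Sum>n. b n * x ^ n) \<longlongrightarrow> pi\<^sup>2 / 12 - euler_mascheroni\<^sup>2 / 2 - 2 * stieltjes 1) (at_left 1)"
    unfolding b_def by (intro abel_limit sums_divisor_constant)
  moreover have "eventually (\<lambda>x. (\<Sum>n. b n * x ^ n) = divisor_series x -
      ((ln (1 - x))\<^sup>2 / 2 - euler_mascheroni * ln (1 - x))) (at_left (1::real))"
  proof -
    have "eventually (\<lambda>x::real. x \<in> {0<..<1}) (at_left 1)"
      by (intro eventually_at_left_real) auto
    then show ?thesis
    proof eventually_elim
      case (elim x)
      then have x: "0 < x" "x < 1" by auto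
      have "(\<lambda>n. real (divisor_count n) / real n * x ^ n - harm (n - 1) / real n * x ^ n
          - euler_mascheroni * (1 / real n * x ^ n)) sums
          (divisor_series x - (ln (1 - x))\<^sup>2 / 2 - euler_mascheroni * (- ln (1 - x)))"
        using divisor_series_sums[of x] x
        by (intro sums_diff sums_mult harm_div_sums ln_one_minus_sums) auto
      also have "(\<lambda>n. real (divisor_count n) / real n * x ^ n - harm (n - 1) / real n * x ^ n
          - euler_mascheroni * (1 / real n * x ^ n)) = (\<lambda>n. b n * x ^ n)"
        by (rule ext) (simp add: b_def diff_divide_distrib left_diff_distrib)
      finally show ?case by (simp add: sums_iff)
    qed
  qed
  ultimately show ?thesis by (rule Lim_transform_eventually)
qed

text \<open>Comparison with the series of harmonic numbers: the partial sums of the difference are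
  at most linear, and by summation by parts they contribute (1 - x) times O(1/(1 - x)^2).\<close>

lemma divisor_count_power_sum:
  fixes x :: real
  assumes "0 < x" "x < 1"
  shows "summable (\<lambda>n. real (divisor_count n) * x ^ n)"
    and "\<bar>(\<Sum>n. real (divisor_count n) * x ^ n) - (- ln (1 - x) / (1 - x))\<bar> \<le> 1 / (1 - x)"
proof -
  define \<Delta> where "\<Delta> = (\<lambda>N. \<Sum>n\<le>N. real (divisor_count n) - harm n)"
  have \<Delta>: "\<bar>\<Delta> n\<bar> \<le> 1 * (real n + 1)" for n
    using sum_divisor_count_bounds[of n] by (simp add: \<Delta>_def)
  have s: "summable (\<lambda>n. \<bar>\<Delta> n\<bar> * x ^ n)" by (rule summable_linear_power[OF assms \<Delta>])
  then have s': "summable (\<lambda>n. \<Delta> n * x ^ n)"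
    using assms by (intro summable_norm_cancel[of "\<lambda>n. \<Delta> n * x ^ n"]) (simp add: abs_mult)
  from sums_by_parts_power[of "\<lambda>n. real (divisor_count n) - harm n" x]
  have d: "(\<lambda>n. (real (divisor_count n) - harm n) * x ^ n) sums ((1 - x) * (\<Sum>n. \<Delta> n * x ^ n))"
    using s' by (simp add: \<Delta>_def)
  from sums_add[OF this harm_sums[OF assms]]
  have eq: "(\<lambda>n. real (divisor_count n) * x ^ n) sums
      ((1 - x) * (\<Sum>n. \<Delta> n * x ^ n) + (- ln (1 - x) / (1 - x)))"
    by (simp add: algebra_simps)
  then show "summable (\<lambda>n. real (divisor_count n) * x ^ n)" by (simp add: sums_iff)
  have "\<bar>\<Sum>n. \<Delta> n * x ^ n\<bar> \<le> (\<Sum>n. \<bar>\<Delta> n\<bar> * x ^ n)"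
    using summable_rabs[of "\<lambda>n. \<Delta> n * x ^ n"] s assms by (simp add: abs_mult)
  also have "\<dots> \<le> (\<Sum>n. real (Suc n) * x ^ n)"
    using Suc_power_sums[OF assms] \<Delta> assms
    by (intro suminf_le s) (auto simp: sums_iff add_ac intro!: mult_right_mono)
  also have "\<dots> = 1 / (1 - x)\<^sup>2" using Suc_power_sums[OF assms] by (simp add: sums_iff)
  finally have "(1 - x) * \<bar>\<Sum>n. \<Delta> n * x ^ n\<bar> \<le> (1 - x) * (1 / (1 - x)\<^sup>2)"
    using assms by (intro mult_left_mono) auto
  also have "\<dots> = 1 / (1 - x)" using assms by (simp add: power2_eq_square)
  finally show "\<bar>(\<Sum>n. real (divisor_count n) * x ^ n) - (- ln (1 - x) / (1 - x))\<bar> \<le> 1 / (1 - x)"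
    using eq assms by (simp add: sums_iff abs_mult)
qed

text \<open>A second summation by parts: weighting with n raises the bound on the partial sums from
  linear to quadratic, hence the error from 1/(1 - x) to 1/(1 - x)^2.\<close>

lemma mult_divisor_count_power_sum:
  fixes x :: real
  assumes "0 < x" "x < 1"
  shows "summable (\<lambda>n. real n * real (divisor_count n) * x ^ n)"
    and "\<bar>(\<Sum>n. real n * real (divisor_count n) * x ^ n) - x * (1 - ln (1 - x)) / (1 - x)\<^sup>2\<bar> \<le> 4 / (1 - x)\<^sup>2"
proof -
  define \<Delta> where "\<Delta> = (\<lambda>N. \<Sum>n\<le>N. real (divisor_count n) - harm n)"
  define \<Theta> where "\<Theta> = (\<lambda>N. \<Sum>n\<le>N. real n * (real (divisor_count n) - harm n))"
  have \<Delta>: "\<bar>\<Delta> n\<bar> \<le> real n" for n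
    using sum_divisor_count_bounds[of n] by (simp add: \<Delta>_def)
  have parts: "\<Theta> n = real n * \<Delta> n - (\<Sum>k<n. \<Delta> k)" for n
    by (induction n) (auto simp: \<Theta>_def \<Delta>_def algebra_simps)
  have \<Theta>: "\<bar>\<Theta> n\<bar> \<le> 2 * ((real n + 1) * (real n + 2))" for n
  proof -
    have "\<bar>\<Theta> n\<bar> \<le> real n * \<bar>\<Delta> n\<bar> + (\<Sum>k<n. \<bar>\<Delta> k\<bar>)"
      unfolding parts using sum_abs[of \<Delta> "{..<n}"] by (simp add: abs_mult abs_triangle_ineq4[THEN order_trans])
    also have "real n * \<bar>\<Delta> n\<bar> \<le> real n * real n" using \<Delta>[of n] by (intro mult_left_mono) auto
    also have "(\<Sum>k<n. \<bar>\<Delta> k\<bar>) \<le> (\<Sum>k<n. real n)"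
      by (intro sum_mono order_trans[OF \<Delta>]) auto
    finally have "\<bar>\<Theta> n\<bar> \<le> 2 * (real n * real n)" by simp
    also have "real n * real n \<le> (real n + 1) * (real n + 2)" by (intro mult_mono) auto
    finally show ?thesis by simp
  qed
  note q = quadratic_power_sums[OF assms]
  have cancel: "u * (2 * (2 / u ^ 3)) = 4 / u\<^sup>2" if "u \<noteq> 0" for u :: real
    using that by (simp add: power2_eq_square power3_eq_cube)
  have s: "summable (\<lambda>n. \<bar>\<Theta> n\<bar> * x ^ n)"
  proof (rule summable_comparison_test'[of "\<lambda>n. 2 * ((real n + 1) * (real n + 2) * x ^ n)" 0])
    show "summable (\<lambda>n. 2 * ((real n + 1) * (real n + 2) * x ^ n))"
      using q by (intro summable_mult) (simp add: sums_iff)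
    show "norm (\<bar>\<Theta> n\<bar> * x ^ n) \<le> 2 * ((real n + 1) * (real n + 2) * x ^ n)" for n
      using mult_right_mono[OF \<Theta>[of n], of "x ^ n"] assms by (simp add: abs_mult mult_ac)
  qed
  then have s': "summable (\<lambda>n. \<Theta> n * x ^ n)"
    using assms by (intro summable_norm_cancel[of "\<lambda>n. \<Theta> n * x ^ n"]) (simp add: abs_mult)
  from sums_by_parts_power[of "\<lambda>n. real n * (real (divisor_count n) - harm n)" x]
  have d: "(\<lambda>n. real n * (real (divisor_count n) - harm n) * x ^ n) sums ((1 - x) * (\<Sum>n. \<Theta> n * x ^ n))"
    using s' by (simp add: \<Theta>_def)
  from sums_add[OF this mult_harm_sums[OF assms]]
  have eq: "(\<lambda>n. real n * real (divisor_count n) * x ^ n) sums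
      ((1 - x) * (\<Sum>n. \<Theta> n * x ^ n) + x * (1 - ln (1 - x)) / (1 - x)\<^sup>2)"
    by (simp add: algebra_simps)
  then show "summable (\<lambda>n. real n * real (divisor_count n) * x ^ n)" by (simp add: sums_iff)
  have "\<bar>\<Sum>n. \<Theta> n * x ^ n\<bar> \<le> (\<Sum>n. \<bar>\<Theta> n\<bar> * x ^ n)"
    using summable_rabs[of "\<lambda>n. \<Theta> n * x ^ n"] s assms by (simp add: abs_mult)
  also have "\<dots> \<le> (\<Sum>n. 2 * ((real n + 1) * (real n + 2) * x ^ n))"
  proof (intro suminf_le s)
    show "summable (\<lambda>n. 2 * ((real n + 1) * (real n + 2) * x ^ n))"
      using q by (intro summable_mult) (simp add: sums_iff)
    show "\<bar>\<Theta> n\<bar> * x ^ n \<le> 2 * ((real n + 1) * (real n + 2) * x ^ n)" for n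
      using mult_right_mono[OF \<Theta>[of n], of "x ^ n"] assms by (simp add: mult_ac)
  qed
  also have "\<dots> = 2 * (2 / (1 - x) ^ 3)" using sums_mult[OF q, of 2] by (simp add: sums_iff)
  finally have "(1 - x) * \<bar>\<Sum>n. \<Theta> n * x ^ n\<bar> \<le> (1 - x) * (2 * (2 / (1 - x) ^ 3))"
    using assms by (intro mult_left_mono) auto
  also have "\<dots> = 4 / (1 - x)\<^sup>2" by (rule cancel) (use assms in simp)
  finally show "\<bar>(\<Sum>n. real n * real (divisor_count n) * x ^ n) - x * (1 - ln (1 - x)) / (1 - x)\<^sup>2\<bar> \<le> 4 / (1 - x)\<^sup>2"
    using eq assms by (simp add: sums_iff abs_mult)
qed

text \<open>Half of the geometric decay of x = y^2 is spent on one factor n, by n y^n \<le> 1/(1 -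
  y). Such an upper bound is enough for the cubic remainder.\<close>

lemma square_divisor_count_power_sum:
  fixes y :: real
  assumes "0 < y" "y < 1"
  shows "summable (\<lambda>n. (real n)\<^sup>2 * real (divisor_count n) * (y\<^sup>2) ^ n)"
    and "(\<Sum>n. (real n)\<^sup>2 * real (divisor_count n) * (y\<^sup>2) ^ n) \<le>
      (\<Sum>n. real n * real (divisor_count n) * y ^ n) / (1 - y)"
proof -
  have ny: "real n * y ^ n \<le> 1 / (1 - y)" for n
  proof -
    have "real n * y ^ n = (\<Sum>k<n. y ^ n)" by simp
    also have "\<dots> \<le> (\<Sum>k<n. y ^ k)" using assms by (intro sum_mono power_decreasing) auto
    also have "\<dots> \<le> (\<Sum>k. y ^ k)" using assms by (intro sum_le_suminf summable_geometric) auto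
    also have "\<dots> = 1 / (1 - y)" using assms by (intro suminf_geometric) auto
    finally show ?thesis .
  qed
  have le: "(real n)\<^sup>2 * real (divisor_count n) * (y\<^sup>2) ^ n \<le> real n * real (divisor_count n) * y ^ n / (1 - y)" for n
  proof -
    have "(real n)\<^sup>2 * real (divisor_count n) * (y\<^sup>2) ^ n =
        (real n * real (divisor_count n) * y ^ n) * (real n * y ^ n)"
      by (simp add: power2_eq_square power_mult_distrib)
    also have "\<dots> \<le> (real n * real (divisor_count n) * y ^ n) * (1 / (1 - y))"
      using assms by (intro mult_left_mono ny) auto
    finally show ?thesis by simp
  qed
  have s: "summable (\<lambda>n. real n * real (divisor_count n) * y ^ n / (1 - y))"
    using mult_divisor_count_power_sum(1)[OF assms] by (rule summable_divide)
  show s2: "summable (\<lambda>n. (real n)\<^sup>2 * real (divisor_count n) * (y\<^sup>2) ^ n)"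
    by (rule summable_comparison_test'[OF s, of 0]) (use le in simp)
  show "(\<Sum>n. (real n)\<^sup>2 * real (divisor_count n) * (y\<^sup>2) ^ n) \<le>
      (\<Sum>n. real n * real (divisor_count n) * y ^ n) / (1 - y)"
    using suminf_le[OF le s2 s] unfolding suminf_divide[OF mult_divisor_count_power_sum(1)[OF assms]] .
qed

subsection \<open>The Cauchy integral and bounds for its integrand\<close>

definition divisor_fps :: "complex fps" where
  "divisor_fps = Abs_fps (\<lambda>n. of_nat (divisor_count n) / of_nat n)"

lemma eval_divisor_fps: "eval_fps divisor_fps = divisor_series"
  by (simp add: eval_fps_def divisor_fps_def divisor_series_def fun_eq_iff)

lemma divisor_fps_conv_radius: "fps_conv_radius divisor_fps \<ge> 1"
  unfolding fps_conv_radius_def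
proof (rule conv_radius_geI_ex)
  fix r :: real assume r: "0 < r" "ereal r < 1"
  then have "norm (of_real r :: complex) < 1" by simp
  from divisor_series_sums[OF this] r
  show "\<exists>z. norm z = r \<and> summable (\<lambda>n. fps_nth divisor_fps n * z ^ n)"
    by (intro exI[of _ "of_real r"]) (auto simp: divisor_fps_def sums_iff)
qed

lemma divisor_series_holomorphic: "divisor_series holomorphic_on ball 0 (1::real)"
proof -
  have "ball (0::complex) 1 \<subseteq> eball 0 (fps_conv_radius divisor_fps)"
  proof
    fix z :: complex assume "z \<in> ball 0 1"
    then have "ereal (dist 0 z) < 1" by simp
    from less_le_trans[OF this divisor_fps_conv_radius]
    show "z \<in> eball 0 (fps_conv_radius divisor_fps)" by (simp add: in_eball_iff)
  qed
  then show ?thesis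
    using holomorphic_on_eval_fps[of _ divisor_fps] by (simp add: eval_divisor_fps)
qed

definition P_coeff :: "nat \<Rightarrow> real" where
  "P_coeff n = real_of_rat (fps_nth P_series n)"

lemma P_coeff_recurrence:
  "real (Suc n) * P_coeff (Suc n) = (\<Sum>k\<le>n. real (divisor_count (Suc k)) * P_coeff (n - k))"
  using arg_cong[OF P_series_nth_recurrence[of n], of real_of_rat]
  by (simp add: P_coeff_def of_rat_mult of_rat_sum of_rat_add)

text \<open>From A' = F' A the coefficients of exp F satisfy the same recurrence as those of the
  formal product, with the same constant term. This links the \<open>X\<close>-adic product to an
  analytic function.\<close>

lemma exp_divisor_series_has_fps_expansion:
  "(\<lambda>z. exp (divisor_series z)) has_fps_expansion Abs_fps (\<lambda>n. complex_of_real (P_coeff n))"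
proof -
  define A where "A = fps_exp (1::complex) oo divisor_fps"
  have "fps_conv_radius divisor_fps > 0"
    using divisor_fps_conv_radius by (rule less_le_trans[rotated]) simp
  then have "divisor_series has_fps_expansion divisor_fps"
    using eval_fps_has_fps_expansion[of divisor_fps] by (simp add: eval_divisor_fps)
  from has_fps_expansion_compose[OF has_fps_expansion_exp1 this]
  have A: "(\<lambda>z. exp (divisor_series z)) has_fps_expansion A"
    by (simp add: A_def o_def divisor_fps_def)
  have der: "fps_deriv A = fps_deriv divisor_fps * A"
    unfolding A_def by (subst fps_compose_deriv) (simp_all add: divisor_fps_def mult.commute)
  have A0: "fps_nth A 0 = 1" by (simp add: A_def)
  have rec: "of_nat (Suc n) * fps_nth A (Suc n) =
      (\<Sum>k\<le>n. of_nat (divisor_count (Suc k)) * fps_nth A (n - k))" for n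
  proof -
    have "of_nat (Suc n) * fps_nth A (Suc n) = fps_nth (fps_deriv A) n" by simp
    also have "\<dots> = (\<Sum>k\<le>n. fps_nth (fps_deriv divisor_fps) k * fps_nth A (n - k))"
      unfolding der by (simp add: fps_mult_nth atLeast0AtMost)
    also have "\<dots> = (\<Sum>k\<le>n. of_nat (divisor_count (Suc k)) * fps_nth A (n - k))"
      by (intro sum.cong refl) (simp add: divisor_fps_def del: of_nat_Suc)
    finally show ?thesis .
  qed
  have "fps_nth A n = of_real (P_coeff n)" for n
  proof (induction n rule: less_induct)
    case (less n)
    show ?case
    proof (cases n)
      case 0
      then show ?thesis by (simp add: A0 P_coeff_def P_series_nth_0)
    next
      case (Suc m)
      have "of_nat (Suc m) * fps_nth A (Suc m) =
          (\<Sum>k\<le>m. of_nat (divisor_count (Suc k)) * of_real (P_coeff (m - k)))"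
        unfolding rec using less.IH Suc by (intro sum.cong) auto
      also have "\<dots> = of_real (\<Sum>k\<le>m. real (divisor_count (Suc k)) * P_coeff (m - k))" by simp
      also have "\<dots> = of_nat (Suc m) * of_real (P_coeff (Suc m))"
        unfolding P_coeff_recurrence[symmetric] by (simp del: of_nat_Suc)
      finally show ?thesis unfolding Suc by (simp del: of_nat_Suc)
    qed
  qed
  then have "A = Abs_fps (\<lambda>n. complex_of_real (P_coeff n))" by (intro fps_ext) simp
  with A show ?thesis by simp
qed

lemma P_coeff_integral:
  assumes r: "0 < r" "r < 1" and \<delta>: "\<delta> > 0"
  shows "((\<lambda>v. exp (divisor_series (of_real r * cis (\<delta> * v))) * cis (- (real n * (\<delta> * v)))) has_integral
    of_real (2 * pi * P_coeff n * r ^ n / \<delta>)) {- pi / \<delta>..pi / \<delta>}"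
proof -
  define f where "f = (\<lambda>z::complex. exp (divisor_series z))"
  \<comment> \<open>The circle path runs over angles from 0 to 2 pi, whereas the saddle should lie
    in the middle of the interval. Shifting the angle by pi negates the argument; starting from
    f(-z) compensates for that, and the signs (-1)^n cancel.\<close>
  define h where "h = (\<lambda>z. f (- z))"
  have "(\<lambda>z. (-1) * z :: complex) has_fps_expansion fps_const (-1) * fps_X"
    by (intro fps_expansion_intros)
  then have "(\<lambda>z. - z :: complex) has_fps_expansion fps_const (-1) * fps_X" by simp
  from has_fps_expansion_compose[OF exp_divisor_series_has_fps_expansion this]
  have "h has_fps_expansion fps_compose (Abs_fps (\<lambda>n. complex_of_real (P_coeff n))) (fps_const (-1) * fps_X)"
    by (simp add: h_def f_def o_def)
  from fps_nth_fps_expansion[OF this, of n]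
  have derh: "(deriv ^^ n) h 0 = fact n * ((-1) ^ n * of_real (P_coeff n))"
    unfolding fps_compose_linear by (simp add: field_simps)
  have holh: "h holomorphic_on ball 0 1"
  proof -
    have "(divisor_series \<circ> uminus) holomorphic_on ball (0::complex) 1"
      by (intro holomorphic_on_compose_gen[OF _ divisor_series_holomorphic] holomorphic_intros) auto
    then show ?thesis unfolding h_def f_def o_def by (intro holomorphic_intros)
  qed
  have "((\<lambda>u. h u / (u - 0) ^ Suc n) has_contour_integral
      (2 * pi * \<i>) / fact n * (deriv ^^ n) h 0) (circlepath 0 r)"
    using r holh
    by (intro Cauchy_has_contour_integral_higher_derivative_circlepath)
       (auto intro!: holomorphic_on_imp_continuous_on elim: holomorphic_on_subset)
  then have "((\<lambda>t. h (0 + of_real r * cis t) / (0 + of_real r * cis t - 0) ^ Suc n * of_real r * \<i> * cis t)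
      has_integral (2 * pi * \<i>) / fact n * (deriv ^^ n) h 0) {0..2 * pi}"
    unfolding circlepath_def by (subst (asm) has_contour_integral_part_circlepath_iff) auto
  from has_integral_mult_right[OF this, of "- \<i> * of_real r ^ n"]
  have "((\<lambda>t. - \<i> * of_real r ^ n * (h (0 + of_real r * cis t) / (0 + of_real r * cis t - 0) ^ Suc n * of_real r * \<i> * cis t))
      has_integral of_real (2 * pi * (-1) ^ n * P_coeff n * r ^ n)) {0..2 * pi}"
    unfolding derh by (simp add: mult_ac)
  also have "(\<lambda>t. - \<i> * of_real r ^ n * (h (0 + of_real r * cis t) / (0 + of_real r * cis t - 0) ^ Suc n * of_real r * \<i> * cis t)) =
      (\<lambda>t. h (of_real r * cis t) * cis (- (real n * t)))"
  proof
    fix t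
    have "cis (- (real n * t)) = 1 / cis t ^ n"
      by (simp add: Complex.DeMoivre cis_inverse[symmetric] inverse_eq_divide)
    then show "- \<i> * of_real r ^ n * (h (0 + of_real r * cis t) / (0 + of_real r * cis t - 0) ^ Suc n * of_real r * \<i> * cis t) =
        h (of_real r * cis t) * cis (- (real n * t))"
      using r by (simp add: power_mult_distrib field_simps)
  qed
  finally have "((\<lambda>t. h (of_real r * cis t) * cis (- (real n * t))) has_integral
      of_real (2 * pi * (-1) ^ n * P_coeff n * r ^ n)) (cbox 0 (2 * pi))" by simp
  from has_integral_affinity'[OF this \<delta>, of pi]
  have "((\<lambda>v. h (of_real r * cis (\<delta> * v + pi)) * cis (- (real n * (\<delta> * v + pi)))) has_integral
      of_real (2 * pi * (-1) ^ n * P_coeff n * r ^ n / \<delta>)) {- pi / \<delta>..pi / \<delta>}"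
    by (simp add: divide_inverse scaleR_conv_of_real mult_ac)
  from has_integral_mult_right[OF this, of "(-1) ^ n"]
  have "((\<lambda>v. (-1) ^ n * (h (of_real r * cis (\<delta> * v + pi)) * cis (- (real n * (\<delta> * v + pi))))) has_integral
      of_real (2 * pi * P_coeff n * r ^ n / \<delta>)) {- pi / \<delta>..pi / \<delta>}"
  proof -
    have "(-1) ^ n * (-1) ^ n = (1 :: complex)" by (simp flip: power_mult_distrib)
    then have "(-1) ^ n * of_real (2 * pi * (-1) ^ n * P_coeff n * r ^ n / \<delta>) =
        complex_of_real (2 * pi * P_coeff n * r ^ n / \<delta>)"
      by (simp add: divide_inverse)
    then show ?thesis using \<open>((\<lambda>v. (-1) ^ n * _ v) has_integral _) _\<close> by (simp only:)
  qed
  also have "(\<lambda>v. (-1) ^ n * (h (of_real r * cis (\<delta> * v + pi)) * cis (- (real n * (\<delta> * v + pi))))) =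
      (\<lambda>v. f (of_real r * cis (\<delta> * v)) * cis (- (real n * (\<delta> * v))))"
  proof
    fix v
    have "cis (\<delta> * v + pi) = - cis (\<delta> * v)" by (simp add: cis_mult[symmetric])
    moreover have "cis (- (real n * (\<delta> * v + pi))) = (-1) ^ n * cis (- (real n * (\<delta> * v)))"
    proof -
      have "cis (- (real n * pi)) = cis (- pi) ^ n" by (simp add: Complex.DeMoivre)
      also have "cis (- pi) = -1" by (simp add: complex_eq_iff)
      finally have "cis (- (real n * pi)) = (-1) ^ n" .
      moreover have "- (real n * (\<delta> * v + pi)) = - (real n * pi) + - (real n * (\<delta> * v))"
        by (simp add: algebra_simps)
      ultimately show ?thesis by (metis cis_mult)
    qed
    moreover have "((-1) ^ n * (-1) ^ n :: complex) = 1" by (simp flip: power_mult_distrib)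
    ultimately show "(-1) ^ n * (h (of_real r * cis (\<delta> * v + pi)) * cis (- (real n * (\<delta> * v + pi)))) =
        f (of_real r * cis (\<delta> * v)) * cis (- (real n * (\<delta> * v)))"
      by (simp add: h_def)
  qed
  finally show ?thesis by (simp add: f_def)
qed

section \<open>Lower bounds for the decay along the circle\<close>

text \<open>The sum is ln(|1 - z|/(1 - \<rho>)) for z = \<rho> \<open>cis\<close> \<phi>, by the
  real part of the logarithm series, and |1 - z|^2 = (1 - \<rho>)^2 + 4 \<rho>
  sin^2(\<phi>/2).\<close>

lemma ln_one_minus_gap_sums:
  fixes \<rho> \<phi> :: real
  assumes "0 < \<rho>" "\<rho> < 1"
  shows "(\<lambda>k. \<rho> ^ k / real k * (1 - cos (real k * \<phi>))) sums
    (ln (1 + 4 * \<rho> * (sin (\<phi> / 2))\<^sup>2 / (1 - \<rho>)\<^sup>2) / 2)"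
proof -
  define z where "z = complex_of_real \<rho> * cis \<phi>"
  have nz: "norm z < 1" using assms by (simp add: z_def norm_mult)
  have "1 - z \<noteq> 0" using nz by auto
  have "(\<lambda>k. Re (- ((- (- z)) ^ k) / of_nat k)) sums Re (ln (1 + (- z)))"
    using nz by (intro sums_Re Ln_series') simp
  moreover have "Re (ln (1 + (- z))) = ln (norm (1 - z))"
    using Re_Ln[OF \<open>1 - z \<noteq> 0\<close>] by simp
  moreover have "Re (- ((- (- z)) ^ k) / of_nat k) = - (\<rho> ^ k / real k * cos (real k * \<phi>))" for k
    by (simp add: z_def power_mult_distrib Complex.DeMoivre flip: of_real_power)
  ultimately have "(\<lambda>k. - (\<rho> ^ k / real k * cos (real k * \<phi>))) sums ln (norm (1 - z))"
    by (simp only:)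
  from sums_add[OF ln_one_minus_sums[OF assms] this]
  have "(\<lambda>k. \<rho> ^ k / real k * (1 - cos (real k * \<phi>))) sums (- ln (1 - \<rho>) + ln (norm (1 - z)))"
    by (simp add: algebra_simps)
  moreover have "- ln (1 - \<rho>) + ln (norm (1 - z)) = ln (1 + 4 * \<rho> * (sin (\<phi> / 2))\<^sup>2 / (1 - \<rho>)\<^sup>2) / 2"
  proof -
    have c: "cos \<phi> = 1 - 2 * (sin (\<phi> / 2))\<^sup>2" using cos_double_sin[of "\<phi> / 2"] by simp
    have "(norm (1 - z))\<^sup>2 = (1 - \<rho> * cos \<phi>)\<^sup>2 + (\<rho> * sin \<phi>)\<^sup>2"
      by (simp add: cmod_power2 z_def)
    also have "\<dots> = 1 - 2 * \<rho> * cos \<phi> + \<rho>\<^sup>2 * ((sin \<phi>)\<^sup>2 + (cos \<phi>)\<^sup>2)"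
      by algebra
    also have "\<dots> = (1 - \<rho>)\<^sup>2 + 4 * \<rho> * (sin (\<phi> / 2))\<^sup>2"
      unfolding sin_cos_squared_add unfolding c by (simp add: power2_eq_square algebra_simps)
    also have "\<dots> = (1 - \<rho>)\<^sup>2 * (1 + 4 * \<rho> * (sin (\<phi> / 2))\<^sup>2 / (1 - \<rho>)\<^sup>2)"
      using assms by (simp add: distrib_left)
    finally have "ln ((norm (1 - z))\<^sup>2) = ln ((1 - \<rho>)\<^sup>2 * (1 + 4 * \<rho> * (sin (\<phi> / 2))\<^sup>2 / (1 - \<rho>)\<^sup>2))"
      by simp
    also have "\<dots> = ln ((1 - \<rho>)\<^sup>2) + ln (1 + 4 * \<rho> * (sin (\<phi> / 2))\<^sup>2 / (1 - \<rho>)\<^sup>2)"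
      using assms by (intro ln_mult_pos) (auto intro!: add_pos_nonneg divide_nonneg_pos mult_nonneg_nonneg)
    finally show ?thesis
      using assms \<open>1 - z \<noteq> 0\<close> by (simp add: ln_realpow)
  qed
  ultimately show ?thesis by (simp only:)
qed

text \<open>With r = exp(-t), this is 2 ln(|1 - r^d \<open>cis\<close>(d \<theta>)|/(1 -
  r^d)).\<close>

definition gap_term :: "real \<Rightarrow> real \<Rightarrow> nat \<Rightarrow> real" where
  "gap_term t \<theta> d = ln (1 + 4 * exp (- (real d * t)) * (sin (real d * \<theta> / 2))\<^sup>2 / (1 - exp (- (real d * t)))\<^sup>2)"

lemma gap_term_nonneg: "gap_term t \<theta> d \<ge> 0"
  unfolding gap_term_def by (intro ln_ge_zero) simp

text \<open>The n-th term of the gap is \<tau>(n) times a nonnegative number. Keeping only divisors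
  d \<le> D lowers it, and summing over the multiples n = d k gives the logarithms. The cut-off
  \<open>D\<close> is free and is later chosen depending on \<theta>.\<close>

lemma divisor_series_gap:
  assumes "t > 0"
  shows "Re (divisor_series (of_real (exp (- t)) * cis \<theta>)) \<le>
    divisor_series (exp (- t)) - (\<Sum>d=1..D. gap_term t \<theta> d / (2 * real d))"
proof -
  define r where "r = exp (- t)"
  have r: "0 < r" "r < 1" using assms by (auto simp: r_def)
  define z where "z = complex_of_real r * cis \<theta>"
  have nz: "norm z < 1" using r by (simp add: z_def norm_mult)
  have rd: "r ^ d = exp (- (real d * t))" for d
    by (simp add: r_def flip: exp_of_nat_mult)
  define b where "b = (\<lambda>n. r ^ n / real n * (1 - cos (real n * \<theta>)))"
  have b0: "b n \<ge> 0" for n unfolding b_def using r by simp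
  have re: "Re (of_nat (divisor_count n) / of_nat n * z ^ n) =
      real (divisor_count n) / real n * r ^ n * cos (real n * \<theta>)" for n
    by (simp add: z_def power_mult_distrib Complex.DeMoivre flip: of_real_power)
  have "(\<lambda>n. real (divisor_count n) / real n * r ^ n -
      Re (of_nat (divisor_count n) / of_nat n * z ^ n)) sums (divisor_series r - Re (divisor_series z))"
    using divisor_series_sums[of r] divisor_series_sums[OF nz] r by (intro sums_diff sums_Re) auto
  also have "(\<lambda>n. real (divisor_count n) / real n * r ^ n -
      Re (of_nat (divisor_count n) / of_nat n * z ^ n)) = (\<lambda>n. real (divisor_count n) * b n)"
    unfolding re b_def by (auto simp: algebra_simps)
  finally have full: "(\<lambda>n. real (divisor_count n) * b n) sums (divisor_series r - Re (divisor_series z))" .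
  have part: "(\<lambda>n. if d dvd n then b n else 0) sums (gap_term t \<theta> d / (2 * real d))" if d: "d \<in> {1..D}" for d
  proof -
    have rho: "0 < r ^ d" "r ^ d < 1" using r d by (auto simp: power_less_one_iff)
    from sums_divide[OF ln_one_minus_gap_sums[OF rho, of "real d * \<theta>"], of "real d"]
    have "(\<lambda>k. (r ^ d) ^ k / real k * (1 - cos (real k * (real d * \<theta>))) / real d) sums (gap_term t \<theta> d / (2 * real d))"
      unfolding gap_term_def rd by simp
    also have "(\<lambda>k. (r ^ d) ^ k / real k * (1 - cos (real k * (real d * \<theta>))) / real d) =
        (\<lambda>k. (\<lambda>n. if d dvd n then b n else 0) (d * k))"
      by (auto simp: b_def power_mult[symmetric] mult_ac)
    finally show ?thesis
      by (subst (asm) sums_mono_reindex) (use d in \<open>auto simp: strict_mono_def\<close>)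
  qed
  have "(\<lambda>n. \<Sum>d=1..D. if d dvd n then b n else 0) sums (\<Sum>d=1..D. gap_term t \<theta> d / (2 * real d))"
    by (intro sums_sum part)
  moreover have "(\<Sum>d=1..D. if d dvd n then b n else 0) \<le> real (divisor_count n) * b n" for n
  proof (cases "n = 0")
    case True
    then show ?thesis by (auto simp: b_def intro!: sum_nonpos)
  next
    case False
    have "(\<Sum>d=1..D. if d dvd n then b n else 0) = real (card {d \<in> {1..D}. d dvd n}) * b n"
      by (simp add: sum.If_cases Int_def)
    also have "\<dots> \<le> real (divisor_count n) * b n"
      unfolding divisor_count_def using False b0
      by (intro mult_right_mono of_nat_mono card_mono finite_divisors) auto
    finally show ?thesis .
  qed
  ultimately have "(\<Sum>d=1..D. gap_term t \<theta> d / (2 * real d)) \<le> divisor_series r - Re (divisor_series z)"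
    using full by (metis (no_types, lifting) sums_le)
  then show ?thesis by (simp add: z_def r_def)
qed

lemma one_minus_exp_neg_le: "1 - exp (- x) \<le> (x::real)"
  using exp_ge_add_one_self[of "- x"] by simp

text \<open>In this range exp(-d t) \<ge> 1/3, |sin(d \<theta>/2)| \<ge> d|\<theta>|/4 and 1 -
  exp(-d t) \<le> d t. The factors d cancel, so the bound is the same for all such d, with constant
  4 * (1/3)/16 = 1/12.\<close>

lemma gap_term_near:
  assumes "d \<ge> 1" "0 < t" "real d * t \<le> 1" "real d * \<bar>\<theta>\<bar> \<le> 1"
  shows "gap_term t \<theta> d \<ge> ln (1 + (\<theta> / t)\<^sup>2 / 12)"
proof -
  define \<rho> where "\<rho> = exp (- (real d * t))"
  have \<rho>: "\<rho> < 1" "1 / 3 \<le> \<rho>"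
  proof -
    show "\<rho> < 1" using assms by (simp add: \<rho>_def)
    have "1 / 3 \<le> exp (-1 :: real)" using exp_le by (simp add: exp_minus field_simps)
    also have "\<dots> \<le> \<rho>" using assms by (simp add: \<rho>_def)
    finally show "1 / 3 \<le> \<rho>" .
  qed
  have "\<bar>real d * \<theta> / 2\<bar> / 2 \<le> \<bar>sin (real d * \<theta> / 2)\<bar>"
  proof -
    define y where "y = real d * \<bar>\<theta>\<bar> / 2"
    have y: "0 \<le> y" "y \<le> 1 / 2" using assms by (auto simp: y_def)
    have "\<bar>sin y - y\<bar> \<le> \<bar>y\<bar> ^ 3 / 6"
      using Maclaurin_sin_bound[of y 3] by (simp add: eval_nat_numeral sin_coeff_def)
    moreover have "y ^ 3 \<le> y"
      using y power_decreasing[of 1 3 y] by simp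
    ultimately have "y / 2 \<le> sin y" using y abs_ge_minus_self[of "sin y - y"] by simp
    moreover have "\<bar>sin (real d * \<theta> / 2)\<bar> = \<bar>sin y\<bar>"
      unfolding y_def by (cases "\<theta> \<ge> 0") auto
    ultimately show ?thesis using y by (simp add: y_def abs_mult)
  qed
  then have "(\<bar>real d * \<theta> / 2\<bar> / 2)\<^sup>2 \<le> \<bar>sin (real d * \<theta> / 2)\<bar>\<^sup>2" by (intro power_mono) auto
  then have s: "(real d * \<theta>)\<^sup>2 / 16 \<le> (sin (real d * \<theta> / 2))\<^sup>2" by (simp add: power_divide)
  have "(1 - \<rho>)\<^sup>2 \<le> (real d * t)\<^sup>2"
    using one_minus_exp_neg_le[of "real d * t"] \<rho> by (intro power_mono) (auto simp: \<rho>_def)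
  moreover have "(1 - \<rho>)\<^sup>2 > 0" using \<rho> by simp
  ultimately have "4 * (1 / 3) * ((real d * \<theta>)\<^sup>2 / 16) / (real d * t)\<^sup>2 \<le> 4 * \<rho> * (sin (real d * \<theta> / 2))\<^sup>2 / (1 - \<rho>)\<^sup>2"
    using s \<rho> by (intro frac_le mult_mono) auto
  also have "4 * (1 / 3) * ((real d * \<theta>)\<^sup>2 / 16) / (real d * t)\<^sup>2 = (\<theta> / t)\<^sup>2 / 12"
    using assms by (simp add: power_mult_distrib power_divide)
  finally have "1 + (\<theta> / t)\<^sup>2 / 12 \<le> 1 + 4 * \<rho> * (sin (real d * \<theta> / 2))\<^sup>2 / (1 - \<rho>)\<^sup>2" by simp
  then show ?thesis
    unfolding gap_term_def \<rho>_def[symmetric] by (intro ln_mono) (auto intro: add_pos_nonneg)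
qed

text \<open>With the sine bounded away from 0, the quotient is of order 1/t^2. The constant is 4 *
  (1/3) * \<epsilon>/9, where the 9 comes from 1 - exp(-d t) \<le> 3 t.\<close>

lemma gap_term_far:
  assumes "d \<ge> 1" "d \<le> 3" "0 < t" "t \<le> 1 / 3" "\<epsilon> > 0" "(sin (real d * \<theta> / 2))\<^sup>2 \<ge> \<epsilon>"
  shows "gap_term t \<theta> d \<ge> - 2 * ln t + ln (4 * \<epsilon> / 27)"
proof -
  define \<rho> where "\<rho> = exp (- (real d * t))"
  have "real d * t \<le> 3 * (1 / 3)" using assms by (intro mult_mono) auto
  then have dt: "real d * t \<le> 1" by simp
  have \<rho>: "\<rho> < 1" "1 / 3 \<le> \<rho>"
  proof -
    show "\<rho> < 1" using assms by (simp add: \<rho>_def)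
    have "1 / 3 \<le> exp (-1 :: real)" using exp_le by (simp add: exp_minus field_simps)
    also have "\<dots> \<le> \<rho>" using dt by (simp add: \<rho>_def)
    finally show "1 / 3 \<le> \<rho>" .
  qed
  have "1 - \<rho> \<le> 3 * t"
  proof -
    have "real d * t \<le> 3 * t" using assms by (intro mult_right_mono) auto
    then show ?thesis using one_minus_exp_neg_le[of "real d * t"] unfolding \<rho>_def by linarith
  qed
  then have "(1 - \<rho>)\<^sup>2 \<le> (3 * t)\<^sup>2" using \<rho> by (intro power_mono) auto
  moreover have "(1 - \<rho>)\<^sup>2 > 0" using \<rho> by simp
  ultimately have "4 * (1 / 3) * \<epsilon> / (3 * t)\<^sup>2 \<le> 4 * \<rho> * (sin (real d * \<theta> / 2))\<^sup>2 / (1 - \<rho>)\<^sup>2"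
    using assms \<rho> by (intro frac_le mult_mono) auto
  then have le: "(4 * \<epsilon> / 27) / t\<^sup>2 \<le> 1 + 4 * \<rho> * (sin (real d * \<theta> / 2))\<^sup>2 / (1 - \<rho>)\<^sup>2"
    by (simp add: power_mult_distrib)
  have "- 2 * ln t + ln (4 * \<epsilon> / 27) = ln ((4 * \<epsilon> / 27) / t\<^sup>2)"
    using assms by (subst ln_divide_pos) (auto simp: ln_realpow)
  also have "\<dots> \<le> gap_term t \<theta> d"
    unfolding gap_term_def \<rho>_def[symmetric] using le assms by (intro ln_mono) auto
  finally show ?thesis .
qed

text \<open>All d up to 1/sqrt t satisfy the conditions of the near estimate. Their weights 1/d sum
  to at least ln(1/sqrt t), and the factor 1/2 makes this -ln t/4.\<close>

lemma sum_gap_central: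
  assumes "0 < t" "t \<le> 1" "\<bar>\<theta>\<bar> \<le> sqrt t"
  obtains D where "(\<Sum>d=1..D. gap_term t \<theta> d / (2 * real d)) \<ge> (- ln t / 4) * ln (1 + (\<theta> / t)\<^sup>2 / 12)"
proof -
  define D where "D = nat \<lfloor>1 / sqrt t\<rfloor>"
  have sq: "sqrt t > 0" "sqrt t \<le> 1" using assms by auto
  have D1: "real D \<le> 1 / sqrt t" "1 / sqrt t \<le> real D + 1" using sq unfolding D_def by (auto simp: le_nat_floor intro: order_less_imp_le)
  define l where "l = ln (1 + (\<theta> / t)\<^sup>2 / 12)"
  have l: "l \<ge> 0" by (simp add: l_def)
  have "ln (1 / sqrt t) \<le> ln (real D + 1)" using D1 sq by (intro ln_mono) auto
  also have "\<dots> \<le> harm D" by (rule ln_le_harm)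
  finally have h: "- ln t / 2 \<le> harm D" using assms by (simp add: ln_div ln_sqrt)
  have "(- ln t / 4) * l \<le> harm D / 2 * l" using h l by (intro mult_right_mono) auto
  also have "\<dots> = (\<Sum>d=1..D. l / (2 * real d))"
    unfolding harm_def sum_divide_distrib sum_distrib_right by (intro sum.cong) (auto simp: field_simps)
  also have "\<dots> \<le> (\<Sum>d=1..D. gap_term t \<theta> d / (2 * real d))"
  proof (intro sum_mono divide_right_mono)
    fix d assume d: "d \<in> {1..D}"
    have "real d * sqrt t \<le> 1 / sqrt t * sqrt t" using d D1 sq by (intro mult_right_mono) auto
    then have ds: "real d * sqrt t \<le> 1" using sq by simp
    have "t \<le> sqrt t" using assms sqrt_le_D by (metis mult_left_le real_sqrt_ge_0_iff real_sqrt_mult_self sq(2) abs_of_pos less_imp_le)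
    then have "real d * t \<le> real d * sqrt t" by (intro mult_left_mono) auto
    then have dt: "real d * t \<le> 1" using ds by linarith
    have "real d * \<bar>\<theta>\<bar> \<le> real d * sqrt t" using assms by (intro mult_left_mono) auto
    then have dth: "real d * \<bar>\<theta>\<bar> \<le> 1" using ds by linarith
    show "l \<le> gap_term t \<theta> d"
      unfolding l_def by (rule gap_term_near[OF _ _ dt dth]) (use assms d in auto)
  qed auto
  finally show ?thesis using that by (simp add: l_def)
qed

text \<open>For |\<theta>| \<le> 1/4 the near estimate holds for d \<le> 4, each gap being at least
  -ln t - ln 12. Farther out a gap counts -2 ln t, and the weights 1/2 + 1/6 of d = 1 and d = 3, or
  the larger ones with d = 2, give 4/3 > 25/24.\<close>

lemma sum_gap_outer:
  obtains C where "\<And>t \<theta>. 0 < t \<Longrightarrow> t \<le> 1 / 4 \<Longrightarrow> sqrt t \<le> \<bar>\<theta>\<bar> \<Longrightarrow> \<bar>\<theta>\<bar> \<le> pi \<Longrightarrow>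
    \<exists>D. (\<Sum>d=1..D. gap_term t \<theta> d / (2 * real d)) \<ge> 25 / 24 * (- ln t) - C"
proof -
  \<comment> \<open>The factor sin(\<theta>/2) has no zero on [1/4, pi], while sin \<theta> vanishes
    only at pi, where sin(3 \<theta>/2) = -1. Hence d = 1 and at least one of d = 2, 3 are always
    available, uniformly by compactness.\<close>
  define m where "m = (\<lambda>\<theta>::real. min ((sin (\<theta> / 2))\<^sup>2) (max ((sin \<theta>)\<^sup>2) ((sin (3 * \<theta> / 2))\<^sup>2)))"
  have "compact {1/4..pi}" "{1/4..pi} \<noteq> {}" using pi_gt3 by auto
  moreover have "continuous_on {1/4..pi} m" unfolding m_def by (intro continuous_intros) auto
  ultimately have "\<exists>x\<in>{1/4..pi}. \<forall>y\<in>{1/4..pi}. m x \<le> m y" by (rule continuous_attains_inf)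
  then obtain \<theta>0 where \<theta>0: "\<theta>0 \<in> {1/4..pi}" "\<And>\<theta>. \<theta> \<in> {1/4..pi} \<Longrightarrow> m \<theta>0 \<le> m \<theta>" by blast
  have "m \<theta>0 > 0"
  proof -
    have "sin (\<theta>0 / 2) > 0" using \<theta>0(1) pi_gt3 by (intro sin_gt_zero) auto
    moreover have "sin \<theta>0 \<noteq> 0 \<or> sin (3 * \<theta>0 / 2) \<noteq> 0"
    proof (cases "\<theta>0 = pi")
      case True
      have "sin (3 * pi / 2) = -1" using sin_periodic_pi[of "pi / 2"] by (simp add: field_simps)
      then show ?thesis using True by simp
    next
      case False
      then have "sin \<theta>0 > 0" using \<theta>0(1) by (intro sin_gt_zero) auto
      then show ?thesis by simp
    qed
    ultimately show ?thesis by (auto simp: m_def less_max_iff_disj)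
  qed
  define \<epsilon> where "\<epsilon> = m \<theta>0"
  have \<epsilon>: "\<epsilon> > 0" using \<open>m \<theta>0 > 0\<close> by (simp add: \<epsilon>_def)
  define c where "c = ln (4 * \<epsilon> / 27)"
  define C where "C = max (25 / 24 * ln 12) (2 / 3 * \<bar>c\<bar>)"
  have "\<exists>D. (\<Sum>d=1..D. gap_term t \<theta> d / (2 * real d)) \<ge> 25 / 24 * (- ln t) - C"
    if t: "0 < t" "t \<le> 1 / 4" and \<theta>: "sqrt t \<le> \<bar>\<theta>\<bar>" "\<bar>\<theta>\<bar> \<le> pi" for t \<theta>
  proof (cases "\<bar>\<theta>\<bar> \<le> 1 / 4")
    case True
    define l where "l = ln (1 + (\<theta> / t)\<^sup>2 / 12)"
    have "t \<le> \<bar>\<theta>\<bar>\<^sup>2" using \<theta>(1) t by (intro sqrt_le_D) auto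
    then have "1 / t \<le> (\<theta> / t)\<^sup>2" using t by (simp add: power_divide power2_eq_square field_simps)
    then have "1 / (12 * t) \<le> 1 + (\<theta> / t)\<^sup>2 / 12" by simp
    then have "ln (1 / (12 * t)) \<le> l" unfolding l_def using t by (intro ln_mono) (auto intro: add_pos_nonneg)
    then have l: "- ln t - ln 12 \<le> l" using t by (simp add: ln_div ln_mult)
    have "(\<Sum>d=1..4. gap_term t \<theta> d / (2 * real d)) \<ge> (\<Sum>d=1..4. l / (2 * real d))"
    proof (intro sum_mono divide_right_mono)
      fix d :: nat assume d: "d \<in> {1..4}"
      have "real d * t \<le> 4 * (1 / 4)" "real d * \<bar>\<theta>\<bar> \<le> 4 * (1 / 4)"
        by (intro mult_mono; use d t True in auto)+
      then show "l \<le> gap_term t \<theta> d" unfolding l_def using d t by (intro gap_term_near) auto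
    qed auto
    also have "(\<Sum>d=1..4. l / (2 * real d)) = 25 / 24 * l"
      by (simp add: eval_nat_numeral)
    finally have "(\<Sum>d=1..4. gap_term t \<theta> d / (2 * real d)) \<ge> 25 / 24 * l" .
    moreover have "C \<ge> 25 / 24 * ln 12" by (simp add: C_def)
    ultimately show ?thesis using l by (intro exI[of _ 4]) linarith
  next
    case False
    have far: "m \<bar>\<theta>\<bar> \<ge> \<epsilon>" unfolding \<epsilon>_def using \<theta>0(2)[of "\<bar>\<theta>\<bar>"] False \<theta> by auto
    have abs_sin: "(sin (x * \<bar>\<theta>\<bar> / 2))\<^sup>2 = (sin (x * \<theta> / 2))\<^sup>2" for x by (cases "\<theta> \<ge> 0") auto
    have s1: "(sin (real 1 * \<theta> / 2))\<^sup>2 \<ge> \<epsilon>" using far abs_sin[of 1] by (auto simp: m_def)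
    have s23: "(sin (real 2 * \<theta> / 2))\<^sup>2 \<ge> \<epsilon> \<or> (sin (real 3 * \<theta> / 2))\<^sup>2 \<ge> \<epsilon>"
      using far abs_sin[of 2] abs_sin[of 3] by (auto simp: m_def le_max_iff_disj)
    let ?g = "gap_term t \<theta>"
    define u where "u = - 2 * ln t + c"
    have t3: "t \<le> 1 / 3" using t by simp
    have g1: "?g 1 \<ge> u" using gap_term_far[OF _ _ t(1) t3 \<epsilon> s1] by (simp add: u_def c_def)
    have g23: "?g 2 \<ge> u \<or> ?g 3 \<ge> u"
      using s23 gap_term_far[of 2, OF _ _ t(1) t3 \<epsilon>] gap_term_far[of 3, OF _ _ t(1) t3 \<epsilon>]
      by (auto simp: u_def c_def)
    have "(\<Sum>d=1..3. ?g d / (2 * real d)) = ?g 1 / 2 + ?g 2 / 4 + ?g 3 / 6"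
      by (simp add: eval_nat_numeral)
    also have "\<dots> \<ge> 2 / 3 * u"
      using g1 g23 gap_term_nonneg[of t \<theta> 1] gap_term_nonneg[of t \<theta> 2] gap_term_nonneg[of t \<theta> 3]
      by (cases "u \<ge> 0") auto
    finally have "(\<Sum>d=1..3. ?g d / (2 * real d)) \<ge> 2 / 3 * u" .
    moreover have "ln t \<le> 0" using t by simp
    moreover have "2 / 3 * u \<ge> 25 / 24 * (- ln t) - C"
    proof -
      have "2 / 3 * \<bar>c\<bar> \<le> C" by (simp add: C_def)
      then show ?thesis unfolding u_def using \<open>ln t \<le> 0\<close> by (simp add: algebra_simps abs_if split: if_splits)
    qed
    ultimately show ?thesis by (intro exI[of _ 3]) linarith
  qed
  then show ?thesis by (rule that)
qed

subsection \<open>The local expansion at the saddle point\<close>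

text \<open>These are the first three iterates of x d/dx on F, that is, the derivatives with respect
  to ln x; up to powers of the imaginary unit they are the angular derivatives at \<theta> =
  0.\<close>

definition moment1 :: "real \<Rightarrow> real" where "moment1 x = (\<Sum>n. real (divisor_count n) * x ^ n)"
definition moment2 :: "real \<Rightarrow> real" where "moment2 x = (\<Sum>n. real n * real (divisor_count n) * x ^ n)"
definition moment3 :: "real \<Rightarrow> real" where "moment3 x = (\<Sum>n. (real n)\<^sup>2 * real (divisor_count n) * x ^ n)"

lemma moment3_sums:
  assumes "0 < x" "x < 1"
  shows "(\<lambda>n. (real n)\<^sup>2 * real (divisor_count n) * x ^ n) sums moment3 x"
    and "moment3 x \<le> moment2 (sqrt x) / (1 - sqrt x)"
  using square_divisor_count_power_sum[of "sqrt x"] assms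
  by (auto simp: moment3_def moment2_def intro: summable_sums)

lemma divisor_series_taylor:
  assumes r: "0 < r" "r < 1"
  shows "norm (divisor_series (of_real r * cis \<theta>) - of_real (divisor_series r)
    - \<i> * of_real (\<theta> * moment1 r) + of_real (\<theta>\<^sup>2 / 2 * moment2 r)) \<le> \<bar>\<theta>\<bar> ^ 3 / 6 * moment3 r"
proof (rule norm_sums_le)
  let ?\<tau> = "\<lambda>n. real (divisor_count n)"
  let ?z = "complex_of_real r * cis \<theta>"
  have nz: "norm ?z < 1" using r by (simp add: norm_mult)
  have "(\<lambda>n. of_nat (divisor_count n) / of_nat n * ?z ^ n - of_real (?\<tau> n / real n * r ^ n)
      - \<i> * of_real (\<theta> * (?\<tau> n * r ^ n)) + of_real (\<theta>\<^sup>2 / 2 * (real n * ?\<tau> n * r ^ n))) sums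
      (divisor_series ?z - of_real (divisor_series r)
       - \<i> * of_real (\<theta> * moment1 r) + of_real (\<theta>\<^sup>2 / 2 * moment2 r))"
    unfolding moment1_def moment2_def using divisor_series_sums[of r] r
    by (intro sums_add sums_diff sums_mult sums_of_real divisor_series_sums nz summable_sums
        divisor_count_power_sum(1) mult_divisor_count_power_sum(1)) auto
  then show "(\<lambda>n. of_nat (divisor_count n) / of_nat n * ?z ^ n - of_real (?\<tau> n / real n * r ^ n)
      - \<i> * of_real (\<theta> * (?\<tau> n * r ^ n)) + of_real (\<theta>\<^sup>2 / 2 * (real n * ?\<tau> n * r ^ n))) sums
      (divisor_series ?z - of_real (divisor_series r)
       - \<i> * of_real (\<theta> * moment1 r) + of_real (\<theta>\<^sup>2 / 2 * moment2 r))" .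
  show "(\<lambda>n. \<bar>\<theta>\<bar> ^ 3 / 6 * ((real n)\<^sup>2 * ?\<tau> n * r ^ n)) sums (\<bar>\<theta>\<bar> ^ 3 / 6 * moment3 r)"
    using r by (intro sums_mult moment3_sums)
  fix n
  show "norm (of_nat (divisor_count n) / of_nat n * ?z ^ n - of_real (?\<tau> n / real n * r ^ n)
      - \<i> * of_real (\<theta> * (?\<tau> n * r ^ n)) + of_real (\<theta>\<^sup>2 / 2 * (real n * ?\<tau> n * r ^ n)))
      \<le> \<bar>\<theta>\<bar> ^ 3 / 6 * ((real n)\<^sup>2 * ?\<tau> n * r ^ n)" (is "norm ?L \<le> ?R")
  proof (cases "n = 0")
    case False
    define x where "x = real n * \<theta>"
    have cis_n: "?z ^ n = of_real (r ^ n) * cis x"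
      by (simp add: power_mult_distrib Complex.DeMoivre x_def)
    have L: "?L = of_real (?\<tau> n / real n * r ^ n) * (cis x - (1 + \<i> * of_real x - of_real (x\<^sup>2 / 2)))"
      unfolding cis_n x_def using False by (simp add: field_simps power2_eq_square)
    have "norm (cis x - (1 + \<i> * of_real x - of_real (x\<^sup>2 / 2))) \<le> \<bar>x\<bar> ^ 3 / 6"
      using iexp_approx1[of x 2]
      by (simp add: eval_nat_numeral cis_conv_exp algebra_simps power2_eq_square)
    then have "norm ?L \<le> ?\<tau> n / real n * r ^ n * (\<bar>x\<bar> ^ 3 / 6)"
      unfolding L norm_mult using r by (intro mult_mono) (auto simp: norm_mult norm_divide norm_power)
    also have "\<dots> = ?R"
      using False by (simp add: x_def abs_mult power_mult_distrib power2_eq_square power3_eq_cube)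
    finally show ?thesis .
  qed simp
qed

text \<open>The accuracy is dictated by the scaling \<theta> = v t/sqrt l. The linear term carries
  1/sqrt l, so the first moment must be known up to o(sqrt l); the second only to leading order; the
  third must be o(l^(3/2)).\<close>

lemma moment_asymptotics:
  fixes t :: "nat \<Rightarrow> real"
  assumes t: "\<And>n. 0 < t n" "t \<longlonglongrightarrow> 0"
  defines "l \<equiv> (\<lambda>n. - ln (t n))"
  shows "(\<lambda>n. (t n * moment1 (exp (- t n)) - l n) / sqrt (l n)) \<longlonglongrightarrow> 0"
    and "(\<lambda>n. (t n)\<^sup>2 * moment2 (exp (- t n)) / l n) \<longlonglongrightarrow> 1"
    and "(\<lambda>n. (t n) ^ 3 * moment3 (exp (- t n)) / (l n * sqrt (l n))) \<longlonglongrightarrow> 0"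
proof -
  have tr: "filterlim t (at_right 0) sequentially"
    using t by (auto simp: filterlim_at less_imp_neq[THEN not_sym] intro!: always_eventually)
  have r: "0 < exp (- t n)" "exp (- t n) < 1" for n using t(1) by auto
  have pos: "eventually (\<lambda>n. 0 < l n) sequentially"
  proof -
    have "eventually (\<lambda>x::real. 0 < - ln x) (at_right 0)" by real_asymp
    then show ?thesis unfolding l_def using tr by (rule eventually_compose_filterlim)
  qed
  show "(\<lambda>n. (t n * moment1 (exp (- t n)) - l n) / sqrt (l n)) \<longlonglongrightarrow> 0"
  proof -
    define A where "A = (\<lambda>x::real. (x * (- ln (1 - exp (-x)) / (1 - exp (-x))) - (- ln x)) / sqrt (- ln x))"
    define B where "B = (\<lambda>x::real. x * (1 / (1 - exp (-x))) / sqrt (- ln x))"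
    have "(A \<longlongrightarrow> 0) (at_right 0)" unfolding A_def by real_asymp
    then have A: "(\<lambda>n. A (t n)) \<longlonglongrightarrow> 0" using tr by (rule filterlim_compose)
    have "(B \<longlongrightarrow> 0) (at_right 0)" unfolding B_def by real_asymp
    then have B: "(\<lambda>n. B (t n)) \<longlonglongrightarrow> 0" using tr by (rule filterlim_compose)
    have "(\<lambda>n. (t n * moment1 (exp (- t n)) - l n) / sqrt (l n) - A (t n)) \<longlonglongrightarrow> 0"
    proof (rule Lim_null_comparison[OF _ B])
      show "eventually (\<lambda>n. norm ((t n * moment1 (exp (- t n)) - l n) / sqrt (l n) - A (t n)) \<le> B (t n)) sequentially"
        using pos
      proof eventually_elim
        case (elim n)
        have "(t n * moment1 (exp (- t n)) - l n) / sqrt (l n) - A (t n) =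
            t n * (moment1 (exp (- t n)) - (- ln (1 - exp (- t n)) / (1 - exp (- t n)))) / sqrt (l n)"
          unfolding A_def l_def diff_divide_distrib[symmetric] by (simp only: right_diff_distrib) simp
        also have "norm \<dots> = t n * \<bar>moment1 (exp (- t n)) - (- ln (1 - exp (- t n)) / (1 - exp (- t n)))\<bar> / sqrt (l n)"
          using t(1)[of n] elim by (simp add: abs_mult)
        also have "\<dots> \<le> t n * (1 / (1 - exp (- t n))) / sqrt (l n)"
          unfolding moment1_def using divisor_count_power_sum(2)[OF r] t(1)[of n] elim
          by (intro divide_right_mono mult_left_mono) auto
        finally show ?case by (simp add: B_def l_def)
      qed
    qed
    from tendsto_add[OF this A] show ?thesis by simp
  qed
  have m2: "\<bar>moment2 x - x * (1 - ln (1 - x)) / (1 - x)\<^sup>2\<bar> \<le> 4 / (1 - x)\<^sup>2" if "0 < x" "x < 1" for x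
    unfolding moment2_def by (rule mult_divisor_count_power_sum(2)[OF that])
  show "(\<lambda>n. (t n)\<^sup>2 * moment2 (exp (- t n)) / l n) \<longlonglongrightarrow> 1"
  proof -
    define A where "A = (\<lambda>x::real. x\<^sup>2 * (exp (-x) * (1 - ln (1 - exp (-x))) / (1 - exp (-x))\<^sup>2) / (- ln x))"
    define B where "B = (\<lambda>x::real. x\<^sup>2 * (4 / (1 - exp (-x))\<^sup>2) / (- ln x))"
    have "(A \<longlongrightarrow> 1) (at_right 0)" unfolding A_def by real_asymp
    then have A: "(\<lambda>n. A (t n)) \<longlonglongrightarrow> 1" using tr by (rule filterlim_compose)
    have "(B \<longlongrightarrow> 0) (at_right 0)" unfolding B_def by real_asymp
    then have B: "(\<lambda>n. B (t n)) \<longlonglongrightarrow> 0" using tr by (rule filterlim_compose)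
    have "(\<lambda>n. (t n)\<^sup>2 * moment2 (exp (- t n)) / l n - A (t n)) \<longlonglongrightarrow> 0"
    proof (rule Lim_null_comparison[OF _ B])
      show "eventually (\<lambda>n. norm ((t n)\<^sup>2 * moment2 (exp (- t n)) / l n - A (t n)) \<le> B (t n)) sequentially"
        using pos
      proof eventually_elim
        case (elim n)
        have "(t n)\<^sup>2 * moment2 (exp (- t n)) / l n - A (t n) =
            (t n)\<^sup>2 * (moment2 (exp (- t n)) - exp (- t n) * (1 - ln (1 - exp (- t n))) / (1 - exp (- t n))\<^sup>2) / l n"
          unfolding A_def l_def diff_divide_distrib[symmetric] by (simp only: right_diff_distrib)
        also have "norm \<dots> = (t n)\<^sup>2 * \<bar>moment2 (exp (- t n)) - exp (- t n) * (1 - ln (1 - exp (- t n))) / (1 - exp (- t n))\<^sup>2\<bar> / l n"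
          using elim by (simp add: abs_mult)
        also have "\<dots> \<le> (t n)\<^sup>2 * (4 / (1 - exp (- t n))\<^sup>2) / l n"
          using m2[OF r] elim by (intro divide_right_mono mult_left_mono) auto
        finally show ?case by (simp add: B_def l_def)
      qed
    qed
    from tendsto_add[OF this A] show ?thesis by simp
  qed
  show "(\<lambda>n. (t n) ^ 3 * moment3 (exp (- t n)) / (l n * sqrt (l n))) \<longlonglongrightarrow> 0"
  proof -
    \<comment> \<open>The arguments x/2 come from bounding the third moment at r by the second one
      at sqrt r.\<close>
    define B where "B = (\<lambda>x::real. x ^ 3 * ((exp (-x/2) * (1 - ln (1 - exp (-x/2))) / (1 - exp (-x/2))\<^sup>2
      + 4 / (1 - exp (-x/2))\<^sup>2) / (1 - exp (-x/2))) / (- ln x * sqrt (- ln x)))"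
    have "(B \<longlongrightarrow> 0) (at_right 0)" unfolding B_def by real_asymp
    then have B: "(\<lambda>n. B (t n)) \<longlonglongrightarrow> 0" using tr by (rule filterlim_compose)
    show ?thesis
    proof (rule Lim_null_comparison[OF _ B])
      show "eventually (\<lambda>n. norm ((t n) ^ 3 * moment3 (exp (- t n)) / (l n * sqrt (l n))) \<le> B (t n)) sequentially"
        using pos
      proof eventually_elim
        case (elim n)
        define y where "y = exp (- t n / 2)"
        have y: "0 < y" "y < 1" using t(1)[of n] by (auto simp: y_def)
        have "y\<^sup>2 = exp (- t n)" by (simp add: y_def power2_eq_square flip: exp_add)
        then have sq: "sqrt (exp (- t n)) = y" using y by (metis less_imp_le real_sqrt_abs abs_of_pos)
        have m0: "moment3 (exp (- t n)) \<ge> 0"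
          unfolding moment3_def by (rule suminf_nonneg) (use moment3_sums(1)[OF r] in \<open>auto simp: sums_iff\<close>)
        have m: "moment3 (exp (- t n)) \<le> (y * (1 - ln (1 - y)) / (1 - y)\<^sup>2 + 4 / (1 - y)\<^sup>2) / (1 - y)"
        proof -
          have "moment2 y \<le> y * (1 - ln (1 - y)) / (1 - y)\<^sup>2 + 4 / (1 - y)\<^sup>2"
            using m2[OF y] by linarith
          then have "moment2 y / (1 - y) \<le> (y * (1 - ln (1 - y)) / (1 - y)\<^sup>2 + 4 / (1 - y)\<^sup>2) / (1 - y)"
            using y by (intro divide_right_mono) auto
          then show ?thesis using moment3_sums(2)[OF r[of n]] unfolding sq by linarith
        qed
        have "norm ((t n) ^ 3 * moment3 (exp (- t n)) / (l n * sqrt (l n))) \<le>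
            (t n) ^ 3 * ((y * (1 - ln (1 - y)) / (1 - y)\<^sup>2 + 4 / (1 - y)\<^sup>2) / (1 - y)) / (l n * sqrt (l n))"
        proof -
          have "norm ((t n) ^ 3 * moment3 (exp (- t n)) / (l n * sqrt (l n))) =
              (t n) ^ 3 * moment3 (exp (- t n)) / (l n * sqrt (l n))"
            using m0 t(1)[of n] elim by (simp add: abs_mult)
          also have "\<dots> \<le> (t n) ^ 3 * ((y * (1 - ln (1 - y)) / (1 - y)\<^sup>2 + 4 / (1 - y)\<^sup>2) / (1 - y)) / (l n * sqrt (l n))"
            using t(1)[of n] elim by (intro divide_right_mono mult_left_mono m) auto
          finally show ?thesis .
        qed
        then show ?case by (simp only: B_def l_def y_def)
      qed
    qed
  qed
qed

section \<open>Dominated convergence for the rescaled Cauchy integral\<close>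

lemma has_integral_gaussian: "((\<lambda>x::real. exp (- x\<^sup>2 / 2)) has_integral sqrt (2 * pi)) UNIV"
proof -
  have "(normal_density 0 1 has_integral 1) UNIV"
    using has_integral_integral_lborel[OF integrable_normal_density[of 1 0]] by simp
  from has_integral_mult_right[OF this, of "sqrt (2 * pi)"] show ?thesis
    by (simp add: normal_density_def)
qed

lemma inverse_one_plus_square_integrable: "(\<lambda>x::real. inverse (1 + x\<^sup>2)) integrable_on UNIV"
proof -
  have "set_integrable lborel UNIV (\<lambda>x::real. inverse (1 + x\<^sup>2))"
    using integrable_inverse_1_plus_square by (simp add: einterval_def)
  then show ?thesis by (rule set_borel_integral_eq_integral(1))
qed

text \<open>Bernoulli's inequality is applied with the integer part k of l/4; l \<ge> 4 gives k
  \<ge> l/8, whence 96 = 8 * 12. The majorant is integrable and independent of l.\<close>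

lemma powr_bernoulli_bound:
  fixes l v :: real
  assumes "l \<ge> 4"
  shows "exp (- (l / 4 * ln (1 + v\<^sup>2 / l / 12))) \<le> 96 * inverse (1 + v\<^sup>2)"
proof -
  define k where "k = nat \<lfloor>l / 4\<rfloor>"
  define x where "x = v\<^sup>2 / l / 12"
  have x: "x \<ge> 0" using assms by (simp add: x_def)
  have "\<lfloor>l / 4\<rfloor> \<ge> 1" using assms by (simp add: le_floor_iff)
  then have k: "real k \<le> l / 4" "l / 8 \<le> real k" unfolding k_def by linarith+
  have "1 + v\<^sup>2 / 96 = 1 + l / 8 * x" using assms by (simp add: x_def)
  also have "\<dots> \<le> 1 + real k * x" using k x by (intro add_left_mono mult_right_mono) auto
  also have "\<dots> \<le> (1 + x) ^ k" using x by (intro Bernoulli_inequality) auto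
  also have "\<dots> = exp (real k * ln (1 + x))" using x by (simp add: exp_of_nat_mult)
  also have "\<dots> \<le> exp (l / 4 * ln (1 + x))" using mult_right_mono[OF k(1), of "ln (1 + x)"] x by simp
  finally have "1 + v\<^sup>2 / 96 \<le> exp (l / 4 * ln (1 + x))" .
  then have "inverse (exp (l / 4 * ln (1 + x))) \<le> inverse (1 + v\<^sup>2 / 96)"
    by (intro le_imp_inverse_le) (auto intro: add_pos_nonneg)
  also have "\<dots> \<le> 96 * inverse (1 + v\<^sup>2)"
  proof -
    have "0 < 1 + v\<^sup>2 / 96" "0 < 1 + v\<^sup>2" by (auto intro: add_pos_nonneg)
    moreover have "1 + v\<^sup>2 \<le> 96 * (1 + v\<^sup>2 / 96)" by simp
    ultimately show ?thesis by (simp add: field_simps)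
  qed
  finally show ?thesis by (simp add: x_def exp_minus)
qed

text \<open>The degree \<open>N n\<close> is separate from the index so that an initial segment can
  be discarded; this makes t \<le> exp(-4) available at every index, giving l \<ge> 4 and t \<le>
  1/4. The left side is the Cauchy integral in the variable v, normalised by the value at v =
  0.\<close>

lemma saddle_point:
  fixes t :: "nat \<Rightarrow> real" and N :: "nat \<Rightarrow> nat"
  assumes t: "\<And>n. 0 < t n" "\<And>n. t n \<le> exp (-4)" "t \<longlonglongrightarrow> 0"
    and saddle: "\<And>n. real (N n) * t n = euler_mascheroni - ln (t n)"
  shows "(\<lambda>n. P_coeff (N n) * exp (- (real (N n) * t n)) * exp (- divisor_series (exp (- t n))) *
    (2 * pi * sqrt (- ln (t n)) / t n)) \<longlonglongrightarrow> sqrt (2 * pi)"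
proof -
  define l where "l = (\<lambda>n. - ln (t n))"
  have l4: "l n \<ge> 4" for n
  proof -
    have "ln (t n) \<le> ln (exp (-4))" using t(1,2) by (intro ln_mono) auto
    then show ?thesis by (simp add: l_def)
  qed
  have l0: "l n > 0" for n using l4[of n] by linarith
  \<comment> \<open>The width of the peak: the second moment is asymptotic to l/t^2.\<close>
  define \<delta> where "\<delta> = (\<lambda>n. t n / sqrt (l n))"
  have \<delta>: "\<delta> n > 0" for n using t(1)[of n] l0[of n] by (simp add: \<delta>_def)
  define r where "r = (\<lambda>n. exp (- t n))"
  have r: "0 < r n" "r n < 1" for n using t(1)[of n] by (auto simp: r_def)
  have tr: "filterlim t (at_right 0) sequentially"
    using t by (auto simp: filterlim_at less_imp_neq[THEN not_sym] intro!: always_eventually)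
  have t14: "t n \<le> 1 / 4" for n
  proof -
    have "exp (-4 :: real) \<le> 1 / 4"
      using exp_ge_add_one_self[of "4::real"] by (simp add: exp_minus field_simps)
    then show ?thesis using t(2)[of n] by linarith
  qed

  define E where "E = (\<lambda>n v. divisor_series (of_real (r n) * cis (\<delta> n * v)) - of_real (divisor_series (r n)))"
  define G where "G = (\<lambda>n v. exp (E n v) * cis (- (real (N n) * (\<delta> n * v))))"
  define I where "I = (\<lambda>n. P_coeff (N n) * exp (- (real (N n) * t n)) * exp (- divisor_series (r n)) *
    (2 * pi * sqrt (l n) / t n))"
  define X where "X = (\<lambda>n. pi / \<delta> n)"
  \<comment> \<open>The points v = \<plusminus>\<open>V n\<close> correspond to |\<theta>| = sqrt t,
    where the central and the outer estimate meet.\<close>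
  define V where "V = (\<lambda>n. sqrt (t n) / \<delta> n)"
  have int: "(G n has_integral of_real (I n)) {- X n..X n}" for n
  proof -
    from has_integral_mult_right[OF P_coeff_integral[OF r[of n] \<delta>[of n], of "N n"],
        of "of_real (exp (- divisor_series (r n)))"]
    have "((\<lambda>v. of_real (exp (- divisor_series (r n))) *
        (exp (divisor_series (of_real (r n) * cis (\<delta> n * v))) * cis (- (real (N n) * (\<delta> n * v)))))
        has_integral of_real (exp (- divisor_series (r n)) * (2 * pi * P_coeff (N n) * r n ^ N n / \<delta> n))) {- X n..X n}"
      by (simp add: X_def)
    moreover have "(\<lambda>v. of_real (exp (- divisor_series (r n))) *
        (exp (divisor_series (of_real (r n) * cis (\<delta> n * v))) * cis (- (real (N n) * (\<delta> n * v))))) = G n"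
      by (auto simp: G_def E_def exp_diff exp_minus exp_of_real field_simps)
    moreover have "exp (- divisor_series (r n)) * (2 * pi * P_coeff (N n) * r n ^ N n / \<delta> n) = I n"
      by (simp add: I_def \<delta>_def r_def exp_of_nat_mult[symmetric])
    ultimately show ?thesis by (simp only:)
  qed
  have VX: "0 < V n" "V n \<le> X n" for n
  proof -
    show "0 < V n" using t(1) \<delta> by (simp add: V_def)
    have "sqrt (t n) \<le> sqrt 1" using t14[of n] by (intro real_sqrt_le_mono) auto
    then have "sqrt (t n) \<le> pi" using pi_gt3 by (simp only: real_sqrt_one)
    then show "V n \<le> X n" unfolding V_def X_def using \<delta>[of n] by (intro divide_right_mono) auto
  qed
  have normG: "norm (G n v) = exp (Re (divisor_series (of_real (r n) * cis (\<delta> n * v))) - divisor_series (r n))" for n v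
    by (simp add: G_def E_def norm_mult)

  have central: "norm (G n v) \<le> 96 * inverse (1 + v\<^sup>2)" if v: "v \<in> {- V n..V n}" for n v
  proof -
    have "\<bar>\<delta> n * v\<bar> = \<delta> n * \<bar>v\<bar>" using \<delta>[of n] by (simp add: abs_mult)
    also have "\<dots> \<le> \<delta> n * V n" using v \<delta>[of n] by (intro mult_left_mono) auto
    also have "\<dots> = sqrt (t n)" using \<delta>[of n] by (simp add: V_def)
    finally have th: "\<bar>\<delta> n * v\<bar> \<le> sqrt (t n)" .
    have "t n \<le> 1" using t14[of n] by simp
    from sum_gap_central[OF t(1) this th] obtain D where
      "(\<Sum>d=1..D. gap_term (t n) (\<delta> n * v) d / (2 * real d)) \<ge> (- ln (t n) / 4) * ln (1 + (\<delta> n * v / t n)\<^sup>2 / 12)" .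
    moreover have "(\<delta> n * v / t n)\<^sup>2 = v\<^sup>2 / l n"
      using t(1)[of n] l0[of n] by (simp add: \<delta>_def power_divide power_mult_distrib)
    ultimately have "Re (divisor_series (of_real (r n) * cis (\<delta> n * v))) - divisor_series (r n)
        \<le> - (l n / 4 * ln (1 + v\<^sup>2 / l n / 12))"
      using divisor_series_gap[OF t(1)[of n], of "\<delta> n * v" D] by (simp add: r_def l_def)
    then have "norm (G n v) \<le> exp (- (l n / 4 * ln (1 + v\<^sup>2 / l n / 12)))"
      unfolding normG by simp
    also have "\<dots> \<le> 96 * inverse (1 + v\<^sup>2)" by (rule powr_bernoulli_bound[OF l4])
    finally show ?thesis .
  qed

  obtain C where C: "\<And>t \<theta>. 0 < t \<Longrightarrow> t \<le> 1 / 4 \<Longrightarrow> sqrt t \<le> \<bar>\<theta>\<bar> \<Longrightarrow> \<bar>\<theta>\<bar> \<le> pi \<Longrightarrow>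
    \<exists>D. (\<Sum>d=1..D. gap_term t \<theta> d / (2 * real d)) \<ge> 25 / 24 * (- ln t) - C"
    using sum_gap_outer by blast
  \<comment> \<open>The outer range has length of order sqrt l/t, so the exponent 25/24 leaves t
    powr (1/24) times sqrt l, which still tends to 0.\<close>
  define B where "B = (\<lambda>n. exp C * t n powr (25 / 24))"
  have outer: "norm (G n v) \<le> B n" if v: "V n \<le> \<bar>v\<bar>" "\<bar>v\<bar> \<le> X n" for n v
  proof -
    have eq: "\<bar>\<delta> n * v\<bar> = \<delta> n * \<bar>v\<bar>" using \<delta>[of n] by (simp add: abs_mult)
    have "\<delta> n * V n \<le> \<delta> n * \<bar>v\<bar>" "\<delta> n * \<bar>v\<bar> \<le> \<delta> n * X n"
      using v \<delta>[of n] by (auto intro!: mult_left_mono)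
    then have "sqrt (t n) \<le> \<bar>\<delta> n * v\<bar>" "\<bar>\<delta> n * v\<bar> \<le> pi"
      using \<delta>[of n] unfolding eq by (auto simp: V_def X_def)
    from C[OF t(1) t14 this] obtain D where
      "(\<Sum>d=1..D. gap_term (t n) (\<delta> n * v) d / (2 * real d)) \<ge> 25 / 24 * (- ln (t n)) - C" by blast
    then have "Re (divisor_series (of_real (r n) * cis (\<delta> n * v))) - divisor_series (r n) \<le> C + 25 / 24 * ln (t n)"
      using divisor_series_gap[OF t(1)[of n], of "\<delta> n * v" D] by (simp add: r_def)
    then have "norm (G n v) \<le> exp (C + 25 / 24 * ln (t n))" unfolding normG by simp
    also have "\<dots> = B n" using t(1)[of n] by (simp add: B_def exp_add powr_def)
    finally show ?thesis .
  qed

  have pointwise: "(\<lambda>n. G n v) \<longlonglongrightarrow> exp (of_real (- v\<^sup>2 / 2))" for v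
  proof -
    have mom: "(\<lambda>n. (t n * moment1 (r n) - l n) / sqrt (l n)) \<longlonglongrightarrow> 0"
      "(\<lambda>n. (t n)\<^sup>2 * moment2 (r n) / l n) \<longlonglongrightarrow> 1"
      "(\<lambda>n. (t n) ^ 3 * moment3 (r n) / (l n * sqrt (l n))) \<longlonglongrightarrow> 0"
      unfolding l_def r_def by (rule moment_asymptotics[OF t(1,3)])+
    define err where "err = (\<lambda>n. E n v - \<i> * of_real (\<delta> n * v * moment1 (r n)) + of_real ((\<delta> n * v)\<^sup>2 / 2 * moment2 (r n)))"
    have err0: "err \<longlonglongrightarrow> 0"
    proof (rule Lim_null_comparison)
      show "eventually (\<lambda>n. norm (err n) \<le> \<bar>v\<bar> ^ 3 / 6 * ((t n) ^ 3 * moment3 (r n) / (l n * sqrt (l n)))) sequentially"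
      proof (intro always_eventually allI)
        fix n
        have "norm (err n) \<le> \<bar>\<delta> n * v\<bar> ^ 3 / 6 * moment3 (r n)"
          unfolding err_def E_def by (rule divisor_series_taylor[OF r])
        also have "\<bar>\<delta> n * v\<bar> ^ 3 = \<bar>v\<bar> ^ 3 * ((t n) ^ 3 / (l n * sqrt (l n)))"
          using t(1)[of n] l0[of n]
          by (simp add: \<delta>_def abs_mult power_mult_distrib power_divide power3_eq_cube)
        finally show "norm (err n) \<le> \<bar>v\<bar> ^ 3 / 6 * ((t n) ^ 3 * moment3 (r n) / (l n * sqrt (l n)))"
          by simp
      qed
      show "(\<lambda>n. \<bar>v\<bar> ^ 3 / 6 * ((t n) ^ 3 * moment3 (r n) / (l n * sqrt (l n)))) \<longlonglongrightarrow> 0"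
        using tendsto_mult[OF tendsto_const mom(3), of "\<bar>v\<bar> ^ 3 / 6"] by simp
    qed
    \<comment> \<open>In the linear phase the saddle equation N t = \<gamma> + l cancels the leading
      part l of the first moment; the remaining \<gamma>/sqrt l tends to 0.\<close>
    define ph where "ph = (\<lambda>n. \<delta> n * v * moment1 (r n) - real (N n) * (\<delta> n * v))"
    have ph0: "ph \<longlonglongrightarrow> 0"
    proof -
      have "(\<lambda>n. 1 / sqrt (l n)) \<longlonglongrightarrow> 0"
      proof -
        have "((\<lambda>x::real. 1 / sqrt (- ln x)) \<longlongrightarrow> 0) (at_right 0)" by real_asymp
        then show ?thesis unfolding l_def using tr by (rule filterlim_compose)
      qed
      from tendsto_mult[OF tendsto_const this, of "euler_mascheroni"]
      have "(\<lambda>n. euler_mascheroni * (1 / sqrt (l n))) \<longlonglongrightarrow> 0" by simp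
      from tendsto_mult[OF tendsto_const tendsto_diff[OF mom(1) this], of v]
      have "(\<lambda>n. v * ((t n * moment1 (r n) - l n) / sqrt (l n) - euler_mascheroni * (1 / sqrt (l n)))) \<longlonglongrightarrow> 0"
        by simp
      moreover have "v * ((t n * moment1 (r n) - l n) / sqrt (l n) - euler_mascheroni * (1 / sqrt (l n))) = ph n" for n
      proof -
        have "real (N n) * t n = euler_mascheroni + l n" using saddle[of n] by (simp add: l_def)
        then have "ph n = v / sqrt (l n) * (t n * moment1 (r n) - (euler_mascheroni + l n))"
          unfolding ph_def \<delta>_def by (simp add: right_diff_distrib mult_ac)
        then show ?thesis by (simp add: diff_divide_distrib add_divide_distrib algebra_simps)
      qed
      ultimately show ?thesis by simp
    qed
    define q where "q = (\<lambda>n. (\<delta> n * v)\<^sup>2 / 2 * moment2 (r n))"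
    have q0: "q \<longlonglongrightarrow> v\<^sup>2 / 2"
    proof -
      have "(\<lambda>n. v\<^sup>2 / 2 * ((t n)\<^sup>2 * moment2 (r n) / l n)) \<longlonglongrightarrow> v\<^sup>2 / 2 * 1"
        by (intro tendsto_mult tendsto_const mom(2))
      moreover have "v\<^sup>2 / 2 * ((t n)\<^sup>2 * moment2 (r n) / l n) = q n" for n
        using l0[of n] by (simp add: q_def \<delta>_def power_mult_distrib power_divide mult_ac)
      ultimately show ?thesis by simp
    qed
    have "G n v = exp (err n + \<i> * of_real (ph n) - of_real (q n))" for n
    proof -
      have "cis (- (real (N n) * (\<delta> n * v))) = exp (\<i> * of_real (- (real (N n) * (\<delta> n * v))))"
        by (rule cis_conv_exp)
      then show ?thesis
        unfolding G_def by (simp add: exp_add[symmetric] err_def ph_def q_def algebra_simps)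
    qed
    moreover have "(\<lambda>n. exp (err n + \<i> * of_real (ph n) - of_real (q n))) \<longlonglongrightarrow>
        exp (0 + \<i> * of_real 0 - of_real (v\<^sup>2 / 2))"
      by (intro tendsto_intros err0 ph0 q0)
    ultimately show ?thesis by simp
  qed

  \<comment> \<open>Cutting off at \<open>V n\<close> gives functions on the whole line; the
    pointwise limit is unchanged because \<open>V n\<close> tends to infinity.\<close>
  define A where "A = (\<lambda>n v. if v \<in> {- V n..V n} then G n v else 0)"
  have Gint: "G n integrable_on {a..b}" if "- X n \<le> a" "b \<le> X n" for n a b
  proof (rule integrable_on_subinterval)
    show "G n integrable_on {- X n..X n}" using int by blast
  qed (use that in auto)
  have Vlim: "filterlim V at_top sequentially"
  proof -
    have "filterlim (\<lambda>x::real. sqrt x / (x / sqrt (- ln x))) at_top (at_right 0)" by real_asymp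
    then show ?thesis unfolding V_def \<delta>_def l_def using tr by (rule filterlim_compose)
  qed
  have conv: "(\<lambda>n. integral UNIV (A n)) \<longlonglongrightarrow> integral UNIV (\<lambda>v. exp (complex_of_real (- v\<^sup>2 / 2)))"
  proof (rule dominated_convergence(2))
    show "A n integrable_on UNIV" for n
      unfolding A_def integrable_restrict_UNIV using VX[of n] by (intro Gint) auto
    show "(\<lambda>v::real. 96 * inverse (1 + v\<^sup>2)) integrable_on UNIV"
      using inverse_one_plus_square_integrable by (rule integrable_on_mult_right)
    show "norm (A n v) \<le> 96 * inverse (1 + v\<^sup>2)" for n v
      using central[of v n] by (auto simp: A_def)
    show "(\<lambda>n. A n v) \<longlonglongrightarrow> exp (complex_of_real (- v\<^sup>2 / 2))" for v
    proof (rule Lim_transform_eventually[OF pointwise])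
      have "eventually (\<lambda>n. \<bar>v\<bar> \<le> V n) sequentially" using Vlim by (simp add: filterlim_at_top)
      then show "eventually (\<lambda>n. G n v = A n v) sequentially"
        by eventually_elim (auto simp: A_def)
    qed
  qed
  have "((\<lambda>v. complex_of_real (exp (- v\<^sup>2 / 2))) has_integral of_real (sqrt (2 * pi))) UNIV"
    by (intro has_integral_of_real has_integral_gaussian)
  then have lim: "integral UNIV (\<lambda>v. exp (complex_of_real (- v\<^sup>2 / 2))) = of_real (sqrt (2 * pi))"
    by (intro integral_unique) (simp only: exp_of_real)
  have split: "norm (of_real (I n) - integral UNIV (A n)) \<le> 2 * (B n * X n)" for n
  proof -
    have "of_real (I n) = integral {- X n..X n} (G n)" using int[of n] by (simp add: integral_unique)
    also have "\<dots> = integral {- X n..- V n} (G n) + integral {- V n..X n} (G n)"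
      using VX[of n] by (intro Henstock_Kurzweil_Integration.integral_combine[symmetric] Gint) auto
    also have "integral {- V n..X n} (G n) = integral {- V n..V n} (G n) + integral {V n..X n} (G n)"
      using VX[of n] by (intro Henstock_Kurzweil_Integration.integral_combine[symmetric] Gint) auto
    also have "integral {- V n..V n} (G n) = integral UNIV (A n)"
      unfolding A_def by (rule integral_restrict_UNIV[symmetric])
    finally have eq: "of_real (I n) - integral UNIV (A n) =
        integral {- X n..- V n} (G n) + integral {V n..X n} (G n)" by simp
    have B0: "B n \<ge> 0" by (simp add: B_def)
    have bnd: "norm (integral {a..b} (G n)) \<le> B n * X n"
      if ab: "a \<le> b" "- X n \<le> a" "b \<le> X n" "b - a \<le> X n" "\<And>v. v \<in> {a..b} \<Longrightarrow> V n \<le> \<bar>v\<bar>" for a b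
    proof -
      have "(G n has_integral integral {a..b} (G n)) (cbox a b)"
        using Gint[OF ab(2,3)] by (simp add: integrable_integral)
      from has_integral_bound[OF B0 this]
      have "norm (integral {a..b} (G n)) \<le> B n * measure lborel (cbox a b)"
        using ab by (force intro!: outer)
      also have "\<dots> \<le> B n * X n" using ab B0 by (intro mult_left_mono) auto
      finally show ?thesis .
    qed
    have "norm (integral {- X n..- V n} (G n)) \<le> B n * X n" "norm (integral {V n..X n} (G n)) \<le> B n * X n"
      using VX[of n] by (intro bnd; auto)+
    then show ?thesis
      unfolding eq using norm_triangle_ineq[of "integral {- X n..- V n} (G n)" "integral {V n..X n} (G n)"]
      by linarith
  qed
  have "(\<lambda>n. 2 * (B n * X n)) \<longlonglongrightarrow> 0"
  proof -
    have "((\<lambda>x::real. 2 * (exp C * x powr (25 / 24) * (pi / (x / sqrt (- ln x))))) \<longlongrightarrow> 0) (at_right 0)"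
      by real_asymp
    then show ?thesis unfolding B_def X_def \<delta>_def l_def using tr by (rule filterlim_compose)
  qed
  then have "(\<lambda>n. of_real (I n) - integral UNIV (A n)) \<longlonglongrightarrow> 0"
    by (rule Lim_null_comparison[OF always_eventually[OF allI[OF split]]])
  from tendsto_add[OF this conv] have "(\<lambda>n. complex_of_real (I n)) \<longlonglongrightarrow> of_real (sqrt (2 * pi))"
    unfolding lim by simp
  then have "I \<longlonglongrightarrow> sqrt (2 * pi)" by (simp only: tendsto_of_real_iff)
  then show ?thesis by (simp add: I_def l_def r_def)
qed

subsection \<open>The location of the saddle point\<close>

text \<open>Since y exp y \<ge> y, the intermediate value theorem on [0, y] places y in the image,
  which is what makes \<open>inv_into\<close> a genuine inverse there.\<close>

lemma Lambert_W_nonneg_eq: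
  assumes "y \<ge> 0"
  shows "Lambert_W y \<ge> 0" "Lambert_W y * exp (Lambert_W y) = y"
proof -
  have "y * 1 \<le> y * exp y" using assms by (intro mult_left_mono) auto
  then have "\<exists>x\<ge>0. x \<le> y \<and> x * exp x = y"
    using assms by (intro IVT') (auto intro!: continuous_intros)
  then have mem: "y \<in> (\<lambda>x. x * exp x) ` {0..}" by auto
  show "Lambert_W y \<ge> 0" using inv_into_into[OF mem] by (simp add: Lambert_W_def)
  show "Lambert_W y * exp (Lambert_W y) = y" using f_inv_into_f[OF mem] by (simp add: Lambert_W_def)
qed

context
  fixes w t :: "nat \<Rightarrow> real"
  defines "w \<equiv> (\<lambda>n. Lambert_W (exp euler_mascheroni * real n))"
    and "t \<equiv> (\<lambda>n. w n / real n)"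
begin

lemma w_eq: "w n * exp (w n) = exp euler_mascheroni * real n"
  unfolding w_def by (rule Lambert_W_nonneg_eq) simp

lemma w_pos: "n \<ge> 1 \<Longrightarrow> w n > 0"
  using w_eq[of n] Lambert_W_nonneg_eq(1)[of "exp euler_mascheroni * real n"]
  by (cases "w n = 0") (auto simp: w_def)

lemma t_pos: "n \<ge> 1 \<Longrightarrow> t n > 0"
  using w_pos by (simp add: t_def)

text \<open>From w exp w = exp(\<gamma>) n one gets t = w/n = exp(\<gamma> - w). Together with n t =
  w this is the saddle equation n t = \<gamma> - ln t.\<close>

lemma ln_t: "n \<ge> 1 \<Longrightarrow> ln (t n) = euler_mascheroni - w n"
  and ln_n: "n \<ge> 1 \<Longrightarrow> ln (real n) = w n + ln (w n) - euler_mascheroni"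
proof -
  assume n: "n \<ge> 1"
  have "ln (w n * exp (w n)) = ln (exp euler_mascheroni * real n)" by (simp only: w_eq)
  then have "ln (w n) + w n = euler_mascheroni + ln (real n)"
    using n w_pos[OF n] by (simp add: ln_mult)
  then show "ln (t n) = euler_mascheroni - w n" "ln (real n) = w n + ln (w n) - euler_mascheroni"
    using n w_pos[OF n] by (simp_all add: t_def ln_div)
qed

text \<open>While w stays below Z, the product w exp w is bounded, but it equals exp(\<gamma>)
  n.\<close>

lemma w_at_top: "filterlim w at_top sequentially"
  unfolding filterlim_at_top
proof
  fix Z :: real
  define n0 where "n0 = nat \<lceil>\<bar>Z\<bar> * exp \<bar>Z\<bar>\<rceil> + 1"
  show "eventually (\<lambda>n. Z \<le> w n) sequentially"
    using eventually_ge_at_top[of n0]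
  proof eventually_elim
    case (elim n)
    show ?case
    proof (rule ccontr)
      assume "\<not> Z \<le> w n"
      moreover have "w n > 0" using elim by (intro w_pos) (simp add: n0_def)
      ultimately have "w n * exp (w n) \<le> \<bar>Z\<bar> * exp \<bar>Z\<bar>" by (intro mult_mono) auto
      moreover have "real n0 > \<bar>Z\<bar> * exp \<bar>Z\<bar>" unfolding n0_def by linarith
      moreover have "1 * real n \<le> exp euler_mascheroni * real n"
        using euler_mascheroni_pos by (intro mult_right_mono) auto
      moreover have "real n0 \<le> real n" using elim by simp
      ultimately show False using w_eq[of n] by linarith
    qed
  qed
qed

lemma t_LIMSEQ: "t \<longlonglongrightarrow> 0"
proof -
  have "((\<lambda>x::real. exp (euler_mascheroni - x)) \<longlongrightarrow> 0) at_top" by real_asymp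
  then have "(\<lambda>n. exp (euler_mascheroni - w n)) \<longlonglongrightarrow> 0" using w_at_top by (rule filterlim_compose)
  moreover have "eventually (\<lambda>n. exp (euler_mascheroni - w n) = t n) sequentially"
    using eventually_ge_at_top[of 1]
    by eventually_elim (metis exp_ln ln_t t_pos)
  ultimately show ?thesis by (rule Lim_transform_eventually)
qed

lemma P_coeff_saddle:
  "(\<lambda>n. P_coeff n * exp (- w n) * exp (- divisor_series (exp (- t n))) *
    (2 * pi * sqrt (- ln (t n)) / t n)) \<longlonglongrightarrow> sqrt (2 * pi)"
proof -
  have "eventually (\<lambda>n. t n < exp (-4)) sequentially"
    using t_LIMSEQ by (rule order_tendstoD) simp
  then obtain n0 where n0: "\<And>n. n \<ge> n0 \<Longrightarrow> t n < exp (-4)" by (auto simp: eventually_sequentially)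
  \<comment> \<open>The extra 1 excludes n = 0, where t is not positive.\<close>
  define m where "m = n0 + 1"
  have nt: "real n * t n = w n" if "n \<ge> 1" for n using that by (simp add: t_def)
  have "(\<lambda>n. P_coeff (n + m) * exp (- (real (n + m) * t (n + m))) * exp (- divisor_series (exp (- t (n + m)))) *
    (2 * pi * sqrt (- ln (t (n + m))) / t (n + m))) \<longlonglongrightarrow> sqrt (2 * pi)"
  proof (rule saddle_point)
    show "0 < t (n + m)" for n by (rule t_pos) (simp add: m_def)
    show "t (n + m) \<le> exp (-4)" for n using n0[of "n + m"] by (simp add: m_def)
    show "(\<lambda>n. t (n + m)) \<longlonglongrightarrow> 0" using t_LIMSEQ by (rule LIMSEQ_ignore_initial_segment)
    show "real (n + m) * t (n + m) = euler_mascheroni - ln (t (n + m))" for n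
      using ln_t[of "n + m"] nt[of "n + m"] by (simp add: m_def)
  qed
  then have "(\<lambda>n. P_coeff (n + m) * exp (- w (n + m)) * exp (- divisor_series (exp (- t (n + m)))) *
    (2 * pi * sqrt (- ln (t (n + m))) / t (n + m))) \<longlonglongrightarrow> sqrt (2 * pi)"
    by (subst (asm) nt) (simp_all add: m_def)
  then show ?thesis by (rule LIMSEQ_offset)
qed

text \<open>The asymptotics are stated in 1 - exp(-t). Passing to t changes the logarithm by O(t),
  which remains negligible after multiplication by the diverging logarithm in the square.\<close>

lemma divisor_series_at_t:
  "(\<lambda>n. divisor_series (exp (- t n)) - ((ln (t n))\<^sup>2 / 2 - euler_mascheroni * ln (t n))) \<longlonglongrightarrow>
     pi\<^sup>2 / 12 - euler_mascheroni\<^sup>2 / 2 - 2 * stieltjes 1"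
proof -
  have tr: "filterlim t (at_right 0) sequentially"
    unfolding filterlim_at using t_LIMSEQ
    by (auto intro!: eventually_mono[OF eventually_ge_at_top[of 1]] dest!: t_pos)
  have "filterlim (\<lambda>x::real. exp (- x)) (at_left 1) (at_right 0)" by real_asymp
  then have "filterlim (\<lambda>n. exp (- t n)) (at_left 1) sequentially" using tr by (rule filterlim_compose)
  with divisor_series_asymp
  have 1: "(\<lambda>n. divisor_series (exp (- t n)) - ((ln (1 - exp (- t n)))\<^sup>2 / 2 - euler_mascheroni * ln (1 - exp (- t n))))
      \<longlonglongrightarrow> pi\<^sup>2 / 12 - euler_mascheroni\<^sup>2 / 2 - 2 * stieltjes 1"
    by (rule filterlim_compose)
  have "((\<lambda>x::real. (ln (1 - exp (- x)))\<^sup>2 / 2 - (ln x)\<^sup>2 / 2) \<longlongrightarrow> 0) (at_right 0)" by real_asymp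
  then have 2: "(\<lambda>n. (ln (1 - exp (- t n)))\<^sup>2 / 2 - (ln (t n))\<^sup>2 / 2) \<longlonglongrightarrow> 0" using tr by (rule filterlim_compose)
  have "((\<lambda>x::real. ln (1 - exp (- x)) - ln x) \<longlongrightarrow> 0) (at_right 0)" by real_asymp
  then have 3: "(\<lambda>n. ln (1 - exp (- t n)) - ln (t n)) \<longlonglongrightarrow> 0" using tr by (rule filterlim_compose)
  from tendsto_diff[OF tendsto_add[OF 1 2] tendsto_mult[OF tendsto_const[of euler_mascheroni] 3]]
  show ?thesis by (simp add: algebra_simps)
qed

lemma P_coeff_ratio:
  fixes c :: real
  defines "c \<equiv> pi\<^sup>2 / 12 - euler_mascheroni\<^sup>2 / 2 - 2 * stieltjes 1"
  defines "R \<equiv> (\<lambda>n. (w n / real n) powr (1 - euler_mascheroni) / sqrt (2 * pi * ln (real n / w n)) *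
            exp (c + w n + (ln (w n / real n))\<^sup>2 / 2))"
  shows "(\<lambda>n. P_coeff n / R n) \<longlonglongrightarrow> 1"
proof -
  define F where "F = (\<lambda>n. divisor_series (exp (- t n)))"
  define Q where "Q = (\<lambda>n. P_coeff n * exp (- w n) * exp (- F n) * (2 * pi * sqrt (- ln (t n)) / t n))"
  have "(\<lambda>n. F n - ((ln (t n))\<^sup>2 / 2 - euler_mascheroni * ln (t n)) - c) \<longlonglongrightarrow> c - c"
    unfolding F_def c_def by (intro tendsto_diff divisor_series_at_t tendsto_const)
  from tendsto_exp[OF this]
  have "(\<lambda>n. exp (F n - ((ln (t n))\<^sup>2 / 2 - euler_mascheroni * ln (t n)) - c)) \<longlonglongrightarrow> 1" by simp
  moreover have "Q \<longlonglongrightarrow> sqrt (2 * pi)" using P_coeff_saddle by (simp add: Q_def F_def)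
  ultimately have lim: "(\<lambda>n. Q n * exp (F n - ((ln (t n))\<^sup>2 / 2 - euler_mascheroni * ln (t n)) - c) / sqrt (2 * pi))
      \<longlonglongrightarrow> sqrt (2 * pi) * 1 / sqrt (2 * pi)"
    by (intro tendsto_intros) auto
  have "eventually (\<lambda>n. w n > euler_mascheroni) sequentially"
    using w_at_top by (simp add: filterlim_at_top_dense)
  then have ev: "eventually (\<lambda>n. Q n * exp (F n - ((ln (t n))\<^sup>2 / 2 - euler_mascheroni * ln (t n)) - c) / sqrt (2 * pi)
      = P_coeff n / R n) sequentially"
    using eventually_ge_at_top[of 1]
  proof eventually_elim
    case (elim n)
    define s where "s = sqrt (- ln (t n))"
    have tn: "t n > 0" using elim t_pos by simp
    have l: "- ln (t n) > 0" using ln_t elim by simp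
    then have s: "s > 0" by (simp add: s_def)
    have "ln (real n / w n) = - ln (t n)"
      using elim w_pos[of n] by (simp add: t_def ln_div)
    then have R: "R n = t n powr (1 - euler_mascheroni) / (sqrt (2 * pi) * s) * exp (c + w n + (ln (t n))\<^sup>2 / 2)"
      unfolding R_def t_def s_def by (simp only: real_sqrt_mult)
    \<comment> \<open>The exponent 1 - \<gamma> has two sources: t from the width of the peak, and t
      powr (-\<gamma>) from the term -\<gamma> ln t of F.\<close>
    have p: "t n powr (1 - euler_mascheroni) = t n * exp (- (euler_mascheroni * ln (t n)))"
      using tn by (simp add: powr_def left_diff_distrib exp_diff exp_minus field_simps)
    define q where "q = sqrt (2 * pi)"
    have q: "q > 0" by (simp add: q_def)
    have Qn: "Q n = P_coeff n * exp (- w n) * exp (- F n) * (q * q * s / t n)"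
      by (simp add: Q_def s_def q_def)
    have "Q n * exp (F n - ((ln (t n))\<^sup>2 / 2 - euler_mascheroni * ln (t n)) - c) / sqrt (2 * pi) =
        P_coeff n * (exp (- w n) * exp (- F n) * exp (F n - ((ln (t n))\<^sup>2 / 2 - euler_mascheroni * ln (t n)) - c)) *
        (sqrt (2 * pi) * s / t n)"
      unfolding Qn q_def[symmetric] using q by simp
    also have "exp (- w n) * exp (- F n) * exp (F n - ((ln (t n))\<^sup>2 / 2 - euler_mascheroni * ln (t n)) - c) =
        exp (euler_mascheroni * ln (t n)) * exp (- (c + w n + (ln (t n))\<^sup>2 / 2))"
      by (simp add: exp_add[symmetric])
    also have "P_coeff n * (exp (euler_mascheroni * ln (t n)) * exp (- (c + w n + (ln (t n))\<^sup>2 / 2))) *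
        (sqrt (2 * pi) * s / t n) = P_coeff n / R n"
      unfolding R p exp_minus by (simp add: divide_simps)
    finally show ?case .
  qed
  from Lim_transform_eventually[OF lim ev] show ?thesis by simp
qed

text \<open>In terms of w, ln n = w + ln w - \<gamma> and ln t = \<gamma> - w, so the logarithm of
  the main term and ln^2(n)/2 are elementary functions of w, both dominated by w^2/2.\<close>

lemma ln_P_coeff_asymp: "(\<lambda>n. ln (P_coeff n)) \<sim>[sequentially] (\<lambda>n. (ln (real n))\<^sup>2 / 2)"
proof -
  define \<gamma> :: real where "\<gamma> = euler_mascheroni"
  define c :: real where "c = pi\<^sup>2 / 12 - euler_mascheroni\<^sup>2 / 2 - 2 * stieltjes 1"
  define R where "R = (\<lambda>n. (w n / real n) powr (1 - euler_mascheroni) / sqrt (2 * pi * ln (real n / w n)) *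
            exp (c + w n + (ln (w n / real n))\<^sup>2 / 2))"
  have ratio: "(\<lambda>n. P_coeff n / R n) \<longlonglongrightarrow> 1" unfolding R_def c_def by (rule P_coeff_ratio)
  then have lnr: "(\<lambda>n. ln (P_coeff n / R n)) \<longlonglongrightarrow> 0"
    using tendsto_ln[OF ratio] by simp
  define A where "A = (\<lambda>x::real. ((1 - \<gamma>) * (\<gamma> - x) - ln (2 * pi * (x - \<gamma>)) / 2 + (c + x + (\<gamma> - x)\<^sup>2 / 2)) /
      ((x + ln x - \<gamma>)\<^sup>2 / 2))"
  have "(A \<longlongrightarrow> 1) at_top" unfolding A_def by real_asymp
  then have A: "(\<lambda>n. A (w n)) \<longlonglongrightarrow> 1" using w_at_top by (rule filterlim_compose)
  have "((\<lambda>x::real. 1 / ((ln x)\<^sup>2 / 2)) \<longlongrightarrow> 0) at_top" by real_asymp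
  then have inv: "(\<lambda>n. 1 / ((ln (real n))\<^sup>2 / 2)) \<longlonglongrightarrow> 0"
    using filterlim_real_sequentially by (rule filterlim_compose)
  have lim: "(\<lambda>n. ln (P_coeff n / R n) * (1 / ((ln (real n))\<^sup>2 / 2)) + A (w n)) \<longlonglongrightarrow> 0 * 0 + 1"
    by (intro tendsto_intros lnr inv A)
  have evw: "eventually (\<lambda>n. w n > \<gamma>) sequentially"
    using w_at_top by (simp add: filterlim_at_top_dense)
  have evr: "eventually (\<lambda>n. P_coeff n / R n > 0) sequentially"
    using ratio by (rule order_tendstoD) simp
  have "eventually (\<lambda>n. ln (P_coeff n / R n) * (1 / ((ln (real n))\<^sup>2 / 2)) + A (w n) =
      ln (P_coeff n) / ((ln (real n))\<^sup>2 / 2)) sequentially"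
    using evw evr eventually_ge_at_top[of 1]
  proof eventually_elim
    case (elim n)
    have tn: "t n > 0" using elim t_pos by simp
    have ln1: "ln (w n / real n) = \<gamma> - w n" using ln_t elim by (simp add: t_def \<gamma>_def)
    have ln2: "ln (real n / w n) = w n - \<gamma>"
      using ln1 elim w_pos[of n] by (simp add: ln_div)
    have sq: "sqrt (2 * pi * (w n - \<gamma>)) > 0" using elim by simp
    have Rpos: "R n > 0"
      unfolding R_def ln2 by (intro mult_pos_pos divide_pos_pos) (use sq tn elim w_pos[of n] in auto)
    have "ln (R n) = (1 - \<gamma>) * (\<gamma> - w n) - ln (2 * pi * (w n - \<gamma>)) / 2 + (c + w n + (\<gamma> - w n)\<^sup>2 / 2)"
    proof -
      have ln_quotient: "ln (a / b * exp z) = ln a - ln b + z" if "a > 0" "b > 0" for a b z :: real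
        using that by (simp add: ln_mult_pos ln_div)
      have "ln (R n) = ln ((w n / real n) powr (1 - \<gamma>)) - ln (sqrt (2 * pi * (w n - \<gamma>))) + (c + w n + (\<gamma> - w n)\<^sup>2 / 2)"
        unfolding R_def ln1 ln2 \<gamma>_def[symmetric]
        by (rule ln_quotient) (use sq tn elim w_pos[of n] in auto)
      also have "ln ((w n / real n) powr (1 - \<gamma>)) = (1 - \<gamma>) * (\<gamma> - w n)"
        using tn by (simp add: ln_powr ln1 t_def)
      also have "ln (sqrt (2 * pi * (w n - \<gamma>))) = ln (2 * pi * (w n - \<gamma>)) / 2"
        using elim by (simp add: ln_sqrt)
      finally show ?thesis .
    qed
    then have "A (w n) = ln (R n) / ((ln (real n))\<^sup>2 / 2)"
      using ln_n[of n] elim by (simp add: A_def \<gamma>_def)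
    moreover have "ln (P_coeff n) = ln (P_coeff n / R n) + ln (R n)"
    proof -
      have "P_coeff n > 0" using elim Rpos by (simp add: zero_less_divide_iff)
      then show ?thesis using Rpos by (simp add: ln_div)
    qed
    ultimately show ?case by (simp add: add_divide_distrib)
  qed
  from Lim_transform_eventually[OF lim this] show ?thesis
    by (intro asymp_equivI') simp
qed

end

theorem theorem1p2:
  fixes \<gamma> c :: real and w :: "nat \<Rightarrow> real"
  defines "\<gamma> \<equiv> euler_mascheroni"
  defines "c \<equiv> pi\<^sup>2 / 12 - \<gamma>\<^sup>2 / 2 - 2 * stieltjes 1"
  defines "w \<equiv> (\<lambda>n. Lambert_W (exp \<gamma> * real n))"
  shows "(\<forall>n. p_seq n = of_nat (card (divisor_labelled_perms n))) \<and>
    (\<lambda>n. real_of_rat (p_seq n) / fact n) \<sim>[sequentially]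
      (\<lambda>n. (w n / real n) powr (1 - \<gamma>) / sqrt (2 * pi * ln (real n / w n)) *
            exp (c + w n + (ln (w n / real n))\<^sup>2 / 2)) \<and>
    (\<lambda>n. ln (real_of_rat (p_seq n) / fact n)) \<sim>[sequentially] (\<lambda>n. (ln (real n))\<^sup>2 / 2)"
proof (intro conjI allI)
  have p: "real_of_rat (p_seq n) / fact n = P_coeff n" for n
  proof -
    have "real_of_rat (fact n) = fact n" by (metis of_nat_fact of_rat_of_nat_eq)
    then show ?thesis by (simp add: p_seq_def P_coeff_def of_rat_mult)
  qed
  show "p_seq n = of_nat (card (divisor_labelled_perms n))" for n by (rule p_seq_eq_card)
  show "(\<lambda>n. real_of_rat (p_seq n) / fact n) \<sim>[sequentially]
      (\<lambda>n. (w n / real n) powr (1 - \<gamma>) / sqrt (2 * pi * ln (real n / w n)) *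
            exp (c + w n + (ln (w n / real n))\<^sup>2 / 2))"
    unfolding p w_def c_def \<gamma>_def by (intro asymp_equivI' P_coeff_ratio)
  show "(\<lambda>n. ln (real_of_rat (p_seq n) / fact n)) \<sim>[sequentially] (\<lambda>n. (ln (real n))\<^sup>2 / 2)"
    unfolding p by (rule ln_P_coeff_asymp)
qed

end
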